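(* Let $\Gamma$ be a countable group. For every $n\in\mathbb N$, let $\Gamma\curvearrowright (X_n,\mu_n)$ be a free ergodic p.m.p. action such that the diagonal action $\Gamma\curvearrowright (X_n\times X_n,\mu_n\times\mu_n)$ has spectral gap. Assume that we can find $F_{n,k}\in L^{\infty}(X_n)$, for all $n,k\in\mathbb N$, such that $\sup_{n,k}\|F_{n,k}\|_{\infty}\leq 1$, $\inf_{n,k}\|F_{n,k}\|_2>0$, and (i) $F_{n,k}\rightarrow 0$ weakly in $L^2(X_n)$, as $k\rightarrow\infty$, for every $n\in\mathbb N$; (ii) $\lim_{n\rightarrow\infty}\big(\sup_{k\in\mathbb N}\|F_{n,k}\circ g-F_{n,k}\|_2\big)=0$, for every $g\in\Gamma$. Consider the diagonal action $\Gamma\curvearrowright (X,\mu)=\prod_{n\in\mathbb N}(X_n,\mu_n)$ given by $g\cdot x=(g\cdot x_n)_n$, for all $g\in\Gamma$ and $x=(x_n)_n\in X$. Then the orbit equivalence relation $\mathcal R(\Gamma\curvearrowright X)=\{(x,y)\in X^2:\Gamma\cdot x=\Gamma\cdot y\}$ does not have the Jones–Schmidt property.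
   Context: Probability spaces are standard; p.m.p. means probability measure preserving. A p.m.p. action $\Gamma\curvearrowright(Z,\zeta)$ has spectral gap if the Koopman representation of $\Gamma$ on $L^2(Z)\ominus\mathbb C1$ has spectral gap, i.e. does not weakly contain the trivial representation (there is no sequence of unit vectors $\xi_m$ with $\|g\xi_m-\xi_m\|\to0$ for all $g\in\Gamma$). For a countable p.m.p. equivalence relation $\mathcal R$ on $(X,\mu)$, $[x]_{\mathcal R}$ is the class of $x$ and the full group $[\mathcal R]$ is the group of automorphisms $\alpha$ of $(X,\mu)$ with $(\alpha(x),x)\in\mathcal R$ for a.e. $x$. $\mathcal R$ is strongly ergodic if every sequence of measurable sets $A_n\subset X$ with $\mu(\alpha(A_n)\triangle A_n)\to0$ for all $\alpha\in[\mathcal R]$ satisfies $\mu(A_n)(1-\mu(A_n))\to0$. Jones–Schmidt property: a countable ergodic p.m.p. equivalence relation $\mathcal S$ on $(X,\mu)$ has the Jones–Schmidt property if there exist a hyperfinite ergodic p.m.p. equivalence relation $\mathcal T$ on a probability space $(Y,\nu)$ and a factor map (measurable, measure preserving) $\pi:(X,\mu)\to(Y,\nu)$ such that (1) $\pi([x]_{\mathcal S})=[\pi(x)]_{\mathcal T}$ for almost every $x\in X$, and (2) $\mathcal S_0=\{(x_1,x_2)\in\mathcal S:\pi(x_1)=\pi(x_2)\}$ is strongly ergodic on almost every ergodic component of $\mathcal S_0$. *)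

theory Defs
  imports "HOL-Probability.Probability" "HOL-Algebra.Group_Action"
begin

section \<open>Standard probability spaces and their automorphisms\<close>

definition standard_borel :: "'a measure \<Rightarrow> bool" where
  "standard_borel M \<longleftrightarrow>
     (\<exists>T. completely_metrizable_space T \<and> second_countable T \<and> topspace T = space M \<and>
          sets M = sigma_sets (space M) {U. openin T U})"

definition standard_prob_space :: "'a measure \<Rightarrow> bool" where
  "standard_prob_space M \<longleftrightarrow> prob_space M \<and> standard_borel M"

definition measure_preserving_map :: "'a measure \<Rightarrow> 'b measure \<Rightarrow> ('a \<Rightarrow> 'b) \<Rightarrow> bool" where
  "measure_preserving_map M N f \<longleftrightarrow> f \<in> M \<rightarrow>\<^sub>M N \<and> distr M N f = N"

definition borel_automorphism :: "'a measure \<Rightarrow> ('a \<Rightarrow> 'a) \<Rightarrow> bool" where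
  "borel_automorphism M \<alpha> \<longleftrightarrow>
     bij_betw \<alpha> (space M) (space M) \<and> \<alpha> \<in> M \<rightarrow>\<^sub>M M \<and> inv_into (space M) \<alpha> \<in> M \<rightarrow>\<^sub>M M"


section \<open>Square-integrable and essentially bounded functions\<close>

text \<open>Elements of the function spaces are represented by measurable functions; nothing below
  distinguishes functions that agree almost everywhere.\<close>

definition L2 :: "'a measure \<Rightarrow> ('a \<Rightarrow> complex) set" where
  "L2 M = {f \<in> borel_measurable M. integrable M (\<lambda>x. (cmod (f x))\<^sup>2)}"

definition L2_norm :: "'a measure \<Rightarrow> ('a \<Rightarrow> complex) \<Rightarrow> real" where
  "L2_norm M f = sqrt (\<integral>x. (cmod (f x))\<^sup>2 \<partial>M)"

definition L2_inner :: "'a measure \<Rightarrow> ('a \<Rightarrow> complex) \<Rightarrow> ('a \<Rightarrow> complex) \<Rightarrow> complex" where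
  "L2_inner M f h = (\<integral>x. f x * cnj (h x) \<partial>M)"

definition L2_weakly_tendsto ::
    "'a measure \<Rightarrow> (nat \<Rightarrow> 'a \<Rightarrow> complex) \<Rightarrow> ('a \<Rightarrow> complex) \<Rightarrow> bool" where
  "L2_weakly_tendsto M F f \<longleftrightarrow>
     (\<forall>h\<in>L2 M. (\<lambda>k. L2_inner M (F k) h) \<longlonglongrightarrow> L2_inner M f h)"

definition Linf_norm :: "'a measure \<Rightarrow> ('a \<Rightarrow> complex) \<Rightarrow> ereal" where
  "Linf_norm M f = esssup M (\<lambda>x. ereal (cmod (f x)))"

definition Linf :: "'a measure \<Rightarrow> ('a \<Rightarrow> complex) set" where
  "Linf M = {f \<in> borel_measurable M. Linf_norm M f < \<infinity>}"


section \<open>Probability measure preserving actions\<close>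

definition pmp_action ::
    "('g, 'r) monoid_scheme \<Rightarrow> 'a measure \<Rightarrow> ('g \<Rightarrow> 'a \<Rightarrow> 'a) \<Rightarrow> bool" where
  "pmp_action G M a \<longleftrightarrow>
     standard_prob_space M \<and> group_action G (space M) a \<and>
     (\<forall>g\<in>carrier G. measure_preserving_map M M (a g))"

definition free_action ::
    "('g, 'r) monoid_scheme \<Rightarrow> 'a measure \<Rightarrow> ('g \<Rightarrow> 'a \<Rightarrow> 'a) \<Rightarrow> bool" where
  "free_action G M a \<longleftrightarrow>
     (AE x in M. \<forall>g\<in>carrier G. g \<noteq> \<one>\<^bsub>G\<^esub> \<longrightarrow> a g x \<noteq> x)"

definition ergodic_action ::
    "('g, 'r) monoid_scheme \<Rightarrow> 'a measure \<Rightarrow> ('g \<Rightarrow> 'a \<Rightarrow> 'a) \<Rightarrow> bool" where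
  "ergodic_action G M a \<longleftrightarrow>
     (\<forall>A\<in>sets M. (\<forall>g\<in>carrier G. a g ` A = A) \<longrightarrow> measure M A = 0 \<or> measure M A = 1)"

definition koopman ::
    "('g, 'r) monoid_scheme \<Rightarrow> ('g \<Rightarrow> 'a \<Rightarrow> 'a) \<Rightarrow> 'g \<Rightarrow> ('a \<Rightarrow> complex) \<Rightarrow> 'a \<Rightarrow> complex" where
  "koopman G a g f = (\<lambda>x. f (a (inv\<^bsub>G\<^esub> g) x))"

text \<open>The condition \<open>L2_inner M (\<xi> m) (\<lambda>_. 1) = 0\<close> places \<open>\<xi> m\<close> in the orthogonal complement
  of the constant functions.\<close>

definition spectral_gap ::
    "('g, 'r) monoid_scheme \<Rightarrow> 'a measure \<Rightarrow> ('g \<Rightarrow> 'a \<Rightarrow> 'a) \<Rightarrow> bool" where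
  "spectral_gap G M a \<longleftrightarrow>
     \<not> (\<exists>\<xi> :: nat \<Rightarrow> 'a \<Rightarrow> complex.
          (\<forall>m. \<xi> m \<in> L2 M \<and> L2_inner M (\<xi> m) (\<lambda>_. 1) = 0 \<and> L2_norm M (\<xi> m) = 1) \<and>
          (\<forall>g\<in>carrier G. (\<lambda>m. L2_norm M (\<lambda>x. koopman G a g (\<xi> m) x - \<xi> m x)) \<longlonglongrightarrow> 0))"

text \<open>Maps of a \<^const>\<open>group_action\<close> on \<open>E\<close> are required to be extensional on \<open>E\<close>,
  hence the restrictions.\<close>

definition diagonal_square_action :: "'a measure \<Rightarrow> ('g \<Rightarrow> 'a \<Rightarrow> 'a) \<Rightarrow> 'g \<Rightarrow> 'a \<times> 'a \<Rightarrow> 'a \<times> 'a" where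
  "diagonal_square_action M a g = (\<lambda>p\<in>space (M \<Otimes>\<^sub>M M). (a g (fst p), a g (snd p)))"

definition diagonal_action ::
    "(nat \<Rightarrow> 'a measure) \<Rightarrow> (nat \<Rightarrow> 'g \<Rightarrow> 'a \<Rightarrow> 'a) \<Rightarrow> 'g \<Rightarrow> (nat \<Rightarrow> 'a) \<Rightarrow> (nat \<Rightarrow> 'a)" where
  "diagonal_action X a g = (\<lambda>x\<in>space (\<Pi>\<^sub>M n\<in>UNIV. X n). (\<lambda>n. a n g (x n)))"

definition orbit_relation ::
    "('g, 'r) monoid_scheme \<Rightarrow> 'a measure \<Rightarrow> ('g \<Rightarrow> 'a \<Rightarrow> 'a) \<Rightarrow> ('a \<times> 'a) set" where
  "orbit_relation G M a = {(x, y) \<in> space M \<times> space M. orbit G a x = orbit G a y}"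


section \<open>Countable p.m.p. equivalence relations\<close>

definition countable_pmp_eqrel :: "'a measure \<Rightarrow> ('a \<times> 'a) set \<Rightarrow> bool" where
  "countable_pmp_eqrel M R \<longleftrightarrow>
     standard_prob_space M \<and> equiv (space M) R \<and> R \<in> sets (M \<Otimes>\<^sub>M M) \<and>
     (\<forall>x\<in>space M. countable (R `` {x})) \<and>
     (\<forall>\<alpha>. borel_automorphism M \<alpha> \<and> (\<forall>x\<in>space M. (\<alpha> x, x) \<in> R)
          \<longrightarrow> measure_preserving_map M M \<alpha>)"

definition ergodic_eqrel :: "'a measure \<Rightarrow> ('a \<times> 'a) set \<Rightarrow> bool" where
  "ergodic_eqrel M R \<longleftrightarrow>
     (\<forall>A\<in>sets M. R `` A = A \<longrightarrow> measure M A = 0 \<or> measure M A = 1)"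

definition hyperfinite_eqrel :: "'a measure \<Rightarrow> ('a \<times> 'a) set \<Rightarrow> bool" where
  "hyperfinite_eqrel M R \<longleftrightarrow>
     (\<exists>E :: nat \<Rightarrow> ('a \<times> 'a) set.
        (\<forall>n. equiv (space M) (E n) \<and> E n \<in> sets (M \<Otimes>\<^sub>M M) \<and> E n \<subseteq> R \<and>
             E n \<subseteq> E (Suc n) \<and> (\<forall>x\<in>space M. finite (E n `` {x}))) \<and>
        (AE x in M. R `` {x} = (\<Union>n. E n `` {x})))"

definition full_group :: "'a measure \<Rightarrow> ('a \<times> 'a) set \<Rightarrow> ('a \<Rightarrow> 'a) set" where
  "full_group M R =
     {\<alpha>. borel_automorphism M \<alpha> \<and> measure_preserving_map M M \<alpha> \<and> (AE x in M. (\<alpha> x, x) \<in> R)}"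

definition strongly_ergodic :: "'a measure \<Rightarrow> ('a \<times> 'a) set \<Rightarrow> bool" where
  "strongly_ergodic M R \<longleftrightarrow>
     (\<forall>A :: nat \<Rightarrow> 'a set.
        (\<forall>n. A n \<in> sets M) \<and>
        (\<forall>\<alpha>\<in>full_group M R. (\<lambda>n. measure M ((\<alpha> ` A n - A n) \<union> (A n - \<alpha> ` A n))) \<longlonglongrightarrow> 0)
        \<longrightarrow> (\<lambda>n. measure M (A n) * (1 - measure M (A n))) \<longlonglongrightarrow> 0)"

text \<open>The ergodic decomposition of \<open>R\<close> (Farrell, Varadarajan) is the essentially unique
  invariant measurable map \<open>\<kappa>\<close> sending a point to the ergodic invariant probability measure of
  its ergodic component; the component of \<open>x\<close> is \<open>{y. \<kappa> y = \<kappa> x}\<close>, equipped with \<open>\<kappa> x\<close>. The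
  components are thus indexed by the measures themselves, and ``almost every component'' means
  \<open>\<kappa> x\<close> for almost every \<open>x\<close>.\<close>

definition ergodic_decomposition ::
    "'a measure \<Rightarrow> ('a \<times> 'a) set \<Rightarrow> ('a \<Rightarrow> 'a measure) \<Rightarrow> bool" where
  "ergodic_decomposition M R \<kappa> \<longleftrightarrow>
     \<kappa> \<in> M \<rightarrow>\<^sub>M prob_algebra M \<and>
     (\<forall>(x, y)\<in>R. \<kappa> x = \<kappa> y) \<and>
     (\<forall>A\<in>sets M. emeasure M A = (\<integral>\<^sup>+x. emeasure (\<kappa> x) A \<partial>M)) \<and>
     (AE x in M. (AE y in \<kappa> x. \<kappa> y = \<kappa> x) \<and>
                 countable_pmp_eqrel (\<kappa> x) R \<and> ergodic_eqrel (\<kappa> x) R)"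

definition strongly_ergodic_on_components :: "'a measure \<Rightarrow> ('a \<times> 'a) set \<Rightarrow> bool" where
  "strongly_ergodic_on_components M R \<longleftrightarrow>
     (\<exists>\<kappa>. ergodic_decomposition M R \<kappa> \<and> (AE x in M. strongly_ergodic (\<kappa> x) R))"


section \<open>The Jones--Schmidt property\<close>

text \<open>The type argument is the type carrying the quotient space \<open>N\<close>, since a definition cannot
  quantify over types. Every standard probability space is isomorphic to one carried by the
  reals, so \<open>'y = real\<close> already gives the full notion; a statement refuting the property for a
  type variable \<open>'y\<close> refutes it for quotient spaces on every type. The relation \<open>S\<close> is meant to
  be a countable ergodic p.m.p. equivalence relation on \<open>M\<close>; this is not part of the
  definition, so that a refutation always refutes the existence of the data.\<close>

definition jones_schmidt :: "'y itself \<Rightarrow> 'a measure \<Rightarrow> ('a \<times> 'a) set \<Rightarrow> bool" where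
  "jones_schmidt _ M S \<longleftrightarrow>
     (\<exists>(N :: 'y measure) T \<pi>.
        countable_pmp_eqrel N T \<and> hyperfinite_eqrel N T \<and> ergodic_eqrel N T \<and>
        measure_preserving_map M N \<pi> \<and>
        (AE x in M. \<pi> ` (S `` {x}) = T `` {\<pi> x}) \<and>
        strongly_ergodic_on_components M {(x\<^sub>1, x\<^sub>2) \<in> S. \<pi> x\<^sub>1 = \<pi> x\<^sub>2})"

end

(*
  Suppose R(G, X) had the Jones-Schmidt property, with quotient map pi onto a hyperfinite relation
  exhausted by finite relations E_m, and let S_0 be the kernel relation.

  Put F_n = F_{n,k(n)} o pr_n. By (ii) this sequence is asymptotically invariant under G, so strong
  ergodicity of S_0 on its ergodic components (applied to the level sets of F_n) puts F_n close in
  L^2 to its S_0-invariant conditional expectation. Hence for some fixed n all F_{n,k}, k in N, are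
  uniformly close to S_0-invariant functions g_k.

  Spectral gap of X_n x X_n is stable: since matrix coefficients of L^2_0(X_n) decay in l^2 along a
  random walk on G, the G-action on L^2_0(X_n) (x) L^2(M) has a gap for every p.m.p. action on M.
  Viewing X as X_n times itself by resampling the n-th coordinate, a function on X that is almost
  invariant under a finite set K is close to its average over the n-th coordinate.

  Let Q be a high power of the Markov operator averaging over those moves in K that stay within the
  extension of S_0 by E_m. Split X into pieces B_j by finitely many labels of pi(x) such that (up to
  small measure) g_k is constant on B_j within each extended class. Then
  w_j = Q(1_{B_j} g_k) / sqrt(Q 1_{B_j}) satisfies sum_j w_j^2 = Q(g_k^2), and
  |w_j(hx) - w_j(x)|^2 <= |Q 1_{B_j}(hx) - Q 1_{B_j}(x)| shows that the w_j are almost K-invariant.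
  Replacing g_k by F_{n,k} changes the w_j little, while the averages over the n-th coordinate then
  tend to 0 as k grows, by (i). The gap forces sum_j |w_j|_2^2 to be small, so F_{n,k} is small in
  L^2, a contradiction.
*)
theory Submission
  imports Defs
begin

section \<open>Bounded real functions and the squared L2 norm\<close>

section \<open>Bounded measurable functions\<close>

text \<open>The g_k vary with k and are invariant only under the kernel relation, so their own
  motion under K cannot be made small uniformly in k. The motion of the weights Q 1_{B_j} does not
  involve k, and it vanishes as the power of the averaging operator grows. The square root in w_j
  passes this on to all k at once, while the labels keep the values of g_k on different kernel
  classes from cancelling in the average. Hence the order of limits: k, then the power, then the
  number of labels, then m, with n, K and the gap constant fixed.

  The square of X_n enters because a gap on X_n alone controls averages of signed matrix
  coefficients, and a second action can undo the signs. On X_n x X_n the coefficients appear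
  squared.

  All work is done with bounded real functions. If c bounds the norms of the F_{n,k} from below, the
  clamped real or imaginary part keeps a squared norm of at least c^2/2. The argument ends in c^2/2
  <= 10 eps, where eps bounds the squared distance to the g_k; the value eps = c^2/40 contradicts
  this.\<close>

definition sqn :: "'a measure \<Rightarrow> ('a \<Rightarrow> real) \<Rightarrow> real" where
  "sqn M f = (\<integral>x. (f x)\<^sup>2 \<partial>M)"

text \<open>The bound holds at every point of the space, not just almost everywhere, so it survives
  composition with measurable maps and restriction to sections of a product.\<close>

definition bdd_meas :: "'a measure \<Rightarrow> ('a \<Rightarrow> real) \<Rightarrow> bool" where
  "bdd_meas M f \<longleftrightarrow> f \<in> borel_measurable M \<and> (\<exists>B. \<forall>x\<in>space M. \<bar>f x\<bar> \<le> B)"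

lemma bdd_measI: "f \<in> borel_measurable M \<Longrightarrow> (\<And>x. x \<in> space M \<Longrightarrow> \<bar>f x\<bar> \<le> B) \<Longrightarrow> bdd_meas M f"
  by (auto simp: bdd_meas_def)

lemma bdd_meas_measurable [measurable_dest]: "bdd_meas M f \<Longrightarrow> f \<in> borel_measurable M"
  by (simp add: bdd_meas_def)

lemma bdd_measE:
  assumes "bdd_meas M f"
  obtains B where "0 \<le> B" "\<And>x. x \<in> space M \<Longrightarrow> \<bar>f x\<bar> \<le> B"
proof -
  obtain B where B: "\<forall>x\<in>space M. \<bar>f x\<bar> \<le> B" using assms by (auto simp: bdd_meas_def)
  show thesis by (rule that[of "\<bar>B\<bar>"]) (use B in force)+
qed

lemma bdd_meas_const [intro, simp]: "bdd_meas M (\<lambda>_. c)"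
  by (rule bdd_measI[of _ _ "\<bar>c\<bar>"]) auto

lemma bdd_meas_indicator [intro]: "A \<in> sets M \<Longrightarrow> bdd_meas M (indicator A)"
  by (rule bdd_measI[of _ _ 1]) (auto simp: indicator_def)

lemma bdd_meas_add [intro]:
  assumes "bdd_meas M f" "bdd_meas M g" shows "bdd_meas M (\<lambda>x. f x + g x)"
proof -
  obtain B where "\<And>x. x \<in> space M \<Longrightarrow> \<bar>f x\<bar> \<le> B" using bdd_measE[OF assms(1)] by metis
  moreover obtain C where "\<And>x. x \<in> space M \<Longrightarrow> \<bar>g x\<bar> \<le> C" using bdd_measE[OF assms(2)] by metis
  ultimately show ?thesis using assms[THEN bdd_meas_measurable]
    by (intro bdd_measI[of _ _ "B + C"]) (auto intro: order.trans[OF abs_triangle_ineq] add_mono)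
qed

lemma bdd_meas_mult [intro]:
  assumes "bdd_meas M f" "bdd_meas M g" shows "bdd_meas M (\<lambda>x. f x * g x)"
proof -
  obtain B where "0 \<le> B" "\<And>x. x \<in> space M \<Longrightarrow> \<bar>f x\<bar> \<le> B" using bdd_measE[OF assms(1)] by metis
  moreover obtain C where "\<And>x. x \<in> space M \<Longrightarrow> \<bar>g x\<bar> \<le> C" using bdd_measE[OF assms(2)] by metis
  ultimately show ?thesis using assms[THEN bdd_meas_measurable]
    by (intro bdd_measI[of _ _ "B * C"]) (auto simp: abs_mult intro: mult_mono)
qed

lemma bdd_meas_uminus [intro]: "bdd_meas M f \<Longrightarrow> bdd_meas M (\<lambda>x. - f x)"
  using bdd_meas_mult[of M "\<lambda>_. -1" f] by simp

lemma bdd_meas_diff [intro]: "bdd_meas M f \<Longrightarrow> bdd_meas M g \<Longrightarrow> bdd_meas M (\<lambda>x. f x - g x)"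
  using bdd_meas_add[of M f "\<lambda>x. - g x"] bdd_meas_uminus by auto

lemma bdd_meas_divide [intro]: "bdd_meas M f \<Longrightarrow> bdd_meas M (\<lambda>x. f x / c)"
  using bdd_meas_mult[of M f "\<lambda>_. inverse c"] by (simp add: divide_inverse)

lemma bdd_meas_power2 [intro]: "bdd_meas M f \<Longrightarrow> bdd_meas M (\<lambda>x. (f x)\<^sup>2)"
  using bdd_meas_mult[of M f f] by (simp add: power2_eq_square)

lemma bdd_meas_abs [intro]: "bdd_meas M f \<Longrightarrow> bdd_meas M (\<lambda>x. \<bar>f x\<bar>)"
  by (auto simp: bdd_meas_def)

lemma bdd_meas_sum [intro]:
  assumes "\<And>i. i \<in> I \<Longrightarrow> bdd_meas M (f i)" shows "bdd_meas M (\<lambda>x. \<Sum>i\<in>I. f i x)"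
  using assms by (induction I rule: infinite_finite_induct) auto

lemma bdd_meas_comp:
  assumes "bdd_meas N f" "\<tau> \<in> M \<rightarrow>\<^sub>M N" shows "bdd_meas M (\<lambda>x. f (\<tau> x))"
proof -
  obtain B where "\<And>x. x \<in> space N \<Longrightarrow> \<bar>f x\<bar> \<le> B" using bdd_measE[OF assms(1)] by metis
  then show ?thesis
    using measurable_compose[OF assms(2) bdd_meas_measurable[OF assms(1)]] measurable_space[OF assms(2)]
    by (intro bdd_measI[of _ _ B]) auto
qed

lemma bdd_meas_cong: "(\<And>x. x \<in> space M \<Longrightarrow> f x = g x) \<Longrightarrow> bdd_meas M f \<longleftrightarrow> bdd_meas M g"
  by (simp add: bdd_meas_def cong: measurable_cong)

lemmas bdd_meas_intros = bdd_meas_const bdd_meas_indicator bdd_meas_add bdd_meas_mult bdd_meas_uminus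
  bdd_meas_diff bdd_meas_divide bdd_meas_power2 bdd_meas_abs bdd_meas_sum

lemma (in prob_space) integrable_bdd_meas [intro]:
  assumes "bdd_meas M f" shows "integrable M f"
proof -
  obtain B where "\<And>x. x \<in> space M \<Longrightarrow> \<bar>f x\<bar> \<le> B" using bdd_measE[OF assms] by metis
  then show ?thesis using assms by (intro integrable_const_bound[of _ B]) (auto simp: bdd_meas_measurable)
qed

lemma sqn_nonneg [simp]: "0 \<le> sqn M f"
  by (simp add: sqn_def)

lemma sqn_cong: "(\<And>x. x \<in> space M \<Longrightarrow> f x = g x) \<Longrightarrow> sqn M f = sqn M g"
  unfolding sqn_def by (rule Bochner_Integration.integral_cong) auto

lemma sqn_cmult: "sqn M (\<lambda>x. c * f x) = c\<^sup>2 * sqn M f"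
  by (simp add: sqn_def power_mult_distrib)

lemma sqn_uminus: "sqn M (\<lambda>x. - f x) = sqn M f"
  by (simp add: sqn_def)

lemma sqn_distr:
  assumes "\<tau> \<in> M \<rightarrow>\<^sub>M N" "distr M N \<tau> = N" "f \<in> borel_measurable N"
  shows "sqn M (\<lambda>x. f (\<tau> x)) = sqn N f"
proof -
  have "sqn N f = (\<integral>x. (f x)\<^sup>2 \<partial>(distr M N \<tau>))" by (simp add: sqn_def assms)
  also have "\<dots> = sqn M (\<lambda>x. f (\<tau> x))" unfolding sqn_def
    by (rule integral_distr) (use assms in auto)
  finally show ?thesis ..
qed

context prob_space
begin

lemma sqn_add_le:
  assumes "bdd_meas M f" "bdd_meas M g"
  shows "sqn M (\<lambda>x. f x + g x) \<le> 2 * sqn M f + 2 * sqn M g"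
proof -
  have "sqn M (\<lambda>x. f x + g x) \<le> (\<integral>x. 2 * (f x)\<^sup>2 + 2 * (g x)\<^sup>2 \<partial>M)"
    unfolding sqn_def
  proof (rule integral_mono)
    show "(f x + g x)\<^sup>2 \<le> 2 * (f x)\<^sup>2 + 2 * (g x)\<^sup>2" for x
      using sum_squares_bound[of "f x" "g x"] by (simp add: power2_sum)
  qed (intro integrable_bdd_meas bdd_meas_intros assms)+
  also have "\<dots> = 2 * sqn M f + 2 * sqn M g" unfolding sqn_def
    using assms by (simp add: integrable_bdd_meas bdd_meas_intros)
  finally show ?thesis .
qed

lemma sqn_diff_le:
  assumes "bdd_meas M f" "bdd_meas M g"
  shows "sqn M (\<lambda>x. f x - g x) \<le> 2 * sqn M f + 2 * sqn M g"
  using sqn_add_le[of f "\<lambda>x. - g x"] assms by (auto simp: sqn_uminus)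

lemma sqn_const [simp]: "sqn M (\<lambda>_. c) = c\<^sup>2"
  by (simp add: sqn_def prob_space)

lemma sqn_diff_scaled:
  assumes "bdd_meas M f" "bdd_meas M g"
  shows "sqn M (\<lambda>x. f x - s * g x) = sqn M f - 2 * s * (\<integral>x. f x * g x \<partial>M) + s\<^sup>2 * sqn M g"
proof -
  have "sqn M (\<lambda>x. f x - s * g x) = (\<integral>x. (f x)\<^sup>2 - 2 * s * (f x * g x) + s\<^sup>2 * (g x)\<^sup>2 \<partial>M)"
    unfolding sqn_def by (rule Bochner_Integration.integral_cong) (auto simp: power2_eq_square algebra_simps)
  also have "\<dots> = sqn M f - 2 * s * (\<integral>x. f x * g x \<partial>M) + s\<^sup>2 * sqn M g"
    unfolding sqn_def
    using assms by (simp add: integrable_bdd_meas bdd_meas_intros)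
  finally show ?thesis .
qed

end

text \<open>Common source of two Cauchy-Schwarz inequalities: the one for integrals, and the
  pointwise one for iterated averages.\<close>

lemma quadratic_nonneg_discriminant:
  fixes a b c :: real
  assumes "\<And>s. 0 \<le> a - 2 * s * c + s\<^sup>2 * b" and "0 \<le> b"
  shows "c\<^sup>2 \<le> a * b"
proof (cases "b = 0")
  case True
  have "c = 0"
  proof (rule ccontr)
    assume "c \<noteq> 0"
    \<comment> \<open>For \<open>b = 0\<close> the expression is affine in \<open>s\<close>; at this
      \<open>s\<close> it equals -1.\<close>
    then show False using assms(1)[of "(a + 1) / (2 * c)"] True by (simp add: field_simps)
  qed
  then show ?thesis using True by simp
next
  case False
  then have "0 < b" using assms(2) by simp
  have "0 \<le> a - 2 * (c / b) * c + (c / b)\<^sup>2 * b" by (rule assms(1))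
  also have "\<dots> = a - c\<^sup>2 / b" using False by (simp add: field_simps power2_eq_square)
  finally show ?thesis using \<open>0 < b\<close> by (simp add: field_simps)
qed

context prob_space
begin

lemma integral_mult_sq_le:
  assumes "bdd_meas M f" "bdd_meas M g"
  shows "(\<integral>x. f x * g x \<partial>M)\<^sup>2 \<le> sqn M f * sqn M g"
  using sqn_diff_scaled[OF assms] by (intro quadratic_nonneg_discriminant) (auto simp flip: sqn_diff_scaled[OF assms])

lemma integral_sq_le_sqn: "bdd_meas M f \<Longrightarrow> (\<integral>x. f x \<partial>M)\<^sup>2 \<le> sqn M f"
  using integral_mult_sq_le[of f "\<lambda>_. 1"] by simp

lemma integral_abs_le_sqrt_sqn: "bdd_meas M f \<Longrightarrow> (\<integral>x. \<bar>f x\<bar> \<partial>M) \<le> sqrt (sqn M f)"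
  using integral_sq_le_sqn[of "\<lambda>x. \<bar>f x\<bar>"] by (auto simp: sqn_def intro: real_le_rsqrt)

lemma sqrt_sqn_add:
  assumes "bdd_meas M f" "bdd_meas M g"
  shows "sqrt (sqn M (\<lambda>x. f x + g x)) \<le> sqrt (sqn M f) + sqrt (sqn M g)"
proof -
  have "(\<integral>x. f x * g x \<partial>M) \<le> sqrt (sqn M f) * sqrt (sqn M g)"
    using integral_mult_sq_le[OF assms] by (simp add: real_le_rsqrt flip: real_sqrt_mult)
  then have "sqn M (\<lambda>x. f x + g x) \<le> (sqrt (sqn M f) + sqrt (sqn M g))\<^sup>2"
    using sqn_diff_scaled[OF assms, of "-1"] by (simp add: power2_sum)
  then show ?thesis by (simp add: real_le_lsqrt)
qed

lemma sqrt_sqn_diff: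
  assumes "bdd_meas M f" "bdd_meas M g"
  shows "sqrt (sqn M (\<lambda>x. f x - g x)) \<ge> sqrt (sqn M f) - sqrt (sqn M g)"
  using sqrt_sqn_add[of "\<lambda>x. f x - g x" g] assms by (auto simp: algebra_simps)

end

section \<open>Self-adjoint Markov operators given by finitely many maps\<close>

section \<open>Symmetric averaging operators\<close>

text \<open>\<open>integral_swap\<close> is self-adjointness of the sum over \<open>K\<close>; no
  single map is asked to preserve the measure. This leaves room for group elements restricted to
  part of the space. With \<open>u = 1\<close> it makes the average preserve integrals.\<close>

locale averaging = prob_space M for M :: "'a measure" +
  fixes K :: "'i set" and \<tau> :: "'i \<Rightarrow> 'a \<Rightarrow> 'a"
  assumes finite_K: "finite K"
    and lazy: "\<exists>e\<in>K. \<forall>x\<in>space M. \<tau> e x = x"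
    and \<tau>_measurable: "i \<in> K \<Longrightarrow> \<tau> i \<in> M \<rightarrow>\<^sub>M M"
    and integral_swap: "bdd_meas M u \<Longrightarrow> bdd_meas M f \<Longrightarrow>
      (\<integral>x. u x * (\<Sum>i\<in>K. f (\<tau> i x)) \<partial>M) = (\<integral>x. (\<Sum>i\<in>K. u (\<tau> i x)) * f x \<partial>M)"
begin

definition avg :: "('a \<Rightarrow> real) \<Rightarrow> 'a \<Rightarrow> real" where
  "avg f x = (\<Sum>i\<in>K. f (\<tau> i x)) / card K"

lemma card_K_pos: "0 < card K"
  using finite_K lazy by (auto simp: card_gt_0_iff)

lemma \<tau>_space: "i \<in> K \<Longrightarrow> x \<in> space M \<Longrightarrow> \<tau> i x \<in> space M"
  using measurable_space[OF \<tau>_measurable] by auto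

lemma bdd_meas_\<tau>: "i \<in> K \<Longrightarrow> bdd_meas M f \<Longrightarrow> bdd_meas M (\<lambda>x. f (\<tau> i x))"
  by (rule bdd_meas_comp) (auto intro: \<tau>_measurable)

lemma bdd_meas_avg: "bdd_meas M f \<Longrightarrow> bdd_meas M (avg f)"
  unfolding avg_def by (intro bdd_meas_intros bdd_meas_\<tau>)

lemma bdd_meas_avg_pow: "bdd_meas M f \<Longrightarrow> bdd_meas M ((avg ^^ l) f)"
  by (induction l) (auto intro: bdd_meas_avg)

lemma avg_add: "avg (\<lambda>x. f x + g x) = (\<lambda>x. avg f x + avg g x)"
  by (auto simp: avg_def sum.distrib add_divide_distrib)

lemma avg_cmult: "avg (\<lambda>x. c * f x) = (\<lambda>x. c * avg f x)"
  by (auto simp: avg_def simp flip: sum_distrib_left)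

lemma avg_const: "avg (\<lambda>x. c) = (\<lambda>x. c)"
  using card_K_pos by (auto simp: avg_def)

lemma avg_pow_add: "(avg ^^ l) (\<lambda>x. f x + g x) = (\<lambda>x. (avg ^^ l) f x + (avg ^^ l) g x)"
  by (induction l) (auto simp: avg_add)

lemma avg_pow_cmult: "(avg ^^ l) (\<lambda>x. c * f x) = (\<lambda>x. c * (avg ^^ l) f x)"
  by (induction l) (auto simp: avg_cmult)

lemma avg_pow_const: "(avg ^^ l) (\<lambda>x. c) = (\<lambda>x. c)"
  by (induction l) (auto simp: avg_const)

lemma avg_pow_diff: "(avg ^^ l) (\<lambda>x. f x - g x) = (\<lambda>x. (avg ^^ l) f x - (avg ^^ l) g x)"
  using avg_pow_add[of l f "\<lambda>x. (-1) * g x"] avg_pow_cmult[of l "-1" g] by simp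

lemma avg_pow_sum: "(avg ^^ l) (\<lambda>x. \<Sum>j\<in>J. f j x) = (\<lambda>x. \<Sum>j\<in>J. (avg ^^ l) (f j) x)"
  by (induction J rule: infinite_finite_induct) (auto simp: avg_pow_add avg_pow_const)

lemma avg_pow_nonneg_on:
  assumes "\<And>i x. i \<in> K \<Longrightarrow> x \<in> C \<Longrightarrow> \<tau> i x \<in> C" and "\<And>x. x \<in> C \<Longrightarrow> 0 \<le> f x" and "x \<in> C"
  shows "0 \<le> (avg ^^ l) f x"
  using assms(3)
proof (induction l arbitrary: x)
  case (Suc l)
  then show ?case using assms(1) by (auto simp: avg_def intro!: divide_nonneg_nonneg sum_nonneg)
qed (use assms in auto)

lemma avg_pow_nonneg: "(\<And>x. x \<in> space M \<Longrightarrow> 0 \<le> f x) \<Longrightarrow> x \<in> space M \<Longrightarrow> 0 \<le> (avg ^^ l) f x"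
  by (rule avg_pow_nonneg_on[where C = "space M"]) (auto intro: \<tau>_space)

text \<open>An iterated average at \<open>x\<close> only sees values on a set that contains
  \<open>x\<close> and is closed under the moves. \<open>C\<close> may be non-measurable or null; it
  will be a piece of a single orbit.\<close>

lemma avg_pow_cong_on:
  assumes "\<And>i x. i \<in> K \<Longrightarrow> x \<in> C \<Longrightarrow> \<tau> i x \<in> C" and "\<And>x. x \<in> C \<Longrightarrow> f x = g x" and "x \<in> C"
  shows "(avg ^^ l) f x = (avg ^^ l) g x"
  using assms(3)
proof (induction l arbitrary: x)
  case (Suc l)
  then show ?case using assms(1) by (auto simp: avg_def intro!: arg_cong[of _ _ "\<lambda>s. s / _"] sum.cong)
qed (use assms in auto)

lemma avg_pow_cong:
  "(\<And>x. x \<in> space M \<Longrightarrow> f x = g x) \<Longrightarrow> x \<in> space M \<Longrightarrow> (avg ^^ l) f x = (avg ^^ l) g x"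
  by (rule avg_pow_cong_on[where C = "space M"]) (auto intro: \<tau>_space)

lemma avg_pow_mono:
  "(\<And>x. x \<in> space M \<Longrightarrow> f x \<le> g x) \<Longrightarrow> x \<in> space M \<Longrightarrow> (avg ^^ l) f x \<le> (avg ^^ l) g x"
  using avg_pow_nonneg[of "\<lambda>x. g x - f x" x l] by (simp add: avg_pow_diff)

lemma integral_avg_mult:
  assumes "bdd_meas M u" "bdd_meas M f"
  shows "(\<integral>x. u x * avg f x \<partial>M) = (\<integral>x. avg u x * f x \<partial>M)"
  using integral_swap[OF assms] by (simp add: avg_def)

lemma integral_avg: "bdd_meas M f \<Longrightarrow> (\<integral>x. avg f x \<partial>M) = (\<integral>x. f x \<partial>M)"
  using integral_avg_mult[of "\<lambda>_. 1" f] by (simp add: avg_const)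

lemma integral_avg_pow: "bdd_meas M f \<Longrightarrow> (\<integral>x. (avg ^^ l) f x \<partial>M) = (\<integral>x. f x \<partial>M)"
  by (induction l) (auto simp: integral_avg bdd_meas_avg_pow)

lemma integral_avg_pow_mult:
  assumes "bdd_meas M u" "bdd_meas M f"
  shows "(\<integral>x. (avg ^^ i) u x * (avg ^^ j) f x \<partial>M) = (\<integral>x. (avg ^^ (i + j)) u x * f x \<partial>M)"
proof (induction j arbitrary: i)
  case (Suc j)
  have "(\<integral>x. (avg ^^ i) u x * (avg ^^ Suc j) f x \<partial>M) = (\<integral>x. (avg ^^ Suc i) u x * (avg ^^ j) f x \<partial>M)"
    using integral_avg_mult[OF bdd_meas_avg_pow[OF assms(1)] bdd_meas_avg_pow[OF assms(2)]] by simp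
  also have "\<dots> = (\<integral>x. (avg ^^ (i + Suc j)) u x * f x \<partial>M)" using Suc[of "Suc i"] by simp
  finally show ?case .
qed auto

lemma sqn_avg_pow: "bdd_meas M u \<Longrightarrow> sqn M ((avg ^^ l) u) = (\<integral>x. (avg ^^ (l + l)) u x * u x \<partial>M)"
  using integral_avg_pow_mult[of u u l l] by (simp add: sqn_def power2_eq_square)

text \<open>The variance of \<open>f \<circ> \<tau> i\<close> over \<open>i\<close>; the lazy index compares it with \<open>f\<close> itself.\<close>

lemma avg_defect_pointwise:
  assumes "x \<in> space M"
  shows "(\<Sum>i\<in>K. (f (\<tau> i x) - f x)\<^sup>2) \<le> (card K)\<^sup>2 * (avg (\<lambda>x. (f x)\<^sup>2) x - (avg f x)\<^sup>2)"
proof -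
  define k where "k = real (card K)"
  define a where "a i = f (\<tau> i x)" for i
  obtain e where e: "e \<in> K" "\<tau> e x = x" using lazy assms by auto
  have k: "k > 0" using card_K_pos by (simp add: k_def)
  have "k\<^sup>2 * (avg (\<lambda>x. (f x)\<^sup>2) x - (avg f x)\<^sup>2) = k * (\<Sum>i\<in>K. (a i)\<^sup>2) - (\<Sum>i\<in>K. a i)\<^sup>2"
    using k by (simp add: avg_def a_def k_def power2_eq_square field_simps)
  \<comment> \<open>The variance as a sum of squared differences over pairs of indices.\<close>
  also have "2 * \<dots> = (\<Sum>i\<in>K. \<Sum>j\<in>K. (a i - a j)\<^sup>2)"
  proof -
    have "(\<Sum>i\<in>K. \<Sum>j\<in>K. (a i - a j)\<^sup>2)
      = (\<Sum>i\<in>K. \<Sum>j\<in>K. (a i)\<^sup>2) + (\<Sum>i\<in>K. \<Sum>j\<in>K. (a j)\<^sup>2) - 2 * (\<Sum>i\<in>K. \<Sum>j\<in>K. a i * a j)"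
      by (simp add: power2_diff sum.distrib sum_subtractf sum_distrib_left mult.assoc)
    also have "(\<Sum>i\<in>K. \<Sum>j\<in>K. a i * a j) = (\<Sum>i\<in>K. a i)\<^sup>2"
      by (simp add: sum_product power2_eq_square)
    finally show ?thesis by (simp add: k_def sum_distrib_left)
  qed
  \<comment> \<open>Only pairs containing the lazy index \<open>e\<close> are kept, where
    \<open>a e = f x\<close>; the pair \<open>(e, e)\<close> is counted twice but contributes
    0.\<close>
  also have "(\<Sum>i\<in>K. \<Sum>j\<in>K. (if i = e then (a j - f x)\<^sup>2 else 0) + (if j = e then (a i - f x)\<^sup>2 else 0)) \<le> \<dots>"
    using e by (intro sum_mono) (auto simp: a_def power2_commute)
  moreover have "(\<Sum>i\<in>K. \<Sum>j\<in>K. (if i = e then (a j - f x)\<^sup>2 else 0) + (if j = e then (a i - f x)\<^sup>2 else 0))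
    = 2 * (\<Sum>i\<in>K. (a i - f x)\<^sup>2)"
  proof -
    have "(\<Sum>i\<in>K. \<Sum>j\<in>K. (if i = e then (a j - f x)\<^sup>2 else 0)) = (\<Sum>i\<in>K. if i = e then \<Sum>j\<in>K. (a j - f x)\<^sup>2 else 0)"
      by (intro sum.cong) auto
    then show ?thesis using e finite_K by (simp add: sum.distrib)
  qed
  ultimately show ?thesis by (simp add: k_def a_def)
qed

text \<open>The integral of the pointwise variance is the energy lost in one averaging step, since
  averaging preserves the integral of \<open>f\<close> squared. Lost energy thus controls
  displacement.\<close>

lemma sum_sqn_defect:
  assumes "bdd_meas M f"
  shows "(\<Sum>i\<in>K. sqn M (\<lambda>x. f (\<tau> i x) - f x)) \<le> (card K)\<^sup>2 * (sqn M f - sqn M (avg f))"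
proof -
  note [intro] = bdd_meas_\<tau> bdd_meas_avg assms
  have "(\<Sum>i\<in>K. sqn M (\<lambda>x. f (\<tau> i x) - f x)) = (\<integral>x. (\<Sum>i\<in>K. (f (\<tau> i x) - f x)\<^sup>2) \<partial>M)"
    unfolding sqn_def
    by (subst Bochner_Integration.integral_sum)
      (intro integrable_bdd_meas bdd_meas_intros bdd_meas_\<tau> assms refl; assumption)+
  also have "\<dots> \<le> (\<integral>x. (card K)\<^sup>2 * (avg (\<lambda>x. (f x)\<^sup>2) x - (avg f x)\<^sup>2) \<partial>M)"
    by (intro integral_mono avg_defect_pointwise integrable_bdd_meas bdd_meas_intros) auto
  also have "\<dots> = (card K)\<^sup>2 * (sqn M f - sqn M (avg f))"
  proof -
    have "integrable M (avg (\<lambda>x. (f x)\<^sup>2))" "integrable M (\<lambda>x. (avg f x)\<^sup>2)"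
      by (intro integrable_bdd_meas bdd_meas_intros bdd_meas_avg assms)+
    then show ?thesis using integral_avg[OF bdd_meas_power2[OF assms]] by (simp add: sqn_def)
  qed
  finally show ?thesis .
qed

lemma sqn_avg_le: "bdd_meas M f \<Longrightarrow> sqn M (avg f) \<le> sqn M f"
proof -
  assume "bdd_meas M f"
  then have "0 \<le> (card K)\<^sup>2 * (sqn M f - sqn M (avg f))"
    using sum_sqn_defect[of f] by (smt (verit) sqn_nonneg sum_nonneg)
  then show ?thesis using card_K_pos by (simp add: zero_le_mult_iff)
qed

text \<open>The energies of the iterates decrease and are nonnegative, so the loss per step tends to
  0, and the loss dominates the displacement.\<close>

lemma avg_pow_defect_tendsto:
  assumes u: "bdd_meas M u" and i: "i \<in> K"
  shows "(\<lambda>l. sqn M (\<lambda>x. (avg ^^ l) u (\<tau> i x) - (avg ^^ l) u x)) \<longlonglongrightarrow> 0"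
proof -
  define c where "c l = sqn M ((avg ^^ l) u)" for l
  have "decseq c" unfolding c_def decseq_Suc_iff by (auto intro!: sqn_avg_le bdd_meas_avg_pow u)
  then obtain L where L: "c \<longlonglongrightarrow> L"
    using decseq_convergent[of c 0] by (auto simp: c_def)
  have "(\<lambda>l. (card K)\<^sup>2 * (c l - c (Suc l))) \<longlonglongrightarrow> (card K)\<^sup>2 * (L - L)"
    by (intro tendsto_intros L LIMSEQ_Suc)
  then have "(\<lambda>l. (card K)\<^sup>2 * (c l - c (Suc l))) \<longlonglongrightarrow> 0" by simp
  moreover have "sqn M (\<lambda>x. (avg ^^ l) u (\<tau> i x) - (avg ^^ l) u x) \<le> (card K)\<^sup>2 * (c l - c (Suc l))" for l
  proof -
    have "sqn M (\<lambda>x. (avg ^^ l) u (\<tau> i x) - (avg ^^ l) u x)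
      \<le> (\<Sum>i\<in>K. sqn M (\<lambda>x. (avg ^^ l) u (\<tau> i x) - (avg ^^ l) u x))"
      by (rule member_le_sum[OF i]) (auto simp: finite_K)
    also have "\<dots> \<le> (card K)\<^sup>2 * (c l - c (Suc l))"
      using sum_sqn_defect[OF bdd_meas_avg_pow[OF u]] by (simp add: c_def)
    finally show ?thesis .
  qed
  ultimately show ?thesis
    by - (rule Lim_null_comparison[OF always_eventually], auto)
qed

text \<open>Evaluating an iterated average at \<open>x\<close> is a positive functional; expanding
  its value on \<open>b * (g - s)\<^sup>2\<close> gives a nonnegative quadratic in
  \<open>s\<close>.\<close>

lemma avg_pow_mult_sq_le:
  assumes b: "bdd_meas M b" "\<And>x. x \<in> space M \<Longrightarrow> 0 \<le> b x" and x: "x \<in> space M"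
  shows "((avg ^^ l) (\<lambda>x. b x * g x) x)\<^sup>2 \<le> (avg ^^ l) (\<lambda>x. b x * (g x)\<^sup>2) x * (avg ^^ l) b x"
proof (rule quadratic_nonneg_discriminant)
  fix s
  have "0 \<le> (avg ^^ l) (\<lambda>x. b x * (g x - s)\<^sup>2) x"
    by (rule avg_pow_nonneg[OF _ x]) (use b in auto)
  also have "(\<lambda>x. b x * (g x - s)\<^sup>2) = (\<lambda>x. b x * (g x)\<^sup>2 - (2 * s) * (b x * g x) + s\<^sup>2 * b x)"
    by (auto simp: power2_eq_square algebra_simps)
  finally show "0 \<le> (avg ^^ l) (\<lambda>x. b x * (g x)\<^sup>2) x - 2 * s * (avg ^^ l) (\<lambda>x. b x * g x) x + s\<^sup>2 * (avg ^^ l) b x"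
    by (simp only: avg_pow_add avg_pow_diff avg_pow_cmult)
qed (rule avg_pow_nonneg[OF _ x], use b in auto)

text \<open>By self-adjointness the energy at step \<open>l + 1\<close> is the inner product of the
  iterates at \<open>l\<close> and \<open>l + 2\<close>; then Cauchy-Schwarz.\<close>

lemma sqn_avg_pow_log_convex:
  assumes u: "bdd_meas M u"
  shows "(sqn M ((avg ^^ Suc l) u))\<^sup>2 \<le> sqn M ((avg ^^ l) u) * sqn M ((avg ^^ Suc (Suc l)) u)"
proof -
  have "sqn M ((avg ^^ Suc l) u) = (\<integral>x. (avg ^^ l) u x * (avg ^^ Suc (Suc l)) u x \<partial>M)"
    using integral_avg_pow_mult[OF u u, of l "Suc (Suc l)"] sqn_avg_pow[OF u, of "Suc l"] by (simp del: funpow.simps)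
  then show ?thesis
    using integral_mult_sq_le[OF bdd_meas_avg_pow[OF u] bdd_meas_avg_pow[OF u], of l "Suc (Suc l)"]
    by (simp del: funpow.simps)
qed

text \<open>By log-convexity the ratios of consecutive terms of \<open>sqn M ((avg ^^ l) u)\<close> increase, so an
  exponential decay rate of the sequence already bounds the first ratio.\<close>

lemma sqn_avg_le_of_decay:
  assumes u: "bdd_meas M u" and decay: "\<And>l. sqn M ((avg ^^ l) u) \<le> C * \<rho> ^ l" and \<rho>: "0 \<le> \<rho>"
  shows "sqn M (avg u) \<le> \<rho> * sqn M u"
proof (rule ccontr)
  define c where "c l = sqn M ((avg ^^ l) u)" for l
  assume "\<not> sqn M (avg u) \<le> \<rho> * sqn M u"
  then have gt: "c 1 > \<rho> * c 0" by (simp add: c_def)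
  have lc: "(c (Suc l))\<^sup>2 \<le> c l * c (Suc (Suc l))" for l
    unfolding c_def by (rule sqn_avg_pow_log_convex[OF u])
  have c1: "c 1 > 0" using gt \<rho> sqn_nonneg[of M u] by (smt (verit) c_def funpow_0 mult_nonneg_nonneg)
  have c0: "c 0 > 0" using sqn_avg_le[OF u] c1 by (simp add: c_def)
  define r where "r = c 1 / c 0"
  have r: "r > \<rho>" using gt c0 by (simp add: r_def field_simps)
  have pos_ratio: "c l > 0 \<and> c (Suc l) \<ge> r * c l" for l
  proof (induction l)
    case 0 then show ?case using c0 by (simp add: r_def)
  next
    case (Suc l)
    have p: "c (Suc l) > 0" using Suc r \<rho> by (smt (verit) mult_pos_pos)
    have "r * c l * c (Suc l) \<le> c (Suc l) * c (Suc l)" using Suc p by (intro mult_right_mono) auto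
    also have "\<dots> \<le> c l * c (Suc (Suc l))" using lc[of l] by (simp add: power2_eq_square)
    finally have "c l * (r * c (Suc l)) \<le> c l * c (Suc (Suc l))" by (simp add: algebra_simps)
    then show ?case using Suc p by simp
  qed
  have lower: "c l \<ge> c 0 * r ^ l" for l
  proof (induction l)
    case (Suc l)
    have "c 0 * r ^ Suc l = r * (c 0 * r ^ l)" by simp
    also have "\<dots> \<le> r * c l" using Suc r \<rho> by (intro mult_left_mono) auto
    also have "\<dots> \<le> c (Suc l)" using pos_ratio by blast
    finally show ?case .
  qed simp
  have le: "c 0 * r ^ l \<le> C * \<rho> ^ l" for l
    using order.trans[OF lower[of l]] decay[of l] by (simp add: c_def)
  have "r > 0" using r \<rho> by simp
  \<comment> \<open>The ratio \<open>r\<close> exceeds the decay rate, so the positive number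
    \<open>c 0\<close> would lie below a null sequence, whatever the size of
    \<open>C\<close>.\<close>
  then have "(\<lambda>l. C * (\<rho> / r) ^ l) \<longlonglongrightarrow> C * 0"
    using r \<rho> by (intro tendsto_intros LIMSEQ_power_zero) auto
  moreover have "c 0 \<le> C * (\<rho> / r) ^ l" for l
    using le[of l] \<open>r > 0\<close> by (simp add: power_divide field_simps)
  ultimately have "c 0 \<le> 0" by (intro LIMSEQ_le_const) auto
  then show False using c0 by simp
qed

text \<open>If averaging shrinks the norm by \<open>sqrt \<rho>\<close>, the triangle inequality
  keeps \<open>avg u\<close> at distance at least \<open>1 - sqrt \<rho>\<close> times the norm from
  \<open>u\<close>. By Cauchy-Schwarz over \<open>K\<close> the squared distance is at most the
  total displacement; the gain of a factor \<open>1 / card K\<close> is dropped.\<close>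

lemma sqn_le_defect_of_contraction:
  assumes u: "bdd_meas M u" and le: "sqn M (avg u) \<le> \<rho> * sqn M u" and \<rho>: "0 \<le> \<rho>" "\<rho> < 1"
  shows "(1 - sqrt \<rho>)\<^sup>2 * sqn M u \<le> (\<Sum>i\<in>K. sqn M (\<lambda>x. u (\<tau> i x) - u x))"
proof -
  note [intro] = bdd_meas_\<tau> bdd_meas_avg u
  have "(1 - sqrt \<rho>) * sqrt (sqn M u) \<le> sqrt (sqn M u) - sqrt (sqn M (avg u))"
    using le by (simp add: algebra_simps flip: real_sqrt_mult)
  also have "\<dots> \<le> sqrt (sqn M (\<lambda>x. u x - avg u x))"
    by (rule sqrt_sqn_diff) auto
  finally have "((1 - sqrt \<rho>) * sqrt (sqn M u))\<^sup>2 \<le> (sqrt (sqn M (\<lambda>x. u x - avg u x)))\<^sup>2"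
    using \<rho> by (intro power_mono) auto
  then have "(1 - sqrt \<rho>)\<^sup>2 * sqn M u \<le> sqn M (\<lambda>x. u x - avg u x)"
    by (simp add: power_mult_distrib)
  also have "\<dots> \<le> (\<integral>x. (\<Sum>i\<in>K. (u (\<tau> i x) - u x)\<^sup>2) \<partial>M)"
    unfolding sqn_def
  proof (rule integral_mono)
    fix x assume x: "x \<in> space M"
    have k: "real (card K) \<ge> 1" using card_K_pos by simp
    have "u x - avg u x = (\<Sum>i\<in>K. u x - u (\<tau> i x)) / card K"
      using k by (simp add: avg_def sum_subtractf field_simps)
    then have "(u x - avg u x)\<^sup>2 = (\<Sum>i\<in>K. 1 * (u x - u (\<tau> i x)))\<^sup>2 / (card K)\<^sup>2"
      by (simp add: power_divide)
    also have "(\<Sum>i\<in>K. 1 * (u x - u (\<tau> i x)))\<^sup>2 \<le> (\<Sum>i\<in>K. 1\<^sup>2) * (\<Sum>i\<in>K. (u x - u (\<tau> i x))\<^sup>2)"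
      by (rule Cauchy_Schwarz_ineq_sum)
    finally have "(u x - avg u x)\<^sup>2 \<le> (card K * (\<Sum>i\<in>K. (u x - u (\<tau> i x))\<^sup>2)) / (card K)\<^sup>2"
      by (simp add: divide_right_mono)
    also have "\<dots> = (\<Sum>i\<in>K. (u x - u (\<tau> i x))\<^sup>2) / card K"
      using k by (simp add: power2_eq_square)
    also have "\<dots> \<le> (\<Sum>i\<in>K. (u x - u (\<tau> i x))\<^sup>2)"
    proof -
      have "(\<Sum>i\<in>K. (u x - u (\<tau> i x))\<^sup>2) \<ge> 0" by (simp add: sum_nonneg)
      then have "1 * (\<Sum>i\<in>K. (u x - u (\<tau> i x))\<^sup>2) \<le> card K * (\<Sum>i\<in>K. (u x - u (\<tau> i x))\<^sup>2)"
        using k by (intro mult_right_mono) auto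
      then show ?thesis using k by (simp add: field_simps)
    qed
    finally show "(u x - avg u x)\<^sup>2 \<le> (\<Sum>i\<in>K. (u (\<tau> i x) - u x)\<^sup>2)"
      by (simp add: power2_commute)
  qed (intro integrable_bdd_meas bdd_meas_intros bdd_meas_avg bdd_meas_\<tau> u; assumption)+
  also have "\<dots> = (\<Sum>i\<in>K. sqn M (\<lambda>x. u (\<tau> i x) - u x))"
    unfolding sqn_def
    by (subst Bochner_Integration.integral_sum)
      (intro integrable_bdd_meas bdd_meas_intros bdd_meas_\<tau> u refl; assumption)+
  finally show ?thesis .
qed

text \<open>The random walk behind the operator. On a product, each word acts separately on the two
  factors, so averages of product functions can be computed word by word.\<close>

lemma avg_pow_words:
  "(avg ^^ l) f x = (\<Sum>w | set w \<subseteq> K \<and> length w = l. f (foldr \<tau> w x)) / card K ^ l"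
proof (induction l arbitrary: f)
  case 0
  have "{w. set w \<subseteq> K \<and> w = []} = {[]}" by auto
  then show ?case by simp
next
  case (Suc l)
  define W where "W = {w. set w \<subseteq> K \<and> length w = l}"
  have W: "{w. set w \<subseteq> K \<and> length w = Suc l} = (\<lambda>(i, w). i # w) ` (K \<times> W)"
    by (auto simp: W_def image_iff length_Suc_conv)
  have "(avg ^^ Suc l) f x = (avg ^^ l) (avg f) x"
    by (simp only: funpow_Suc_right comp_def)
  also have "\<dots> = (\<Sum>w\<in>W. avg f (foldr \<tau> w x)) / card K ^ l" using Suc by (simp add: W_def)
  also have "\<dots> = (\<Sum>w\<in>W. \<Sum>i\<in>K. f (\<tau> i (foldr \<tau> w x))) / card K ^ Suc l"
    by (simp add: avg_def flip: sum_divide_distrib)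
  also have "(\<Sum>w\<in>W. \<Sum>i\<in>K. f (\<tau> i (foldr \<tau> w x))) = (\<Sum>w | set w \<subseteq> K \<and> length w = Suc l. f (foldr \<tau> w x))"
    unfolding W by (subst sum.reindex, force simp: inj_on_def)
      (subst sum.swap, simp add: sum.cartesian_product case_prod_unfold)
  finally show ?case .
qed

end

section \<open>Actions as pointwise identities, and averages over partial moves\<close>

section \<open>Measure preserving actions\<close>

locale mp_action = group G + prob_space M
  for G :: "('g, 'r) monoid_scheme" (structure) and M :: "'a measure" and b :: "'g \<Rightarrow> 'a \<Rightarrow> 'a" +
  assumes act_measurable: "g \<in> carrier G \<Longrightarrow> b g \<in> M \<rightarrow>\<^sub>M M"
    and act_distr: "g \<in> carrier G \<Longrightarrow> distr M M (b g) = M"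
    and act_one: "x \<in> space M \<Longrightarrow> b \<one> x = x"
    and act_mult: "\<lbrakk>g \<in> carrier G; h \<in> carrier G; x \<in> space M\<rbrakk> \<Longrightarrow> b (g \<otimes> h) x = b g (b h x)"
begin

lemma act_space: "g \<in> carrier G \<Longrightarrow> x \<in> space M \<Longrightarrow> b g x \<in> space M"
  using measurable_space[OF act_measurable] by auto

lemma act_inv_left: "g \<in> carrier G \<Longrightarrow> x \<in> space M \<Longrightarrow> b (inv g) (b g x) = x"
  using act_mult[of "inv g" g x] act_one by simp

lemma integral_act:
  fixes f :: "'a \<Rightarrow> real"
  assumes "g \<in> carrier G" "f \<in> borel_measurable M" shows "(\<integral>x. f (b g x) \<partial>M) = (\<integral>x. f x \<partial>M)"
  using integral_distr[OF act_measurable[OF assms(1)] assms(2)] act_distr[OF assms(1)] by simp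

lemma sqn_act: "g \<in> carrier G \<Longrightarrow> f \<in> borel_measurable M \<Longrightarrow> sqn M (\<lambda>x. f (b g x)) = sqn M f"
  by (rule sqn_distr) (auto intro: act_measurable act_distr)

lemma AE_act:
  assumes "AE x in M. P x" "g \<in> carrier G" shows "AE x in M. P (b g x)"
proof -
  have "AE x in distr M M (b g). P x" using assms(1) by (simp only: act_distr[OF assms(2)])
  then show ?thesis by (rule AE_distrD[OF act_measurable[OF assms(2)]])
qed

text \<open>The operator averages over the partial transformations obtained by restricting \<open>b g\<close> to
  \<open>D g\<close>. A single restricted map does not preserve the measure, but \<open>g\<close> and \<open>inv g\<close> are adjoint.\<close>

lemma averaging_partial:
  assumes fin: "finite K" and K: "K \<subseteq> carrier G" "\<one> \<in> K" "\<And>g. g \<in> K \<Longrightarrow> inv g \<in> K"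
    and D: "\<And>g. g \<in> K \<Longrightarrow> D g \<in> sets M"
    and D_inv: "\<And>g x. g \<in> K \<Longrightarrow> x \<in> space M \<Longrightarrow> b g x \<in> D (inv g) \<longleftrightarrow> x \<in> D g"
  shows "averaging M K (\<lambda>g x. if x \<in> D g then b g x else x)"
proof
  let ?\<tau> = "\<lambda>g x. if x \<in> D g then b g x else x"
  have gG: "g \<in> K \<Longrightarrow> g \<in> carrier G" for g using K by auto
  show "\<exists>e\<in>K. \<forall>x\<in>space M. ?\<tau> e x = x" using K act_one by (auto intro!: bexI[of _ \<one>])
  show meas: "?\<tau> g \<in> M \<rightarrow>\<^sub>M M" if "g \<in> K" for g
  proof -
    note [measurable] = act_measurable[OF gG[OF that]] D[OF that]
    have "{x \<in> space M. x \<in> D g} \<in> sets M" by measurable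
    then show ?thesis by (intro measurable_If act_measurable gG that) auto
  qed
  fix u f :: "'a \<Rightarrow> real" assume uf: "bdd_meas M u" "bdd_meas M f"
  \<comment> \<open>\<open>\<Phi>\<close> is the contribution of the points that move,
    \<open>\<Psi>\<close> that of the points that stay. The latter is symmetric in \<open>u\<close>
    and \<open>f\<close>.\<close>
  define \<Phi> where "\<Phi> g u f = (\<integral>x. indicator (D g) x * u x * f (b g x) \<partial>M)" for g and u f :: "'a \<Rightarrow> real"
  define \<Psi> where "\<Psi> g u f = (\<integral>x. indicator (space M - D g) x * u x * f x \<partial>M)" for g and u f :: "'a \<Rightarrow> real"
  have bm: "bdd_meas M (\<lambda>x. f (b g x))" if "g \<in> K" "bdd_meas M f" for g f
    using bdd_meas_comp[OF that(2) act_measurable[OF gG[OF that(1)]]] .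
  have bm\<tau>: "bdd_meas M (\<lambda>x. f (?\<tau> g x))" if "g \<in> K" "bdd_meas M f" for g f
    using bdd_meas_comp[OF that(2) meas[OF that(1)]] .
  have split: "(\<integral>x. u x * f (?\<tau> g x) \<partial>M) = \<Phi> g u f + \<Psi> g u f"
    if g: "g \<in> K" and uf: "bdd_meas M u" "bdd_meas M f" for g u f
  proof -
    have "(\<integral>x. u x * f (?\<tau> g x) \<partial>M)
      = (\<integral>x. indicator (D g) x * u x * f (b g x) + indicator (space M - D g) x * u x * f x \<partial>M)"
      by (rule Bochner_Integration.integral_cong) (auto simp: indicator_def)
    also have "\<dots> = \<Phi> g u f + \<Psi> g u f" unfolding \<Phi>_def \<Psi>_def
      by (intro Bochner_Integration.integral_add integrable_bdd_meas bdd_meas_mult bdd_meas_indicator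
          bm uf g D sets.compl_sets)
    finally show ?thesis .
  qed
  \<comment> \<open>The measure preserving substitution by \<open>b g\<close> carries
    \<open>D g\<close> to \<open>D (inv g)\<close>; summing over the symmetric set \<open>K\<close>
    then restores symmetry.\<close>
  have swap: "\<Phi> g u f = \<Phi> (inv g) f u" if g: "g \<in> K" and uf: "bdd_meas M u" "bdd_meas M f" for g u f
  proof -
    note [measurable] = D[OF K(3)[OF g]] D[OF g] uf[THEN bdd_meas_measurable] act_measurable[OF gG[OF g]]
      act_measurable[OF gG[OF K(3)[OF g]]]
    have "\<Phi> (inv g) f u = (\<integral>x. indicator (D (inv g)) (b g x) * f (b g x) * u (b (inv g) (b g x)) \<partial>M)"
      unfolding \<Phi>_def by (rule integral_act[symmetric]) (use g gG in auto)
    also have "\<dots> = \<Phi> g u f" unfolding \<Phi>_def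
      by (rule Bochner_Integration.integral_cong) (use D_inv[OF g] act_inv_left[OF gG[OF g]] in \<open>auto simp: indicator_def\<close>)
    finally show ?thesis ..
  qed
  have sum: "(\<integral>x. u x * (\<Sum>g\<in>K. f (?\<tau> g x)) \<partial>M) = (\<Sum>g\<in>K. \<Phi> g u f + \<Psi> g u f)"
    if "bdd_meas M u" "bdd_meas M f" for u f
    unfolding sum_distrib_left
    by (subst Bochner_Integration.integral_sum) (auto intro!: integrable_bdd_meas bdd_meas_mult bm\<tau> that simp: split that)
  have "(\<Sum>g\<in>K. \<Phi> g u f) = (\<Sum>g\<in>K. \<Phi> (inv g) f u)"
    by (intro sum.cong refl swap uf)
  also have "\<dots> = (\<Sum>g\<in>K. \<Phi> g f u)"
    by (rule sum.reindex_bij_witness[of _ "\<lambda>g. inv g" "\<lambda>g. inv g"]) (use K gG in auto)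
  finally have "(\<Sum>g\<in>K. \<Phi> g u f + \<Psi> g u f) = (\<Sum>g\<in>K. \<Phi> g f u + \<Psi> g f u)"
    by (simp add: sum.distrib \<Psi>_def mult.commute mult.left_commute)
  then show "(\<integral>x. u x * (\<Sum>g\<in>K. f (?\<tau> g x)) \<partial>M) = (\<integral>x. (\<Sum>g\<in>K. u (?\<tau> g x)) * f x \<partial>M)"
    using sum[OF uf] sum[OF uf(2,1)] by (simp add: mult.commute)
qed (fact fin)

lemma averaging_act:
  assumes "finite K" "K \<subseteq> carrier G" "\<one> \<in> K" "\<And>g. g \<in> K \<Longrightarrow> inv g \<in> K"
  shows "averaging M K b"
proof -
  have "averaging M K (\<lambda>g x. if x \<in> (if g \<in> K then space M else UNIV) then b g x else x)"
    by (rule averaging_partial) (use assms in \<open>auto simp: act_space subset_iff\<close>)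
  then interpret A: averaging M K "\<lambda>g x. if x \<in> (if g \<in> K then space M else UNIV) then b g x else x" .
  show ?thesis
  proof
    show "\<exists>e\<in>K. \<forall>x\<in>space M. b e x = x" using assms act_one by auto
    show "(\<integral>x. u x * (\<Sum>i\<in>K. f (b i x)) \<partial>M) = (\<integral>x. (\<Sum>i\<in>K. u (b i x)) * f x \<partial>M)"
      if "bdd_meas M u" "bdd_meas M f" for u f
      using A.integral_swap[OF that] by (simp cong: Bochner_Integration.integral_cong sum.cong)
  qed (use assms act_measurable in auto)
qed

end

text \<open>The restriction makes it coincide with \<open>diagonal_square_action\<close> when both
  factors are the same.\<close>

definition pair_act :: "'a measure \<Rightarrow> 'b measure \<Rightarrow> ('g \<Rightarrow> 'a \<Rightarrow> 'a) \<Rightarrow> ('g \<Rightarrow> 'b \<Rightarrow> 'b) \<Rightarrow> 'g \<Rightarrow> 'a \<times> 'b \<Rightarrow> 'a \<times> 'b" where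
  "pair_act M1 M2 a b g = (\<lambda>p\<in>space (M1 \<Otimes>\<^sub>M M2). (a g (fst p), b g (snd p)))"

lemma pair_act_eq: "x \<in> space M1 \<Longrightarrow> y \<in> space M2 \<Longrightarrow> pair_act M1 M2 a b g (x, y) = (a g x, b g y)"
  by (simp add: pair_act_def space_pair_measure)

lemma mp_action_pair:
  assumes "mp_action G M1 a" "mp_action G M2 b"
  shows "mp_action G (M1 \<Otimes>\<^sub>M M2) (pair_act M1 M2 a b)"
proof -
  interpret A: mp_action G M1 a by fact
  interpret B: mp_action G M2 b by fact
  interpret pair_prob_space M1 M2 ..
  have cong: "p \<in> space (M1 \<Otimes>\<^sub>M M2) \<Longrightarrow> pair_act M1 M2 a b g p = (case p of (x, y) \<Rightarrow> (a g x, b g y))" for p g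
    by (auto simp: pair_act_def split: prod.split)
  show ?thesis
  proof
    fix g assume g: "g \<in> carrier G"
    note [measurable] = A.act_measurable[OF g] B.act_measurable[OF g]
    have "(\<lambda>(x, y). (a g x, b g y)) \<in> M1 \<Otimes>\<^sub>M M2 \<rightarrow>\<^sub>M M1 \<Otimes>\<^sub>M M2" by measurable
    then show "pair_act M1 M2 a b g \<in> M1 \<Otimes>\<^sub>M M2 \<rightarrow>\<^sub>M M1 \<Otimes>\<^sub>M M2"
      by (subst measurable_cong[OF cong])
    have "distr (M1 \<Otimes>\<^sub>M M2) (M1 \<Otimes>\<^sub>M M2) (pair_act M1 M2 a b g)
      = distr (M1 \<Otimes>\<^sub>M M2) (M1 \<Otimes>\<^sub>M M2) (\<lambda>(x, y). (a g x, b g y))"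
      by (rule distr_cong) (auto simp: cong)
    also have "\<dots> = distr M1 M1 (a g) \<Otimes>\<^sub>M distr M2 M2 (b g)"
      by (rule pair_measure_distr[symmetric])
        (use g in \<open>auto simp: B.act_distr A.act_measurable B.act_measurable intro: prob_space_imp_sigma_finite B.prob_space_axioms\<close>)
    finally show "distr (M1 \<Otimes>\<^sub>M M2) (M1 \<Otimes>\<^sub>M M2) (pair_act M1 M2 a b g) = M1 \<Otimes>\<^sub>M M2"
      using g by (simp add: A.act_distr B.act_distr)
  qed (auto simp: space_pair_measure pair_act_eq A.act_one B.act_one A.act_mult B.act_mult A.act_space B.act_space)
qed

lemma foldr_pair_act:
  assumes "mp_action G M1 a" "mp_action G M2 b" "set w \<subseteq> carrier G" "x \<in> space M1" "y \<in> space M2"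
  shows "foldr (pair_act M1 M2 a b) w (x, y) = (foldr a w x, foldr b w y)
    \<and> foldr a w x \<in> space M1 \<and> foldr b w y \<in> space M2"
  using assms(3)
  by (induction w) (use assms in \<open>auto simp: pair_act_eq mp_action.act_space\<close>)

lemma (in mp_action) foldr_act_measurable:
  "set w \<subseteq> carrier G \<Longrightarrow> foldr b w \<in> M \<rightarrow>\<^sub>M M"
  by (induction w) (auto intro!: measurable_comp[where N=M] act_measurable simp: id_def)


section \<open>Conditional expectation on a product, and L2-density of sums of product
  functions\<close>

section \<open>Averages over the first factor and tensor approximation\<close>

text \<open>The conditional expectation onto the second factor, kept as a function of that factor
  alone.\<close>

definition mean_fst :: "'a measure \<Rightarrow> ('a \<times> 'b \<Rightarrow> real) \<Rightarrow> 'b \<Rightarrow> real" where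
  "mean_fst M1 f x = (\<integral>z. f (z, x) \<partial>M1)"

lemma sum_lessThan_append:
  fixes f g :: "nat \<Rightarrow> real"
  shows "(\<Sum>j<n + m. if j < n then f j else g (j - n)) = (\<Sum>j<n. f j) + (\<Sum>j<m. g j)"
  by (induction m) auto

context pair_prob_space
begin

abbreviation MM :: "('a \<times> 'b) measure" where "MM \<equiv> M1 \<Otimes>\<^sub>M M2"

lemma bdd_meas_slice: "bdd_meas MM f \<Longrightarrow> x \<in> space M2 \<Longrightarrow> bdd_meas M1 (\<lambda>z. f (z, x))"
  by (rule bdd_meas_comp) auto

lemma bdd_meas_mean_fst:
  assumes f: "bdd_meas MM f" shows "bdd_meas M2 (mean_fst M1 f)"
proof -
  obtain B where B: "\<And>p. p \<in> space MM \<Longrightarrow> \<bar>f p\<bar> \<le> B" using bdd_measE[OF f] by metis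
  have [measurable]: "f \<in> borel_measurable MM" using f by auto
  have "(\<lambda>x. \<integral>z. f (z, x) \<partial>M1) \<in> borel_measurable M2"
    by (rule M1.borel_measurable_lebesgue_integral) simp
  moreover have "\<bar>mean_fst M1 f x\<bar> \<le> B" if x: "x \<in> space M2" for x
  proof -
    have "\<bar>mean_fst M1 f x\<bar> \<le> (\<integral>z. \<bar>f (z, x)\<bar> \<partial>M1)" unfolding mean_fst_def by (rule integral_abs_bound)
    also have "\<dots> \<le> (\<integral>z. B \<partial>M1)"
      by (intro integral_mono M1.integrable_bdd_meas bdd_meas_intros bdd_meas_slice f x B)
        (use x in \<open>auto simp: space_pair_measure\<close>)
    finally show ?thesis by (simp add: M1.prob_space)
  qed
  ultimately show ?thesis by (auto simp: bdd_meas_def mean_fst_def[abs_def])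
qed

lemma integral_mean_fst:
  assumes f: "bdd_meas MM f" shows "(\<integral>x. mean_fst M1 f x \<partial>M2) = (\<integral>p. f p \<partial>MM)"
  using integral_snd[of "\<lambda>z x. f (z, x)"] integrable_bdd_meas[OF f] by (simp add: mean_fst_def)

lemma bdd_meas_fst: "bdd_meas M1 u \<Longrightarrow> bdd_meas MM (\<lambda>p. u (fst p))"
  by (rule bdd_meas_comp) auto

lemma bdd_meas_snd: "bdd_meas M2 v \<Longrightarrow> bdd_meas MM (\<lambda>p. v (snd p))"
  by (rule bdd_meas_comp) auto

lemma mean_fst_mult_snd: "mean_fst M1 (\<lambda>p. f p * v (snd p)) x = mean_fst M1 f x * v x"
  by (simp add: mean_fst_def)

lemma mean_fst_add:
  assumes "bdd_meas MM f" "bdd_meas MM g" "x \<in> space M2"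
  shows "mean_fst M1 (\<lambda>p. f p + g p) x = mean_fst M1 f x + mean_fst M1 g x"
  unfolding mean_fst_def
  by (intro Bochner_Integration.integral_add M1.integrable_bdd_meas bdd_meas_slice assms)

lemma mean_fst_diff:
  assumes "bdd_meas MM f" "bdd_meas MM g" "x \<in> space M2"
  shows "mean_fst M1 (\<lambda>p. f p - g p) x = mean_fst M1 f x - mean_fst M1 g x"
  unfolding mean_fst_def
  by (intro Bochner_Integration.integral_diff M1.integrable_bdd_meas bdd_meas_slice assms)

lemma integral_tensor:
  assumes "bdd_meas M1 u" "bdd_meas M2 v"
  shows "(\<integral>p. u (fst p) * v (snd p) \<partial>MM) = (\<integral>x. u x \<partial>M1) * (\<integral>y. v y \<partial>M2)"
proof -
  have "bdd_meas MM (\<lambda>p. u (fst p) * v (snd p))"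
    by (intro bdd_meas_mult bdd_meas_fst bdd_meas_snd assms)
  from integral_mean_fst[OF this] show ?thesis by (simp add: mean_fst_def)
qed

text \<open>The mean is an orthogonal projection: its inner product with \<open>h\<close> equals its
  own squared norm.\<close>

lemma sqn_centre_le:
  assumes h: "bdd_meas MM h"
  shows "sqn MM (\<lambda>p. h p - mean_fst M1 h (snd p)) \<le> sqn MM h"
proof -
  let ?m = "\<lambda>p. mean_fst M1 h (snd p)"
  have m: "bdd_meas MM ?m" by (intro bdd_meas_snd bdd_meas_mean_fst h)
  have "(\<integral>p. h p * ?m p \<partial>MM) = (\<integral>x. mean_fst M1 h x * mean_fst M1 h x \<partial>M2)"
    using integral_mean_fst[OF bdd_meas_mult[OF h m]]
    by (simp add: mean_fst_mult_snd)
  also have "\<dots> = sqn MM ?m"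
    using integral_mean_fst[OF bdd_meas_mult[OF m m]]
    by (simp add: sqn_def power2_eq_square mean_fst_def M1.prob_space)
  finally show ?thesis using sqn_diff_scaled[OF h m, of 1] by simp
qed

definition tensor_sum :: "('a \<times> 'b \<Rightarrow> real) \<Rightarrow> bool" where
  "tensor_sum s \<longleftrightarrow> (\<exists>n u v. (\<forall>j<n. bdd_meas M1 (u j) \<and> bdd_meas M2 (v j)) \<and>
     s = (\<lambda>p. \<Sum>j<n::nat. u j (fst p) * v j (snd p)))"

lemma tensor_sum_bdd_meas: "tensor_sum s \<Longrightarrow> bdd_meas MM s"
  by (auto simp: tensor_sum_def intro!: bdd_meas_sum bdd_meas_mult bdd_meas_fst bdd_meas_snd)

lemma tensor_sum_add:
  assumes "tensor_sum s" "tensor_sum t" shows "tensor_sum (\<lambda>p. s p + t p)"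
proof -
  obtain n u v where 1: "\<forall>j<n. bdd_meas M1 (u j) \<and> bdd_meas M2 (v j)"
    "s = (\<lambda>p. \<Sum>j<n::nat. u j (fst p) * v j (snd p))" using assms(1) by (auto simp: tensor_sum_def)
  obtain m u' v' where 2: "\<forall>j<m. bdd_meas M1 (u' j) \<and> bdd_meas M2 (v' j)"
    "t = (\<lambda>p. \<Sum>j<m::nat. u' j (fst p) * v' j (snd p))" using assms(2) by (auto simp: tensor_sum_def)
  have "(\<lambda>p. s p + t p) = (\<lambda>p. \<Sum>j<n+m. (if j < n then u j else u' (j - n)) (fst p) * (if j < n then v j else v' (j - n)) (snd p))"
    unfolding 1(2) 2(2) sum_lessThan_append[symmetric] by (intro ext sum.cong) auto
  then show ?thesis unfolding tensor_sum_def
    by (intro exI[of _ "n + m"] exI[of _ "\<lambda>j. if j < n then u j else u' (j - n)"]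
        exI[of _ "\<lambda>j. if j < n then v j else v' (j - n)"]) (use 1(1) 2(1) in auto)
qed

lemma tensor_sum_cmult:
  assumes "tensor_sum s" shows "tensor_sum (\<lambda>p. c * s p)"
proof -
  obtain n u v where 1: "\<forall>j<n. bdd_meas M1 (u j) \<and> bdd_meas M2 (v j)"
    "s = (\<lambda>p. \<Sum>j<n::nat. u j (fst p) * v j (snd p))" using assms(1) by (auto simp: tensor_sum_def)
  have "(\<lambda>p. c * s p) = (\<lambda>p. \<Sum>j<n. (c * u j (fst p)) * v j (snd p))"
    unfolding 1(2) by (simp add: sum_distrib_left mult.assoc)
  then show ?thesis unfolding tensor_sum_def
    by (intro exI[of _ "n"] exI[of _ "\<lambda>j x. c * u j x"] exI[of _ v]) (use 1(1) in auto)
qed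

lemma tensor_sum_tensor: "bdd_meas M1 u \<Longrightarrow> bdd_meas M2 v \<Longrightarrow> tensor_sum (\<lambda>p. u (fst p) * v (snd p))"
  unfolding tensor_sum_def by (intro exI[of _ 1] exI[of _ "\<lambda>_. u"] exI[of _ "\<lambda>_. v"]) auto

text \<open>L2-density is phrased as a property of one function, so that it can be carried through
  inductions over sets and over functions.\<close>

definition tensor_approx :: "('a \<times> 'b \<Rightarrow> real) \<Rightarrow> bool" where
  "tensor_approx f \<longleftrightarrow> bdd_meas MM f \<and>
     (\<forall>e>0. \<exists>s. tensor_sum s \<and> sqn MM (\<lambda>p. f p - s p) < e)"

lemma tensor_sum_approx: "tensor_sum s \<Longrightarrow> tensor_approx s"
  unfolding tensor_approx_def by (auto intro!: tensor_sum_bdd_meas exI[of _ s])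

lemma tensor_approx_cong:
  assumes "\<And>p. p \<in> space MM \<Longrightarrow> f p = g p" "tensor_approx f" shows "tensor_approx g"
proof -
  have "sqn MM (\<lambda>p. f p - s p) = sqn MM (\<lambda>p. g p - s p)" for s
    by (rule sqn_cong) (simp add: assms)
  then show ?thesis using assms(2) bdd_meas_cong[of "MM" f g] assms(1)
    by (auto simp: tensor_approx_def)
qed

lemma tensor_approx_add:
  assumes f: "tensor_approx f" and g: "tensor_approx g" shows "tensor_approx (\<lambda>p. f p + g p)"
  unfolding tensor_approx_def
proof (intro conjI allI impI)
  have b: "bdd_meas MM f" "bdd_meas MM g" using f g by (auto simp: tensor_approx_def)
  then show "bdd_meas MM (\<lambda>p. f p + g p)" by auto
  fix e :: real assume "e > 0"
  then have "e / 4 > 0" by simp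
  obtain s where s: "tensor_sum s" "sqn MM (\<lambda>p. f p - s p) < e / 4"
    using f \<open>e / 4 > 0\<close> unfolding tensor_approx_def by blast
  obtain t where t: "tensor_sum t" "sqn MM (\<lambda>p. g p - t p) < e / 4"
    using g \<open>e / 4 > 0\<close> unfolding tensor_approx_def by blast
  have "sqn MM (\<lambda>p. (f p - s p) + (g p - t p)) < e"
    using sqn_add_le[of "\<lambda>p. f p - s p" "\<lambda>p. g p - t p"] bdd_meas_diff[OF b(1) tensor_sum_bdd_meas[OF s(1)]]
      bdd_meas_diff[OF b(2) tensor_sum_bdd_meas[OF t(1)]] s(2) t(2) by linarith
  then show "\<exists>s. tensor_sum s \<and> sqn MM (\<lambda>p. f p + g p - s p) < e"
    by (intro exI[of _ "\<lambda>p. s p + t p"]) (auto intro!: tensor_sum_add s t simp: algebra_simps)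
qed

lemma tensor_approx_cmult:
  assumes f: "tensor_approx f" shows "tensor_approx (\<lambda>p. c * f p)"
  unfolding tensor_approx_def
proof (intro conjI allI impI)
  have b: "bdd_meas MM f" using f by (auto simp: tensor_approx_def)
  then show "bdd_meas MM (\<lambda>p. c * f p)" by auto
  fix e :: real assume "e > 0"
  then have "e / (c\<^sup>2 + 1) > 0" by (simp add: add_nonneg_pos)
  then obtain s where s: "tensor_sum s" "sqn MM (\<lambda>p. f p - s p) < e / (c\<^sup>2 + 1)"
    using f unfolding tensor_approx_def by blast
  have "sqn MM (\<lambda>p. c * (f p - s p)) = c\<^sup>2 * sqn MM (\<lambda>p. f p - s p)"
    by (rule sqn_cmult)
  also have "\<dots> \<le> (c\<^sup>2 + 1) * sqn MM (\<lambda>p. f p - s p)" by (intro mult_right_mono) auto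
  also have "\<dots> < (c\<^sup>2 + 1) * (e / (c\<^sup>2 + 1))" by (intro mult_strict_left_mono s) (simp add: add_nonneg_pos)
  also have "\<dots> = e" by (simp add: add_nonneg_eq_0_iff)
  finally have "sqn MM (\<lambda>p. c * (f p - s p)) < e" .
  then show "\<exists>s. tensor_sum s \<and> sqn MM (\<lambda>p. c * f p - s p) < e"
    by (intro exI[of _ "\<lambda>p. c * s p"]) (auto intro!: tensor_sum_cmult s simp: algebra_simps)
qed

lemma tensor_approx_lim:
  assumes U: "\<And>i. tensor_approx (U i)" and B: "\<And>i p. p \<in> space MM \<Longrightarrow> \<bar>U i p\<bar> \<le> B"
    and lim: "\<And>p. p \<in> space MM \<Longrightarrow> (\<lambda>i. U i p) \<longlonglongrightarrow> f p"
  shows "tensor_approx f"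
  unfolding tensor_approx_def
proof (intro conjI allI impI)
  have Um: "bdd_meas MM (U i)" for i using U by (auto simp: tensor_approx_def)
  have fB: "\<bar>f p\<bar> \<le> B" if "p \<in> space MM" for p
    by (rule LIMSEQ_le_const2[OF tendsto_rabs[OF lim[OF that]]]) (use B that in auto)
  have [measurable]: "f \<in> borel_measurable MM"
    by (rule borel_measurable_LIMSEQ_metric[OF _ lim]) (use Um in auto)
  show b: "bdd_meas MM f" by (rule bdd_measI[of _ _ B]) (auto intro: fB)
  fix e :: real assume e: "e > 0"
  have "(\<lambda>i. sqn MM (\<lambda>p. f p - U i p)) \<longlonglongrightarrow> (\<integral>p. 0 \<partial>MM)"
    unfolding sqn_def
  proof (rule integral_dominated_convergence[where w = "\<lambda>_. (2 * B)\<^sup>2"])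
    show "AE p in MM. (\<lambda>i. (f p - U i p)\<^sup>2) \<longlonglongrightarrow> 0"
    proof (rule AE_I2)
      fix p assume "p \<in> space MM"
      then have "(\<lambda>i. (f p - U i p)\<^sup>2) \<longlonglongrightarrow> (f p - f p)\<^sup>2" by (intro tendsto_intros lim)
      then show "(\<lambda>i. (f p - U i p)\<^sup>2) \<longlonglongrightarrow> 0" by simp
    qed
    show "AE p in MM. norm ((f p - U i p)\<^sup>2) \<le> (2 * B)\<^sup>2" for i
    proof (rule AE_I2)
      fix p assume p: "p \<in> space MM"
      have "\<bar>f p - U i p\<bar> \<le> \<bar>2 * B\<bar>" using fB[OF p] B[OF p, of i] by linarith
      then show "norm ((f p - U i p)\<^sup>2) \<le> (2 * B)\<^sup>2" by (simp add: abs_le_square_iff)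
    qed
  qed (use Um in auto)
  then have "\<forall>\<^sub>F i in sequentially. sqn MM (\<lambda>p. f p - U i p) < e / 4"
    by (rule order_tendstoD) (use e in auto)
  then obtain i where i: "sqn MM (\<lambda>p. f p - U i p) < e / 4"
    by (auto simp: eventually_sequentially)
  have "e / 4 > 0" using e by simp
  then obtain s where s: "tensor_sum s" "sqn MM (\<lambda>p. U i p - s p) < e / 4"
    using U[of i] unfolding tensor_approx_def by blast
  have "sqn MM (\<lambda>p. (f p - U i p) + (U i p - s p)) < e"
    using sqn_add_le[of "\<lambda>p. f p - U i p" "\<lambda>p. U i p - s p"] bdd_meas_diff[OF b Um[of i]]
      bdd_meas_diff[OF Um[of i] tensor_sum_bdd_meas[OF s(1)]] s(2) i by linarith
  then show "\<exists>s. tensor_sum s \<and> sqn MM (\<lambda>p. f p - s p) < e" using s by auto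
qed

text \<open>Rectangles form an intersection-stable generator, and approximability passes to
  complements and countable disjoint unions, so Dynkin's theorem applies.\<close>

lemma tensor_approx_indicator:
  assumes "A \<in> sets MM" shows "tensor_approx (indicator A)"
proof -
  let ?E = "{a \<times> b | a b. a \<in> sets M1 \<and> b \<in> sets M2}"
  have sets: "sets MM = sigma_sets (space MM) ?E"
    by (simp add: sets_pair_measure space_pair_measure)
  have A: "A \<in> sigma_sets (space MM) ?E" using assms sets by simp
  have stable: "Int_stable ?E" by (rule Int_stable_pair_measure_generator)
  have Pow: "?E \<subseteq> Pow (space MM)" by (auto simp: space_pair_measure dest: sets.sets_into_space)
  from stable Pow A show ?thesis
  proof (induction A rule: sigma_sets_induct_disjoint)
    case (basic A)
    then obtain a b where A: "A = a \<times> b" "a \<in> sets M1" "b \<in> sets M2" by auto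
    have "tensor_approx (\<lambda>p. indicator a (fst p) * indicator b (snd p))"
      using A by (intro tensor_sum_approx tensor_sum_tensor) auto
    then show ?case by (rule tensor_approx_cong[rotated]) (auto simp: A indicator_def)
  next
    case empty
    have "tensor_approx (\<lambda>p. 0 * 0)" by (rule tensor_sum_approx, rule tensor_sum_tensor) auto
    then show ?case by (rule tensor_approx_cong[rotated]) auto
  next
    case (compl A)
    have "tensor_approx (\<lambda>p. 1 * 1)" by (rule tensor_sum_approx, rule tensor_sum_tensor) auto
    from tensor_approx_add[OF this tensor_approx_cmult[OF compl.IH, of "-1"]]
    show ?case by (rule tensor_approx_cong[rotated]) (auto simp: indicator_def)
  next
    case (union A)
    have part: "tensor_approx (\<lambda>p. \<Sum>i<n. indicator (A i) p)" for n
    proof (induction n)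
      case 0
      have "tensor_approx (\<lambda>p. 0 * 0)" by (rule tensor_sum_approx, rule tensor_sum_tensor) auto
      then show ?case by simp
    next
      case (Suc n) then show ?case using tensor_approx_add[OF Suc union.IH[of n]] by simp
    qed
    \<comment> \<open>Disjointness makes the partial sums indicators, which supplies the uniform
      bound 1 for dominated convergence.\<close>
    have eq: "(\<Sum>i<n. indicator (A i) p) = (indicator (\<Union>i<n. A i) p :: real)" for n p
      using union.hyps(1) by (subst indicator_UN_disjoint) (auto intro: disjoint_family_on_mono)
    show ?case
    proof (rule tensor_approx_lim[OF part, where B = 1])
      show "(\<lambda>n. \<Sum>i<n. indicator (A i) p :: real) \<longlonglongrightarrow> indicator (\<Union>i. A i) p" for p
        unfolding eq by (rule LIMSEQ_indicator_UN)
      show "\<bar>\<Sum>i<n. indicator (A i) p :: real\<bar> \<le> 1" for n p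
        unfolding eq by (simp add: indicator_def)
    qed
  qed
qed

text \<open>Boundedness sits inside the claim because the induction runs over all nonnegative
  functions; a bound on a sum or an increasing limit passes down to its nonnegative
  constituents.\<close>

lemma tensor_approx_nonneg:
  assumes "f \<in> borel_measurable MM" "\<And>p. 0 \<le> f p"
  shows "(\<exists>B. \<forall>p\<in>space MM. f p \<le> B) \<longrightarrow> tensor_approx f"
  using assms
proof (induction f rule: borel_measurable_induct_real)
  case (set A) then show ?case by (auto intro: tensor_approx_indicator)
next
  case (mult u c)
  show ?case
  proof (cases "c = 0")
    case True
    have "tensor_approx (\<lambda>p. 0 * 0)" by (rule tensor_sum_approx, rule tensor_sum_tensor) auto
    then show ?thesis using True by simp
  next
    case False
    show ?thesis
    proof
      assume "\<exists>B. \<forall>p\<in>space MM. c * u p \<le> B"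
      then obtain B where "\<forall>p\<in>space MM. c * u p \<le> B" by auto
      then have "\<forall>p\<in>space MM. u p \<le> B / c" using False mult.hyps by (simp add: field_simps)
      then show "tensor_approx (\<lambda>p. c * u p)" using mult.IH by (intro tensor_approx_cmult) blast
    qed
  qed
next
  case (add u v)
  show ?case
  proof
    assume "\<exists>B. \<forall>p\<in>space MM. v p + u p \<le> B"
    then obtain B where "\<forall>p\<in>space MM. v p + u p \<le> B" by auto
    then have "\<forall>p\<in>space MM. u p \<le> B" "\<forall>p\<in>space MM. v p \<le> B"
      using add.hyps by (metis add.commute add_increasing order_refl order_trans)+
    then show "tensor_approx (\<lambda>p. v p + u p)" using add.IH by (intro tensor_approx_add) blast+
  qed
next
  case (seq U)
  show ?case
  proof
    assume "\<exists>B. \<forall>p\<in>space MM. f p \<le> B"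
    then obtain B where B: "\<forall>p\<in>space MM. f p \<le> B" by auto
    have "U i p \<le> f p" if "p \<in> space MM" for i p
    proof (rule incseq_le)
      show "incseq (\<lambda>i. U i p)" using seq.hyps(3) unfolding incseq_def le_fun_def by blast
    qed (use seq.hyps(4) that in blast)
    then have UB: "U i p \<le> B" if "p \<in> space MM" for i p using B that by (meson order_trans)
    show "tensor_approx f"
    proof (rule tensor_approx_lim)
      show "tensor_approx (U i)" for i using seq.IH UB by blast
      show "\<bar>U i p\<bar> \<le> B" if "p \<in> space MM" for i p using UB[OF that] seq.hyps(2) by simp
    qed (use seq.hyps in auto)
  qed
qed

lemma tensor_approx_bdd_meas:
  assumes f: "bdd_meas MM f" shows "tensor_approx f"
proof -
  obtain B where B: "\<And>p. p \<in> space MM \<Longrightarrow> \<bar>f p\<bar> \<le> B" using bdd_measE[OF f] by metis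
  note [measurable] = bdd_meas_measurable[OF f]
  have "tensor_approx (\<lambda>p. max 0 (f p))"
    by (rule tensor_approx_nonneg[rule_format]) (use B in \<open>force intro: exI[of _ "max 0 B"]\<close>)+
  moreover have "tensor_approx (\<lambda>p. max 0 (- f p))"
    by (rule tensor_approx_nonneg[rule_format]) (use B in \<open>force intro: exI[of _ "max 0 B"]\<close>)+
  ultimately have "tensor_approx (\<lambda>p. max 0 (f p) + (-1) * max 0 (- f p))"
    by (intro tensor_approx_add tensor_approx_cmult)
  then show ?thesis by (rule tensor_approx_cong[rotated]) (auto simp: max_def)
qed

end

section \<open>A gap on a square survives multiplication by any measure preserving action\<close>

section \<open>Stability of spectral gap under products\<close>

lemma (in prob_space) sqn_tendsto:
  assumes f: "bdd_meas M f" and s: "\<And>n. bdd_meas M (s n)"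
    and lim: "(\<lambda>n. sqn M (\<lambda>x. f x - s n x)) \<longlonglongrightarrow> 0"
  shows "(\<lambda>n. sqn M (s n)) \<longlonglongrightarrow> sqn M f"
proof -
  have "(\<lambda>n. sqrt (sqn M (\<lambda>x. f x - s n x))) \<longlonglongrightarrow> sqrt 0" by (intro tendsto_intros lim)
  then have lim': "(\<lambda>n. sqrt (sqn M (\<lambda>x. f x - s n x))) \<longlonglongrightarrow> 0" by simp
  have le: "\<bar>sqrt (sqn M (s n)) - sqrt (sqn M f)\<bar> \<le> sqrt (sqn M (\<lambda>x. f x - s n x))" for n
  proof -
    have "sqn M (\<lambda>x. s n x - f x) = sqn M (\<lambda>x. f x - s n x)"
      using sqn_uminus[of M "\<lambda>x. s n x - f x"] by simp
    then show ?thesis using sqrt_sqn_diff[OF f s[of n]] sqrt_sqn_diff[OF s[of n] f] by simp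
  qed
  have "(\<lambda>n. sqrt (sqn M (s n)) - sqrt (sqn M f)) \<longlonglongrightarrow> 0"
    by (rule Lim_null_comparison[OF always_eventually lim']) (simp add: le)
  then have "(\<lambda>n. sqrt (sqn M (s n))) \<longlonglongrightarrow> sqrt (sqn M f)" by (rule LIM_zero_cancel)
  then have "(\<lambda>n. (sqrt (sqn M (s n)))\<^sup>2) \<longlonglongrightarrow> (sqrt (sqn M f))\<^sup>2" by (rule tendsto_power)
  then show ?thesis by (simp only: real_sqrt_pow2[OF sqn_nonneg])
qed

text \<open>The gap inequality, fed with the energy bound on displacement, says that each averaging
  step loses at least the fraction \<open>1 / D\<close> of the energy, where
  \<open>D = C * (card K)\<^sup>2\<close>. \<open>1 \<le> C\<close> keeps the rate
  nonnegative.\<close>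

lemma (in averaging) sqn_avg_pow_le_of_gap:
  assumes gap: "\<And>f. bdd_meas M f \<Longrightarrow> (\<integral>x. f x \<partial>M) = 0 \<Longrightarrow> sqn M f \<le> C * (\<Sum>i\<in>K. sqn M (\<lambda>x. f (\<tau> i x) - f x))"
    and C: "1 \<le> C"
  shows "\<exists>\<rho>. 0 \<le> \<rho> \<and> \<rho> < 1 \<and> (\<forall>f l. bdd_meas M f \<longrightarrow> (\<integral>x. f x \<partial>M) = 0 \<longrightarrow> sqn M ((avg ^^ l) f) \<le> \<rho> ^ l * sqn M f)"
proof -
  define D where "D = C * (card K)\<^sup>2"
  have "1 * 1 \<le> C * (card K)\<^sup>2" using C card_K_pos by (intro mult_mono) auto
  then have D: "D \<ge> 1" by (simp add: D_def)
  define \<rho> where "\<rho> = 1 - 1 / D"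
  have \<rho>: "0 \<le> \<rho>" "\<rho> < 1" using D by (auto simp: \<rho>_def field_simps)
  have step: "sqn M (avg f) \<le> \<rho> * sqn M f" if f: "bdd_meas M f" "(\<integral>x. f x \<partial>M) = 0" for f
  proof -
    have "sqn M f \<le> C * ((card K)\<^sup>2 * (sqn M f - sqn M (avg f)))"
      using order.trans[OF gap[OF f] mult_left_mono[OF sum_sqn_defect[OF f(1)], of C]] C by simp
    then have "sqn M f \<le> D * (sqn M f - sqn M (avg f))" by (simp add: D_def mult.assoc)
    then show ?thesis using D by (simp add: \<rho>_def field_simps)
  qed
  have "sqn M ((avg ^^ l) f) \<le> \<rho> ^ l * sqn M f" if f: "bdd_meas M f" "(\<integral>x. f x \<partial>M) = 0" for f l
  proof (induction l)
    case (Suc l)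
    have "sqn M ((avg ^^ Suc l) f) \<le> \<rho> * sqn M ((avg ^^ l) f)"
      using step[OF bdd_meas_avg_pow[OF f(1)]] integral_avg_pow[OF f(1)] f(2) by simp
    also have "\<dots> \<le> \<rho> * (\<rho> ^ l * sqn M f)" using Suc \<rho> by (intro mult_left_mono) auto
    finally show ?case by (simp add: mult.assoc)
  qed simp
  then show ?thesis using \<rho> by blast
qed

locale gap_pair = A: mp_action G M1 a + B: mp_action G M2 b
  for G :: "('g, 'r) monoid_scheme" (structure) and M1 :: "'a measure" and a
    and M2 :: "'b measure" and b +
  fixes K :: "'g set" and C :: real
  assumes finite_K: "finite K" and K_carrier: "K \<subseteq> carrier G" and one_K: "\<one> \<in> K"
    and inv_K: "\<And>g. g \<in> K \<Longrightarrow> inv g \<in> K"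
    and C_ge: "1 \<le> C"
    and gap: "\<And>f. bdd_meas (M1 \<Otimes>\<^sub>M M1) f \<Longrightarrow> (\<integral>x. f x \<partial>(M1 \<Otimes>\<^sub>M M1)) = 0 \<Longrightarrow>
      sqn (M1 \<Otimes>\<^sub>M M1) f \<le> C * (\<Sum>g\<in>K. sqn (M1 \<Otimes>\<^sub>M M1) (\<lambda>x. f (pair_act M1 M1 a a g x) - f x))"
begin

abbreviation M11 :: "('a \<times> 'a) measure" where "M11 \<equiv> M1 \<Otimes>\<^sub>M M1"
abbreviation M12 :: "('a \<times> 'b) measure" where "M12 \<equiv> M1 \<Otimes>\<^sub>M M2"

sublocale P11: pair_prob_space M1 M1 ..
sublocale P12: pair_prob_space M1 M2 ..

sublocale Act11: mp_action G "M11" "pair_act M1 M1 a a"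
  by (rule mp_action_pair) (rule A.mp_action_axioms)+
sublocale Act12: mp_action G "M12" "pair_act M1 M2 a b"
  by (rule mp_action_pair) (rule A.mp_action_axioms B.mp_action_axioms)+

sublocale V11: averaging "M11" K "pair_act M1 M1 a a"
  by (rule Act11.averaging_act[OF finite_K K_carrier one_K inv_K])
sublocale V12: averaging "M12" K "pair_act M1 M2 a b"
  by (rule Act12.averaging_act[OF finite_K K_carrier one_K inv_K])

definition words :: "nat \<Rightarrow> 'g list set" where
  "words l = {w. set w \<subseteq> K \<and> length w = l}"

lemma card_words: "card (words l) = card K ^ l"
  using card_lists_length_eq[OF finite_K] by (simp add: words_def)

lemma words_carrier: "w \<in> words l \<Longrightarrow> set w \<subseteq> carrier G"
  using K_carrier by (auto simp: words_def)

text \<open>Matrix coefficient of the Koopman representation at the group element spelled by the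
  word \<open>w\<close>.\<close>

definition coeff1 :: "('a \<Rightarrow> real) \<Rightarrow> ('a \<Rightarrow> real) \<Rightarrow> 'g list \<Rightarrow> real" where
  "coeff1 u u' w = (\<integral>x. u (foldr a w x) * u' x \<partial>M1)"

definition coeff2 :: "('b \<Rightarrow> real) \<Rightarrow> ('b \<Rightarrow> real) \<Rightarrow> 'g list \<Rightarrow> real" where
  "coeff2 v v' w = (\<integral>x. v (foldr b w x) * v' x \<partial>M2)"

lemma bdd_meas_word1: "w \<in> words l \<Longrightarrow> bdd_meas M1 u \<Longrightarrow> bdd_meas M1 (\<lambda>x. u (foldr a w x))"
  by (rule bdd_meas_comp[where \<tau> = "foldr a w"]) (assumption, rule A.foldr_act_measurable[OF words_carrier])

lemma bdd_meas_word2: "w \<in> words l \<Longrightarrow> bdd_meas M2 v \<Longrightarrow> bdd_meas M2 (\<lambda>x. v (foldr b w x))"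
  by (rule bdd_meas_comp[where \<tau> = "foldr b w"]) (assumption, rule B.foldr_act_measurable[OF words_carrier])

lemma integral_avg_pow12_tensor:
  assumes "bdd_meas M1 u" "bdd_meas M1 u'" "bdd_meas M2 v" "bdd_meas M2 v'"
  shows "(\<integral>p. (V12.avg ^^ l) (\<lambda>p. u (fst p) * v (snd p)) p * (u' (fst p) * v' (snd p)) \<partial>M12)
    = (\<Sum>w\<in>words l. coeff1 u u' w * coeff2 v v' w) / card K ^ l"
proof -
  have "(\<integral>p. (V12.avg ^^ l) (\<lambda>p. u (fst p) * v (snd p)) p * (u' (fst p) * v' (snd p)) \<partial>M12)
    = (\<integral>p. (\<Sum>w\<in>words l. (u (foldr a w (fst p)) * u' (fst p)) * (v (foldr b w (snd p)) * v' (snd p))) / card K ^ l \<partial>M12)"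
  proof (rule Bochner_Integration.integral_cong[OF refl])
    fix p assume p: "p \<in> space M12"
    then obtain x y where xy: "p = (x, y)" "x \<in> space M1" "y \<in> space M2" by (auto simp: space_pair_measure)
    have "foldr (pair_act M1 M2 a b) w p = (foldr a w x, foldr b w y)" if "w \<in> words l" for w
      using foldr_pair_act[OF A.mp_action_axioms B.mp_action_axioms words_carrier[OF that]] xy by auto
    then show "(V12.avg ^^ l) (\<lambda>p. u (fst p) * v (snd p)) p * (u' (fst p) * v' (snd p))
      = (\<Sum>w\<in>words l. (u (foldr a w (fst p)) * u' (fst p)) * (v (foldr b w (snd p)) * v' (snd p))) / card K ^ l"
      unfolding V12.avg_pow_words words_def[symmetric] using xy
      by (simp add: sum_distrib_left sum_distrib_right mult.assoc mult.left_commute)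
  qed
  also have "\<dots> = (\<Sum>w\<in>words l. coeff1 u u' w * coeff2 v v' w) / card K ^ l"
    unfolding coeff1_def coeff2_def
  proof -
    have bm: "bdd_meas M1 (\<lambda>x. u (foldr a w x) * u' x)" "bdd_meas M2 (\<lambda>x. v (foldr b w x) * v' x)"
      if "w \<in> words l" for w
      by (intro bdd_meas_mult bdd_meas_word1[OF that] bdd_meas_word2[OF that] assms)+
    have "(\<integral>p. (\<Sum>w\<in>words l. (u (foldr a w (fst p)) * u' (fst p)) * (v (foldr b w (snd p)) * v' (snd p))) \<partial>M12)
      = (\<Sum>w\<in>words l. (\<integral>p. (u (foldr a w (fst p)) * u' (fst p)) * (v (foldr b w (snd p)) * v' (snd p)) \<partial>M12))"
      using P12.bdd_meas_fst[OF bm(1)] P12.bdd_meas_snd[OF bm(2)]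
      by (intro Bochner_Integration.integral_sum P12.integrable_bdd_meas
          bdd_meas_mult[where f = "\<lambda>p. u (foldr a w (fst p)) * u' (fst p)" for w]) auto
    also have "\<dots> = (\<Sum>w\<in>words l. (\<integral>x. u (foldr a w x) * u' x \<partial>M1) * (\<integral>x. v (foldr b w x) * v' x \<partial>M2))"
      by (intro sum.cong refl P12.integral_tensor bm)
    finally show "(\<integral>p. (\<Sum>w\<in>words l. (u (foldr a w (fst p)) * u' (fst p)) * (v (foldr b w (snd p)) * v' (snd p))) / card K ^ l \<partial>M12)
      = (\<Sum>w\<in>words l. (\<integral>x. u (foldr a w x) * u' x \<partial>M1) * (\<integral>x. v (foldr b w x) * v' x \<partial>M2)) / card K ^ l"
      by simp
  qed
  finally show ?thesis .
qed

text \<open>Using the same functions in both factors turns products of coefficients into squares.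
  This is how a gap on \<open>M11\<close> bounds the mean square of the coefficients on
  \<open>M1\<close>.\<close>

lemma integral_avg_pow11_tensor:
  assumes "bdd_meas M1 u" "bdd_meas M1 u'"
  shows "(\<integral>p. (V11.avg ^^ l) (\<lambda>p. u (fst p) * u (snd p)) p * (u' (fst p) * u' (snd p)) \<partial>M11)
    = (\<Sum>w\<in>words l. (coeff1 u u' w)\<^sup>2) / card K ^ l"
proof -
  interpret D: gap_pair G M1 a M1 a K C
    by unfold_locales (use finite_K K_carrier one_K inv_K C_ge gap in auto)
  have "D.words l = words l" "D.coeff2 u u' = coeff1 u u'" "D.coeff1 u u' = coeff1 u u'"
    by (auto simp: D.words_def words_def D.coeff2_def coeff1_def[abs_def] D.coeff1_def fun_eq_iff)
  then show ?thesis using D.integral_avg_pow12_tensor[OF assms assms]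
    by (simp add: power2_eq_square)
qed

lemma gap_decay:
  obtains \<rho> where "0 \<le> \<rho>" "\<rho> < 1"
    "\<And>f l. bdd_meas M11 f \<Longrightarrow> (\<integral>x. f x \<partial>M11) = 0 \<Longrightarrow>
      sqn M11 ((V11.avg ^^ l) f) \<le> \<rho> ^ l * sqn M11 f"
  using V11.sqn_avg_pow_le_of_gap[OF gap C_ge] by blast

lemma abs_coeff2_le:
  assumes "bdd_meas M2 v" "bdd_meas M2 v'"
  shows "\<exists>B\<ge>0. \<forall>l. \<forall>w\<in>words l. \<bar>coeff2 v v' w\<bar> \<le> B"
proof -
  obtain B1 where B1: "B1 \<ge> 0" "\<And>x. x \<in> space M2 \<Longrightarrow> \<bar>v x\<bar> \<le> B1" using bdd_measE[OF assms(1)] by metis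
  obtain B2 where B2: "B2 \<ge> 0" "\<And>x. x \<in> space M2 \<Longrightarrow> \<bar>v' x\<bar> \<le> B2" using bdd_measE[OF assms(2)] by metis
  have "\<bar>coeff2 v v' w\<bar> \<le> B1 * B2" if w: "w \<in> words l" for w l
  proof -
    have sp: "x \<in> space M2 \<Longrightarrow> foldr b w x \<in> space M2" for x
      using measurable_space[OF B.foldr_act_measurable[OF words_carrier[OF w]]] .
    have "\<bar>coeff2 v v' w\<bar> \<le> (\<integral>x. \<bar>v (foldr b w x) * v' x\<bar> \<partial>M2)"
      unfolding coeff2_def by (rule integral_abs_bound)
    also have "\<dots> \<le> (\<integral>x. B1 * B2 \<partial>M2)"
    proof (rule integral_mono)
      show "integrable M2 (\<lambda>x. \<bar>v (foldr b w x) * v' x\<bar>)"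
        by (intro B.integrable_bdd_meas bdd_meas_abs bdd_meas_mult bdd_meas_word2[OF w] assms)
    qed (auto simp: abs_mult intro!: mult_mono B1 B2 sp)
    finally show ?thesis by (simp add: B.prob_space)
  qed
  then show ?thesis using B1 B2 by (intro exI[of _ "B1 * B2"]) auto
qed

text \<open>Cauchy--Schwarz over words separates the two tensor factors; the coefficients in the first
  factor are controlled by the gap on \<open>M11\<close>, those in the second one are bounded.\<close>

lemma tensor_coeff_decay:
  assumes u: "bdd_meas M1 u" "bdd_meas M1 u'" "(\<integral>x. u x \<partial>M1) = 0" and v: "bdd_meas M2 v" "bdd_meas M2 v'"
    and \<rho>: "0 \<le> \<rho>" "\<And>f l. bdd_meas M11 f \<Longrightarrow> (\<integral>x. f x \<partial>M11) = 0 \<Longrightarrow>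
      sqn M11 ((V11.avg ^^ l) f) \<le> \<rho> ^ l * sqn M11 f"
  shows "\<exists>D\<ge>0. \<forall>l. \<bar>\<integral>p. (V12.avg ^^ (l + l)) (\<lambda>p. u (fst p) * v (snd p)) p * (u' (fst p) * v' (snd p)) \<partial>M12\<bar>
    \<le> D * sqrt \<rho> ^ l"
proof -
  obtain B where B: "B \<ge> 0" "\<And>l w. w \<in> words l \<Longrightarrow> \<bar>coeff2 v v' w\<bar> \<le> B" using abs_coeff2_le[OF v] by blast
  define f f' where "f = (\<lambda>p. u (fst p) * u (snd p))" and "f' = (\<lambda>p. u' (fst p) * u' (snd p))"
  have f: "bdd_meas M11 f" "bdd_meas M11 f'"
    unfolding f_def f'_def by (intro bdd_meas_mult P11.bdd_meas_fst P11.bdd_meas_snd u)+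
  \<comment> \<open>The only use of the zero mean of \<open>u\<close>: it puts \<open>f\<close>
    among the functions to which the decay on \<open>M11\<close> applies.\<close>
  have f0: "(\<integral>x. f x \<partial>M11) = 0" unfolding f_def by (subst P11.integral_tensor) (auto simp: u)
  define S where "S = sqn M11 f * sqn M11 f'"
  have S: "S \<ge> 0" by (simp add: S_def)
  have "\<bar>\<integral>p. (V12.avg ^^ (l + l)) (\<lambda>p. u (fst p) * v (snd p)) p * (u' (fst p) * v' (snd p)) \<partial>M12\<bar>
    \<le> (B * sqrt (sqrt S)) * sqrt \<rho> ^ l" (is "\<bar>?I\<bar> \<le> _") for l
  proof -
    \<comment> \<open>With words of length \<open>l + l\<close> the first square root leaves
      \<open>\<rho> ^ l\<close> for the mean square of the coefficients; Cauchy-Schwarz over words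
      takes the second root.\<close>
    let ?W = "words (l + l)" and ?k = "real (card K) ^ (l + l)"
    have k: "?k > 0" using V11.card_K_pos by simp
    have "(\<Sum>w\<in>?W. (coeff1 u u' w)\<^sup>2) / ?k = (\<integral>p. (V11.avg ^^ (l + l)) f p * f' p \<partial>M11)"
      using integral_avg_pow11_tensor[OF u(1,2), of "l + l"] by (simp add: f_def f'_def)
    also have "\<dots> \<le> sqrt (sqn M11 ((V11.avg ^^ (l + l)) f) * sqn M11 f')"
      by (rule real_le_rsqrt[OF P11.integral_mult_sq_le[OF V11.bdd_meas_avg_pow[OF f(1)] f(2)]])
    also have "\<dots> \<le> sqrt (\<rho> ^ (l + l) * sqn M11 f * sqn M11 f')"
      by (intro real_sqrt_le_mono mult_right_mono \<rho>(2) f f0) auto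
    also have "\<dots> = sqrt (\<rho> ^ (l + l)) * sqrt S" by (simp add: S_def real_sqrt_mult mult.assoc)
    also have "sqrt (\<rho> ^ (l + l)) = \<rho> ^ l" using \<rho>(1) by (simp add: power_add)
    finally have c1: "(\<Sum>w\<in>?W. (coeff1 u u' w)\<^sup>2) / ?k \<le> \<rho> ^ l * sqrt S" .
    have "(\<Sum>w\<in>?W. (coeff2 v v' w)\<^sup>2) \<le> (\<Sum>w\<in>?W. B\<^sup>2)"
      by (intro sum_mono) (metis B(2) abs_ge_zero power2_abs power_mono)
    then have c2: "(\<Sum>w\<in>?W. (coeff2 v v' w)\<^sup>2) / ?k \<le> B\<^sup>2" using k by (simp add: card_words field_simps)
    have "?I\<^sup>2 = (\<Sum>w\<in>?W. coeff1 u u' w * coeff2 v v' w)\<^sup>2 / ?k\<^sup>2"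
      by (simp add: integral_avg_pow12_tensor[OF u(1,2) v] power_divide)
    also have "\<dots> \<le> ((\<Sum>w\<in>?W. (coeff1 u u' w)\<^sup>2) * (\<Sum>w\<in>?W. (coeff2 v v' w)\<^sup>2)) / ?k\<^sup>2"
      by (intro divide_right_mono Cauchy_Schwarz_ineq_sum) auto
    also have "\<dots> = ((\<Sum>w\<in>?W. (coeff1 u u' w)\<^sup>2) / ?k) * ((\<Sum>w\<in>?W. (coeff2 v v' w)\<^sup>2) / ?k)"
      by (simp add: power2_eq_square)
    also have "\<dots> \<le> (\<rho> ^ l * sqrt S) * B\<^sup>2"
      using c1 c2 \<rho>(1) S k by (intro mult_mono) (auto intro!: divide_nonneg_nonneg sum_nonneg)
    also have "\<dots> = ((B * sqrt (sqrt S)) * sqrt \<rho> ^ l)\<^sup>2"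
      using \<rho>(1) S by (simp add: power_mult_distrib) (simp add: power_mult[symmetric] mult.commute[of _ 2] power_mult)
    finally show ?thesis using B(1) S \<rho>(1) by (intro power2_le_imp_le[of "\<bar>?I\<bar>"]) auto
  qed
  then show ?thesis using B S by (intro exI[of _ "B * sqrt (sqrt S)"]) auto
qed

text \<open>The decay constants \<open>D i j\<close> depend on the tensor sum, but the rate
  \<open>sqrt \<rho>\<close> does not. Log-convexity discards the constants, so the resulting gap is
  uniform over all tensor sums.\<close>

lemma centred_tensor_sum_gap:
  assumes \<rho>: "0 \<le> \<rho>" "\<rho> < 1" "\<And>f l. bdd_meas M11 f \<Longrightarrow> (\<integral>x. f x \<partial>M11) = 0 \<Longrightarrow>
      sqn M11 ((V11.avg ^^ l) f) \<le> \<rho> ^ l * sqn M11 f"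
    and s: "s = (\<lambda>p. \<Sum>j<n::nat. u j (fst p) * v j (snd p))"
    and uv: "\<And>j. j < n \<Longrightarrow> bdd_meas M1 (u j)" "\<And>j. j < n \<Longrightarrow> bdd_meas M2 (v j)" "\<And>j. j < n \<Longrightarrow> (\<integral>x. u j x \<partial>M1) = 0"
  shows "(1 - sqrt (sqrt \<rho>))\<^sup>2 * sqn M12 s
    \<le> (\<Sum>g\<in>K. sqn M12 (\<lambda>p. s (pair_act M1 M2 a b g p) - s p))"
proof -
  define t where "t j p = u j (fst p) * v j (snd p)" for j p
  have t: "bdd_meas M12 (t j)" if "j < n" for j
    unfolding t_def using that by (intro bdd_meas_mult P12.bdd_meas_fst P12.bdd_meas_snd uv)
  have s_t: "s = (\<lambda>p. \<Sum>j<n. t j p)" by (simp add: s t_def)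
  have sb: "bdd_meas M12 s" unfolding s_t using t by (intro bdd_meas_sum) auto
  define I where "I l i j = (\<integral>p. (V12.avg ^^ (l + l)) (t i) p * t j p \<partial>M12)" for l i j
  have "\<forall>i j. \<exists>D\<ge>0. i < n \<longrightarrow> j < n \<longrightarrow> (\<forall>l. \<bar>I l i j\<bar> \<le> D * sqrt \<rho> ^ l)"
    using tensor_coeff_decay[OF uv(1) uv(1) uv(3) uv(2) uv(2) \<rho>(1,3)] unfolding I_def t_def by blast
  then obtain D where D: "\<And>i j. D i j \<ge> 0" "\<And>i j l. i < n \<Longrightarrow> j < n \<Longrightarrow> \<bar>I l i j\<bar> \<le> D i j * sqrt \<rho> ^ l"
    by metis
  have "sqn M12 ((V12.avg ^^ l) s) \<le> (\<Sum>i<n. \<Sum>j<n. D i j) * sqrt \<rho> ^ l" for l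
  proof -
    have "sqn M12 ((V12.avg ^^ l) s) = (\<integral>p. (\<Sum>i<n. \<Sum>j<n. (V12.avg ^^ (l + l)) (t i) p * t j p) \<partial>M12)"
      unfolding V12.sqn_avg_pow[OF sb] by (simp add: s_t V12.avg_pow_sum sum_product)
    also have "\<dots> = (\<Sum>i<n. \<Sum>j<n. I l i j)"
    proof -
      have "integrable M12 (\<lambda>p. (V12.avg ^^ (l + l)) (t i) p * t j p)" if "i < n" "j < n" for i j
        by (intro P12.integrable_bdd_meas bdd_meas_mult V12.bdd_meas_avg_pow t that)
      then show ?thesis
        unfolding I_def
        by (subst Bochner_Integration.integral_sum, force intro: Bochner_Integration.integrable_sum)
          (intro sum.cong refl Bochner_Integration.integral_sum, auto)
    qed
    also have "\<dots> \<le> (\<Sum>i<n. \<Sum>j<n. D i j * sqrt \<rho> ^ l)"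
      using D(2) by (intro sum_mono) (meson abs_le_D1 lessThan_iff)
    finally show ?thesis by (simp add: sum_distrib_right)
  qed
  then have "sqn M12 (V12.avg s) \<le> sqrt \<rho> * sqn M12 s"
    by (rule V12.sqn_avg_le_of_decay[OF sb]) (use \<rho> in auto)
  then show ?thesis
    by (rule V12.sqn_le_defect_of_contraction[OF sb]) (use \<rho> in auto)
qed

lemma mean_fst_act:
  assumes f: "bdd_meas M12 f" and g: "g \<in> carrier G" and x: "x \<in> space M2"
  shows "mean_fst M1 (\<lambda>p. f (pair_act M1 M2 a b g p)) x = mean_fst M1 f (b g x)"
proof -
  have "mean_fst M1 (\<lambda>p. f (pair_act M1 M2 a b g p)) x = (\<integral>z. f (a g z, b g x) \<partial>M1)"
    unfolding mean_fst_def by (rule Bochner_Integration.integral_cong) (auto simp: pair_act_eq x)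
  also have "\<dots> = mean_fst M1 f (b g x)" unfolding mean_fst_def
    using A.integral_act[OF g, of "\<lambda>z. f (z, b g x)"] P12.bdd_meas_slice[OF f B.act_space[OF g x]] by auto
  finally show ?thesis .
qed

text \<open>The gap for centred tensor sums has a constant depending only on \<open>\<rho>\<close>,
  so both sides pass to the L2 limit. Centring is a contraction, hence approximations of
  \<open>f\<close> give centred approximations of its centred part.\<close>

proposition stable_gap:
  "\<exists>C'\<ge>0. \<forall>f. bdd_meas M12 f \<longrightarrow>
     sqn M12 (\<lambda>p. f p - mean_fst M1 f (snd p))
     \<le> C' * (\<Sum>g\<in>K. sqn M12 (\<lambda>p. f (pair_act M1 M2 a b g p) - f p))"
proof -
  obtain \<rho> where \<rho>: "0 \<le> \<rho>" "\<rho> < 1"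
    "\<And>f l. bdd_meas M11 f \<Longrightarrow> (\<integral>x. f x \<partial>M11) = 0 \<Longrightarrow>
      sqn M11 ((V11.avg ^^ l) f) \<le> \<rho> ^ l * sqn M11 f" by (rule gap_decay) blast
  define c where "c = (1 - sqrt (sqrt \<rho>))\<^sup>2"
  have c: "c > 0" using \<rho> by (simp add: c_def)
  let ?M = "M12" and ?\<tau> = "pair_act M1 M2 a b"
  define cen where "cen f p = f p - mean_fst M1 f (snd p)" for f :: "'a \<times> 'b \<Rightarrow> real" and p
  have cen_bdd: "bdd_meas ?M (cen f)" if "bdd_meas ?M f" for f
    unfolding cen_def by (intro bdd_meas_diff P12.bdd_meas_snd P12.bdd_meas_mean_fst that)
  have cen_diff: "cen (\<lambda>p. f p - h p) p = cen f p - cen h p"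
    if "bdd_meas ?M f" "bdd_meas ?M h" "p \<in> space ?M" for f h p
    using P12.mean_fst_diff[OF that(1,2)] that(3) by (auto simp: cen_def space_pair_measure)
  have main: "c * sqn ?M (cen f) \<le> (\<Sum>g\<in>K. sqn ?M (\<lambda>p. f (?\<tau> g p) - f p))" if f: "bdd_meas ?M f" for f
  proof -
    have "\<exists>s. P12.tensor_sum s \<and> sqn ?M (\<lambda>p. f p - s p) < inverse (real (Suc m))" for m
      using P12.tensor_approx_bdd_meas[OF f] by (auto simp: P12.tensor_approx_def)
    then obtain s where s: "\<And>m. P12.tensor_sum (s m)" "\<And>m. sqn ?M (\<lambda>p. f p - s m p) < inverse (real (Suc m))"
      by metis
    have sb: "bdd_meas ?M (s m)" for m using P12.tensor_sum_bdd_meas s by blast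
    have lim: "(\<lambda>m. sqn ?M (\<lambda>p. cen f p - cen (s m) p)) \<longlonglongrightarrow> 0"
    proof (rule Lim_null_comparison[OF always_eventually LIMSEQ_inverse_real_of_nat], rule allI)
      fix m
      have "sqn ?M (\<lambda>p. cen f p - cen (s m) p) = sqn ?M (cen (\<lambda>p. f p - s m p))"
        by (rule sqn_cong) (simp add: cen_diff f sb)
      also have "\<dots> \<le> sqn ?M (\<lambda>p. f p - s m p)"
        unfolding cen_def by (rule P12.sqn_centre_le) (intro bdd_meas_diff f sb)
      finally show "norm (sqn ?M (\<lambda>p. cen f p - cen (s m) p)) \<le> inverse (real (Suc m))"
        using s(2)[of m] by simp
    qed
    have gap_s: "c * sqn ?M (cen (s m)) \<le> (\<Sum>g\<in>K. sqn ?M (\<lambda>p. cen (s m) (?\<tau> g p) - cen (s m) p))" for m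
    proof -
      obtain n u v where uv: "\<And>j. j < n \<Longrightarrow> bdd_meas M1 (u j)" "\<And>j. j < n \<Longrightarrow> bdd_meas M2 (v j)"
        "s m = (\<lambda>p. \<Sum>j<n::nat. u j (fst p) * v j (snd p))" using s(1)[of m] by (auto simp: P12.tensor_sum_def)
      define u' where "u' j x = u j x - (\<integral>z. u j z \<partial>M1)" for j x
      have "mean_fst M1 (s m) y = (\<Sum>j<n. (\<integral>z. u j z \<partial>M1) * v j y)" for y
        unfolding mean_fst_def uv(3) using uv(1)
        by (simp, subst Bochner_Integration.integral_sum) (auto intro!: A.integrable_bdd_meas)
      then have eq: "cen (s m) = (\<lambda>p. \<Sum>j<n. u' j (fst p) * v j (snd p))"
        by (auto simp: cen_def uv(3) u'_def left_diff_distrib sum_subtractf)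
      show ?thesis unfolding c_def
      proof (rule centred_tensor_sum_gap[OF \<rho> eq])
        show "bdd_meas M1 (u' j)" if "j < n" for j unfolding u'_def using uv(1)[OF that] by auto
        show "(\<integral>x. u' j x \<partial>M1) = 0" if "j < n" for j
          unfolding u'_def using A.integrable_bdd_meas[OF uv(1)[OF that]] by (simp add: A.prob_space)
      qed (use uv in auto)
    qed
    have "(\<lambda>m. c * sqn ?M (cen (s m))) \<longlonglongrightarrow> c * sqn ?M (cen f)"
      by (intro tendsto_mult tendsto_const P12.sqn_tendsto[OF _ _ lim] cen_bdd f sb)
    moreover have "(\<lambda>m. \<Sum>g\<in>K. sqn ?M (\<lambda>p. cen (s m) (?\<tau> g p) - cen (s m) p))
      \<longlonglongrightarrow> (\<Sum>g\<in>K. sqn ?M (\<lambda>p. cen f (?\<tau> g p) - cen f p))"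
    proof (intro tendsto_sum P12.sqn_tendsto)
      fix g assume g: "g \<in> K"
      note bdd_\<tau> = V12.bdd_meas_\<tau>[OF g]
      show "bdd_meas ?M (\<lambda>p. cen f (?\<tau> g p) - cen f p)" "\<And>m. bdd_meas ?M (\<lambda>p. cen (s m) (?\<tau> g p) - cen (s m) p)"
        by (intro bdd_meas_diff bdd_\<tau> cen_bdd f sb)+
      have d: "bdd_meas ?M (\<lambda>p. cen f p - cen (s m) p)" for m by (intro bdd_meas_diff cen_bdd f sb)
      have "sqn ?M (\<lambda>p. (cen f (?\<tau> g p) - cen f p) - (cen (s m) (?\<tau> g p) - cen (s m) p))
        \<le> 4 * sqn ?M (\<lambda>p. cen f p - cen (s m) p)" for m
        using P12.sqn_diff_le[OF bdd_\<tau>[OF d[of m]] d[of m]] Act12.sqn_act[of g "\<lambda>p. cen f p - cen (s m) p"] d[of m] g K_carrier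
        by (auto simp: algebra_simps)
      note le = this
      have "(\<lambda>m. 4 * sqn ?M (\<lambda>p. cen f p - cen (s m) p)) \<longlonglongrightarrow> 0"
        using tendsto_mult[OF tendsto_const lim, of 4] by simp
      then show "(\<lambda>m. sqn ?M (\<lambda>p. (cen f (?\<tau> g p) - cen f p) - (cen (s m) (?\<tau> g p) - cen (s m) p))) \<longlonglongrightarrow> 0"
        by (rule Lim_null_comparison[OF always_eventually, rotated]) (simp add: le)
    qed
    ultimately have "c * sqn ?M (cen f) \<le> (\<Sum>g\<in>K. sqn ?M (\<lambda>p. cen f (?\<tau> g p) - cen f p))"
      by (rule LIMSEQ_le) (use gap_s in auto)
    \<comment> \<open>Centring commutes with the action, so the displacement of the centred function
      is the centred displacement, which is no larger.\<close>
    also have "\<dots> \<le> (\<Sum>g\<in>K. sqn ?M (\<lambda>p. f (?\<tau> g p) - f p))"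
    proof (rule sum_mono)
      fix g assume g: "g \<in> K"
      then have gG: "g \<in> carrier G" using K_carrier by auto
      have f\<tau>: "bdd_meas ?M (\<lambda>p. f (?\<tau> g p))" by (rule V12.bdd_meas_\<tau>[OF g f])
      have "cen f (?\<tau> g p) = cen (\<lambda>p. f (?\<tau> g p)) p" if "p \<in> space ?M" for p
        using that by (auto simp: cen_def space_pair_measure pair_act_eq mean_fst_act[OF f gG])
      then have "sqn ?M (\<lambda>p. cen f (?\<tau> g p) - cen f p) = sqn ?M (cen (\<lambda>p. f (?\<tau> g p) - f p))"
        by (intro sqn_cong) (simp add: cen_diff f f\<tau>)
      also have "\<dots> \<le> sqn ?M (\<lambda>p. f (?\<tau> g p) - f p)"
        unfolding cen_def by (rule P12.sqn_centre_le) (intro bdd_meas_diff f f\<tau>)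
      finally show "sqn ?M (\<lambda>p. cen f (?\<tau> g p) - cen f p) \<le> sqn ?M (\<lambda>p. f (?\<tau> g p) - f p)" .
    qed
    finally show ?thesis .
  qed
  show ?thesis
  proof (intro exI[of _ "1 / c"] conjI allI impI)
    fix f assume "bdd_meas ?M f"
    from main[OF this] c
    show "sqn ?M (\<lambda>p. f p - mean_fst M1 f (snd p)) \<le> 1 / c * (\<Sum>g\<in>K. sqn ?M (\<lambda>p. f (?\<tau> g p) - f p))"
      by (simp add: cen_def[abs_def] field_simps)
  qed (use c in auto)
qed

end

section \<open>From absence of almost invariant vectors to a finite set and a constant\<close>

section \<open>Spectral gap as an inequality\<close>

lemma pmp_action_mp_action:
  assumes "pmp_action G M b" shows "mp_action G M b"
proof -
  have ga: "group_action G (space M) b" and ps: "prob_space M"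
    and mp: "\<And>g. g \<in> carrier G \<Longrightarrow> b g \<in> M \<rightarrow>\<^sub>M M" "\<And>g. g \<in> carrier G \<Longrightarrow> distr M M (b g) = M"
    using assms by (auto simp: pmp_action_def standard_prob_space_def measure_preserving_map_def)
  interpret group_action G "space M" b by fact
  interpret group_hom G "BijGroup (space M)" b by (rule group_hom)
  interpret prob_space M by fact
  show ?thesis
  proof
    show "b \<one>\<^bsub>G\<^esub> x = x" if "x \<in> space M" for x using that id_eq_one by (metis restrict_apply')
    show "b (g \<otimes>\<^bsub>G\<^esub> h) x = b g (b h x)" if "g \<in> carrier G" "h \<in> carrier G" "x \<in> space M" for g h x
      using that by (intro composition_rule)
  qed (use mp in auto)
qed

context mp_action
begin

lemma L2_norm_koopman_diff:
  fixes f :: "'a \<Rightarrow> real"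
  shows "L2_norm M (\<lambda>x. koopman G b g (\<lambda>x. complex_of_real (f x / s)) x - complex_of_real (f x / s))
    = sqrt (sqn M (\<lambda>x. f (b (inv g) x) - f x)) / \<bar>s\<bar>"
proof -
  have "(cmod (koopman G b g (\<lambda>x. complex_of_real (f x / s)) x - complex_of_real (f x / s)))\<^sup>2
    = (f (b (inv g) x) - f x)\<^sup>2 / s\<^sup>2" for x
    by (simp add: koopman_def diff_divide_distrib[symmetric] power_divide norm_divide norm_of_real
        flip: of_real_diff of_real_divide)
  then show ?thesis by (simp add: L2_norm_def sqn_def real_sqrt_divide)
qed

text \<open>If every finite set and constant failed, counterexamples for an exhaustion of the group
  with constants tending to infinity would normalise to almost invariant unit vectors of mean
  zero.\<close>

lemma spectral_gap_inequality:
  assumes count: "countable (carrier G)" and gap: "spectral_gap G M b"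
  obtains K C where "finite K" "K \<subseteq> carrier G" "\<one> \<in> K" "\<And>g. g \<in> K \<Longrightarrow> inv g \<in> K" "1 \<le> C"
    "\<And>f. bdd_meas M f \<Longrightarrow> (\<integral>x. f x \<partial>M) = 0 \<Longrightarrow> sqn M f \<le> C * (\<Sum>g\<in>K. sqn M (\<lambda>x. f (b g x) - f x))"
proof (rule ccontr)
  assume neg: "\<not> thesis"
  define e where "e = from_nat_into (carrier G)"
  have e: "e i \<in> carrier G" for i unfolding e_def by (rule from_nat_into) auto
  \<comment> \<open>Inverses are included both for the symmetry of \<open>K\<close> and because
    \<open>koopman\<close> acts through \<open>inv g\<close>.\<close>
  define K where "K m = insert \<one> (e ` {..m} \<union> (\<lambda>i. inv (e i)) ` {..m})" for m :: nat
  have K: "finite (K m)" "K m \<subseteq> carrier G" "\<one> \<in> K m" "\<And>g. g \<in> K m \<Longrightarrow> inv g \<in> K m" for m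
    using e by (auto simp: K_def)
  have "\<exists>f. bdd_meas M f \<and> (\<integral>x. f x \<partial>M) = 0 \<and> \<not> sqn M f \<le> real (Suc m) * (\<Sum>g\<in>K m. sqn M (\<lambda>x. f (b g x) - f x))" for m
  proof (rule ccontr)
    assume "\<not> ?thesis"
    then have "\<And>f. bdd_meas M f \<Longrightarrow> (\<integral>x. f x \<partial>M) = 0 \<Longrightarrow> sqn M f \<le> real (Suc m) * (\<Sum>g\<in>K m. sqn M (\<lambda>x. f (b g x) - f x))"
      by blast
    then have "thesis" by (intro that[OF K(1,2,3) K(4), of m "real (Suc m)"]) simp_all
    with neg show False by contradiction
  qed
  then have "\<forall>m. \<exists>f. bdd_meas M f \<and> (\<integral>x. f x \<partial>M) = 0 \<and> \<not> sqn M f \<le> real (Suc m) * (\<Sum>g\<in>K m. sqn M (\<lambda>x. f (b g x) - f x))"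
    by blast
  from choice[OF this] obtain f where f: "\<And>m. bdd_meas M (f m)" "\<And>m. (\<integral>x. f m x \<partial>M) = 0"
    "\<And>m. real (Suc m) * (\<Sum>g\<in>K m. sqn M (\<lambda>x. f m (b g x) - f m x)) < sqn M (f m)"
    unfolding not_le by blast
  have pos: "sqn M (f m) > 0" for m
    by (rule le_less_trans[OF _ f(3)]) (auto intro!: mult_nonneg_nonneg sum_nonneg simp del: of_nat_Suc)
  define s where "s m = sqrt (sqn M (f m))" for m
  have s: "s m > 0" for m using pos by (simp add: s_def)
  define \<xi> where "\<xi> m x = complex_of_real (f m x / s m)" for m x
  have "\<xi> m \<in> L2 M" for m
    using integrable_bdd_meas[OF bdd_meas_power2[OF bdd_meas_divide[OF f(1), of m "s m"]]] f(1)[of m]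
    by (auto simp: L2_def \<xi>_def[abs_def] norm_divide power_divide)
  moreover have "L2_inner M (\<xi> m) (\<lambda>_. 1) = 0" for m
  proof -
    have "L2_inner M (\<xi> m) (\<lambda>_. 1) = complex_of_real (\<integral>x. f m x / s m \<partial>M)"
      unfolding L2_inner_def \<xi>_def by (simp del: of_real_divide)
    then show ?thesis using f(2) by simp
  qed
  moreover have "L2_norm M (\<xi> m) = 1" for m
  proof -
    have "L2_norm M (\<xi> m) = sqrt (sqn M (f m) / (s m)\<^sup>2)"
      unfolding L2_norm_def \<xi>_def sqn_def by (simp add: norm_divide power_divide)
    then show ?thesis using pos[of m] by (simp add: s_def)
  qed
  moreover have "(\<lambda>m. L2_norm M (\<lambda>x. koopman G b g (\<xi> m) x - \<xi> m x)) \<longlonglongrightarrow> 0" if g: "g \<in> carrier G" for g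
  proof (rule Lim_null_comparison)
    obtain i where i: "e i = g" using from_nat_into_surj[OF count g] by (auto simp: e_def)
    show "\<forall>\<^sub>F m in sequentially. norm (L2_norm M (\<lambda>x. koopman G b g (\<xi> m) x - \<xi> m x)) \<le> sqrt (inverse (real (Suc m)))"
      unfolding eventually_sequentially
    proof (intro exI[of _ i] allI impI)
      fix m assume "i \<le> m"
      then have "inv g \<in> K m" using i by (auto simp: K_def)
      then have "sqn M (\<lambda>x. f m (b (inv g) x) - f m x) \<le> (\<Sum>g\<in>K m. sqn M (\<lambda>x. f m (b g x) - f m x))"
        using K(1) by (intro member_le_sum) auto
      then have "real (Suc m) * sqn M (\<lambda>x. f m (b (inv g) x) - f m x) < sqn M (f m)"
        by (intro le_less_trans[OF mult_left_mono f(3)]) auto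
      then have "sqn M (\<lambda>x. f m (b (inv g) x) - f m x) / sqn M (f m) \<le> inverse (real (Suc m))"
        using pos[of m] by (simp add: field_simps)
      then have "sqrt (sqn M (\<lambda>x. f m (b (inv g) x) - f m x) / sqn M (f m)) \<le> sqrt (inverse (real (Suc m)))"
        by (rule real_sqrt_le_mono)
      moreover have "L2_norm M (\<lambda>x. koopman G b g (\<xi> m) x - \<xi> m x) = sqrt (sqn M (\<lambda>x. f m (b (inv g) x) - f m x) / sqn M (f m))"
        using L2_norm_koopman_diff[of g "f m" "s m"] s[of m] by (simp add: \<xi>_def[abs_def] s_def real_sqrt_divide)
      ultimately show "norm (L2_norm M (\<lambda>x. koopman G b g (\<xi> m) x - \<xi> m x)) \<le> sqrt (inverse (real (Suc m)))"
        by (simp add: L2_norm_def)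
    qed
    have "(\<lambda>m. sqrt (inverse (real (Suc m)))) \<longlonglongrightarrow> sqrt 0"
      by (intro tendsto_real_sqrt LIMSEQ_inverse_real_of_nat)
    then show "(\<lambda>m. sqrt (inverse (real (Suc m)))) \<longlonglongrightarrow> 0" by simp
  qed
  ultimately show False using gap unfolding spectral_gap_def by blast
qed

end


section \<open>The infinite product, viewed through independent resampling of one coordinate\<close>

section \<open>Diagonal actions on infinite products\<close>

locale diagonal_pmp = group G for G :: "('g, 'r) monoid_scheme" (structure) +
  fixes X :: "nat \<Rightarrow> 'a measure" and a :: "nat \<Rightarrow> 'g \<Rightarrow> 'a \<Rightarrow> 'a"
  assumes mp: "mp_action G (X n) (a n)"
begin

abbreviation M :: "(nat \<Rightarrow> 'a) measure" where "M \<equiv> \<Pi>\<^sub>M n\<in>UNIV. X n"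
abbreviation T :: "'g \<Rightarrow> (nat \<Rightarrow> 'a) \<Rightarrow> (nat \<Rightarrow> 'a)" where "T \<equiv> diagonal_action X a"

sublocale X: mp_action G "X n" "a n" for n by (rule mp)
sublocale PM: prob_space M by (intro prob_space_PiM) (rule X.prob_space_axioms)
sublocale PX: product_prob_space X UNIV ..

lemma space_M: "x \<in> space M \<longleftrightarrow> (\<forall>n. x n \<in> space (X n))"
  by (auto simp: space_PiM PiE_iff)

lemma T_eq: "x \<in> space M \<Longrightarrow> T g x = (\<lambda>n. a n g (x n))"
  by (simp add: diagonal_action_def)

lemma T_measurable: assumes g: "g \<in> carrier G" shows "T g \<in> M \<rightarrow>\<^sub>M M"
proof -
  note [measurable] = X.act_measurable[OF g]
  have "(\<lambda>x n. a n g (x n)) \<in> M \<rightarrow>\<^sub>M M"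
    by (rule measurable_PiM_single') (auto simp: space_M X.act_space[OF g])
  then show ?thesis by (rule measurable_cong[THEN iffD1, rotated]) (simp add: T_eq)
qed

lemma T_distr: assumes g: "g \<in> carrier G" shows "distr M M (T g) = M"
proof (rule PX.PiM_eq)
  fix J F assume J: "finite J" "J \<subseteq> UNIV" and F: "\<And>j. j \<in> J \<Longrightarrow> F j \<in> sets (X j)"
  define F' where "F' j = a j g -` F j \<inter> space (X j)" for j
  have F': "F' j \<in> sets (X j)" if "j \<in> J" for j
    using F[OF that] X.act_measurable[OF g] by (auto simp: F'_def)
  have F'_em: "emeasure (X j) (F' j) = emeasure (X j) (F j)" if "j \<in> J" for j
    using emeasure_distr[OF X.act_measurable[OF g] F[OF that]] X.act_distr[OF g] by (simp add: F'_def)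
  have "emeasure (distr M M (T g)) (prod_emb UNIV X J (Pi\<^sub>E J F))
    = emeasure M (T g -` prod_emb UNIV X J (Pi\<^sub>E J F) \<inter> space M)"
    by (rule emeasure_distr[OF T_measurable[OF g]]) (use J F in \<open>auto intro!: sets_PiM_I\<close>)
  also have "T g -` prod_emb UNIV X J (Pi\<^sub>E J F) \<inter> space M = prod_emb UNIV X J (Pi\<^sub>E J F')"
    by (auto simp: prod_emb_def space_M[unfolded space_PiM] T_eq space_PiM F'_def PiE_iff X.act_space[OF g])
  also have "emeasure M \<dots> = (\<Prod>j\<in>J. emeasure (X j) (F' j))"
    by (rule PX.emeasure_PiM_emb) (use J F' in auto)
  also have "\<dots> = (\<Prod>j\<in>J. emeasure (X j) (F j))" by (intro prod.cong refl F'_em)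
  finally show "emeasure (distr M M (T g)) (prod_emb UNIV X J (Pi\<^sub>E J F)) = (\<Prod>j\<in>J. emeasure (X j) (F j))" .
qed simp

lemma T_space: "g \<in> carrier G \<Longrightarrow> x \<in> space M \<Longrightarrow> T g x \<in> space M"
  using measurable_space[OF T_measurable] .

sublocale MT: mp_action G M T
proof
  show "T \<one> x = x" if "x \<in> space M" for x using that by (auto simp: T_eq X.act_one space_M)
  show "T (g \<otimes> h) x = T g (T h x)" if "g \<in> carrier G" "h \<in> carrier G" "x \<in> space M" for g h x
    using that T_space[of h x] by (auto simp: T_eq X.act_mult space_M X.act_space)
qed (auto intro: T_measurable T_distr)

text \<open>The conditional expectation given all coordinates other than \<open>n\<close>, written
  on the full product although it ignores \<open>x n\<close>.\<close>

definition coord_mean :: "nat \<Rightarrow> ((nat \<Rightarrow> 'a) \<Rightarrow> real) \<Rightarrow> (nat \<Rightarrow> 'a) \<Rightarrow> real" where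
  "coord_mean n f x = (\<integral>y. f (x(n := y)) \<partial>X n)"

text \<open>An equivariant measure preserving map. It makes the product a factor of
  \<open>X n \<Otimes>\<^sub>M M\<close>, where the stable gap is available, without splitting the
  index set.\<close>

definition resample :: "nat \<Rightarrow> 'a \<times> (nat \<Rightarrow> 'a) \<Rightarrow> (nat \<Rightarrow> 'a)" where
  "resample n = (\<lambda>(y, x). x(n := y))"

sublocale RP: pair_prob_space "X n" M for n ..

lemma coord_mean_eq: "coord_mean n f x = mean_fst (X n) (\<lambda>p. f (resample n p)) x"
  by (simp add: coord_mean_def mean_fst_def resample_def)

lemma resample_measurable: "resample n \<in> X n \<Otimes>\<^sub>M M \<rightarrow>\<^sub>M M"
proof -
  have "(\<lambda>p. (case (snd p, fst p) of (f, y) \<Rightarrow> f(n := y))) \<in> X n \<Otimes>\<^sub>M M \<rightarrow>\<^sub>M (\<Pi>\<^sub>M n\<in>insert n UNIV. X n)"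
    by (rule measurable_compose[OF _ measurable_add_dim]) measurable
  then show ?thesis by (simp add: resample_def case_prod_unfold)
qed

lemma resample_distr: "distr (X n \<Otimes>\<^sub>M M) M (resample n) = M"
  using distr_pair_PiM_eq_PiM[of UNIV X n] X.prob_space_axioms by (simp add: resample_def)

lemma resample_act:
  "g \<in> carrier G \<Longrightarrow> p \<in> space (X n \<Otimes>\<^sub>M M) \<Longrightarrow> resample n (pair_act (X n) M (a n) T g p) = T g (resample n p)"
  by (auto simp: resample_def space_pair_measure pair_act_eq T_eq space_M fun_eq_iff)

lemma bdd_meas_resample: "bdd_meas M f \<Longrightarrow> bdd_meas (X n \<Otimes>\<^sub>M M) (\<lambda>p. f (resample n p))"
  by (rule bdd_meas_comp[OF _ resample_measurable])

lemma sqn_resample: "bdd_meas M f \<Longrightarrow> sqn (X n \<Otimes>\<^sub>M M) (\<lambda>p. f (resample n p)) = sqn M f"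
  by (rule sqn_distr) (auto intro: resample_measurable resample_distr)

lemma bdd_meas_coord_mean: "bdd_meas M f \<Longrightarrow> bdd_meas M (coord_mean n f)"
  unfolding coord_mean_eq[abs_def] by (intro RP.bdd_meas_mean_fst bdd_meas_resample)

lemma sqn_coord_mean_le: assumes "bdd_meas M f" shows "sqn M (coord_mean n f) \<le> sqn M f"
proof -
  let ?f = "\<lambda>p. f (resample n p)"
  have b: "bdd_meas (X n \<Otimes>\<^sub>M M) ?f" by (rule bdd_meas_resample[OF assms])
  have "sqn M (coord_mean n f) = (\<integral>x. (mean_fst (X n) ?f x)\<^sup>2 \<partial>M)" by (simp add: sqn_def coord_mean_eq)
  also have "\<dots> \<le> (\<integral>x. mean_fst (X n) (\<lambda>p. (?f p)\<^sup>2) x \<partial>M)"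
  proof (rule integral_mono)
    show "(mean_fst (X n) ?f x)\<^sup>2 \<le> mean_fst (X n) (\<lambda>p. (?f p)\<^sup>2) x" if "x \<in> space M" for x
      using X.integral_sq_le_sqn[OF RP.bdd_meas_slice[OF b that]] by (simp add: mean_fst_def sqn_def)
  qed (intro PM.integrable_bdd_meas bdd_meas_power2 RP.bdd_meas_mean_fst b)+
  also have "\<dots> = sqn (X n \<Otimes>\<^sub>M M) ?f"
    unfolding sqn_def by (rule RP.integral_mean_fst[OF bdd_meas_power2[OF b]])
  also have "\<dots> = sqn M f" by (rule sqn_resample[OF assms])
  finally show ?thesis .
qed

lemma coord_mean_add:
  "bdd_meas M f \<Longrightarrow> bdd_meas M h \<Longrightarrow> x \<in> space M \<Longrightarrow> coord_mean n (\<lambda>x. f x + h x) x = coord_mean n f x + coord_mean n h x"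
  unfolding coord_mean_eq by (rule RP.mean_fst_add) (auto intro: bdd_meas_resample)

lemma coord_mean_act:
  assumes f: "bdd_meas M f" and g: "g \<in> carrier G" and x: "x \<in> space M"
  shows "coord_mean n (\<lambda>x. f (T g x)) x = coord_mean n f (T g x)"
proof -
  have "coord_mean n (\<lambda>x. f (T g x)) x = (\<integral>y. f ((T g x)(n := a n g y)) \<partial>X n)"
    unfolding coord_mean_def
    by (rule Bochner_Integration.integral_cong) (use x in \<open>auto simp: T_eq space_M fun_upd_def intro!: arg_cong[of _ _ f]\<close>)
  also have "\<dots> = coord_mean n f (T g x)" unfolding coord_mean_def
    using X.integral_act[OF g, of "\<lambda>y. f ((T g x)(n := y))"]
      RP.bdd_meas_slice[OF bdd_meas_resample[OF f, of n] MT.act_space[OF g x]]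
    by (auto simp: resample_def)
  finally show ?thesis .
qed

text \<open>The stable gap is applied to the pullback of \<open>f\<close> under
  \<open>resample n\<close>; the mean of the pullback over the new coordinate is
  \<open>coord_mean n f\<close>. The factor 2 comes from splitting off this mean.\<close>

proposition sqn_le_defect_coord_mean:
  assumes count: "countable (carrier G)"
    and gap: "spectral_gap G (X n \<Otimes>\<^sub>M X n) (diagonal_square_action (X n) (a n))"
  obtains K C where "finite K" "K \<subseteq> carrier G" "\<one> \<in> K" "\<And>g. g \<in> K \<Longrightarrow> inv g \<in> K" "0 \<le> C"
    "\<And>f. bdd_meas M f \<Longrightarrow> sqn M f \<le> C * (\<Sum>g\<in>K. sqn M (\<lambda>x. f (T g x) - f x)) + 2 * sqn M (coord_mean n f)"
proof -
  have gap': "spectral_gap G (X n \<Otimes>\<^sub>M X n) (pair_act (X n) (X n) (a n) (a n))"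
    using gap by (simp add: diagonal_square_action_def[abs_def] pair_act_def[abs_def])
  interpret XX: mp_action G "X n \<Otimes>\<^sub>M X n" "pair_act (X n) (X n) (a n) (a n)"
    by (rule mp_action_pair) (rule mp)+
  obtain K C where K: "finite K" "K \<subseteq> carrier G" "\<one> \<in> K" "\<And>g. g \<in> K \<Longrightarrow> inv g \<in> K" "1 \<le> C"
    "\<And>f. bdd_meas (X n \<Otimes>\<^sub>M X n) f \<Longrightarrow> (\<integral>x. f x \<partial>(X n \<Otimes>\<^sub>M X n)) = 0 \<Longrightarrow> sqn (X n \<Otimes>\<^sub>M X n) f
      \<le> C * (\<Sum>g\<in>K. sqn (X n \<Otimes>\<^sub>M X n) (\<lambda>x. f (pair_act (X n) (X n) (a n) (a n) g x) - f x))"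
    by (rule XX.spectral_gap_inequality[OF count gap']) (rule that; assumption)
  interpret GP: gap_pair G "X n" "a n" M T K C by unfold_locales (use K in auto)
  obtain C' where C': "C' \<ge> 0" "\<And>f. bdd_meas (X n \<Otimes>\<^sub>M M) f \<Longrightarrow>
     sqn (X n \<Otimes>\<^sub>M M) (\<lambda>p. f p - mean_fst (X n) f (snd p))
     \<le> C' * (\<Sum>g\<in>K. sqn (X n \<Otimes>\<^sub>M M) (\<lambda>p. f (pair_act (X n) M (a n) T g p) - f p))"
    using GP.stable_gap by blast
  have "sqn M f \<le> 2 * C' * (\<Sum>g\<in>K. sqn M (\<lambda>x. f (T g x) - f x)) + 2 * sqn M (coord_mean n f)"
    if f: "bdd_meas M f" for f
  proof -
    let ?f = "\<lambda>p. f (resample n p)" and ?P = "X n \<Otimes>\<^sub>M M"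
    have b: "bdd_meas ?P ?f" by (rule bdd_meas_resample[OF f])
    have m: "bdd_meas ?P (\<lambda>p. mean_fst (X n) ?f (snd p))"
      by (intro RP.bdd_meas_snd RP.bdd_meas_mean_fst b)
    have "sqn M f = sqn ?P (\<lambda>p. (?f p - mean_fst (X n) ?f (snd p)) + mean_fst (X n) ?f (snd p))"
      using sqn_resample[OF f, of n] by simp
    also have "\<dots> \<le> 2 * sqn ?P (\<lambda>p. ?f p - mean_fst (X n) ?f (snd p)) + 2 * sqn ?P (\<lambda>p. mean_fst (X n) ?f (snd p))"
      by (rule RP.sqn_add_le[OF bdd_meas_diff[OF b m] m])
    also have "sqn ?P (\<lambda>p. mean_fst (X n) ?f (snd p)) = sqn M (coord_mean n f)"
      using RP.integral_mean_fst[OF bdd_meas_power2[OF m]]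
      by (simp add: sqn_def coord_mean_eq mean_fst_def X.prob_space)
    also have "sqn ?P (\<lambda>p. ?f p - mean_fst (X n) ?f (snd p)) \<le> C' * (\<Sum>g\<in>K. sqn M (\<lambda>x. f (T g x) - f x))"
    proof -
      have "sqn ?P (\<lambda>p. ?f (pair_act (X n) M (a n) T g p) - ?f p) = sqn M (\<lambda>x. f (T g x) - f x)" if "g \<in> K" for g
      proof -
        have g: "g \<in> carrier G" using that K by auto
        have "sqn ?P (\<lambda>p. ?f (pair_act (X n) M (a n) T g p) - ?f p) = sqn ?P (\<lambda>p. f (T g (resample n p)) - ?f p)"
          by (rule sqn_cong) (simp add: resample_act g)
        also have "\<dots> = sqn M (\<lambda>x. f (T g x) - f x)"
          by (rule sqn_resample) (intro bdd_meas_diff f bdd_meas_comp[OF f T_measurable[OF g]])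
        finally show ?thesis .
      qed
      then show ?thesis using C'(2)[OF b] by simp
    qed
    finally show ?thesis by simp
  qed
  then show ?thesis using that[of K "2 * C'"] K C'(1) by simp
qed

end

section \<open>From asymptotically invariant sets to bounded functions, through level sets\<close>

section \<open>Strong ergodicity and asymptotically invariant functions\<close>

text \<open>The level \<open>t\<close> separates \<open>u r\<close> from \<open>v r\<close> exactly
  when it lies in an interval of length \<open>\<bar>u r - v r\<bar>\<close>; Borel-Cantelli on the
  line of levels.\<close>

lemma AE_eventually_same_level:
  fixes u v :: "nat \<Rightarrow> real"
  assumes "summable (\<lambda>r. \<bar>u r - v r\<bar>)"
  shows "AE t in lborel. \<forall>\<^sub>F r in sequentially. (u r > t) = (v r > t)"
proof -
  define A where "A r = {min (u r) (v r)..<max (u r) (v r)}" for r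
  have "AE t in lborel. \<forall>\<^sub>F r in sequentially. t \<in> space lborel - A r"
  proof (rule borel_cantelli_AE1)
    show "emeasure lborel (A r) < \<infinity>" for r by (simp add: A_def)
    have "measure lborel (A r) = \<bar>u r - v r\<bar>" for r by (simp add: A_def)
    then show "summable (\<lambda>r. measure lborel (A r))" using assms by simp
  qed (simp add: A_def)
  then show ?thesis
    by eventually_elim (auto simp: A_def elim!: eventually_mono)
qed

text \<open>Pulling the symmetric difference back along \<open>\<alpha>\<close> replaces the image
  of \<open>A\<close> by a preimage condition, which can be checked point by point.\<close>

lemma measure_image_symdiff:
  assumes \<alpha>: "borel_automorphism M \<alpha>" "measure_preserving_map M M \<alpha>" and A: "A \<in> sets M"
  shows "measure M ((\<alpha> ` A - A) \<union> (A - \<alpha> ` A)) = measure M {x \<in> space M. (x \<in> A) \<noteq> (\<alpha> x \<in> A)}"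
proof -
  have bij: "bij_betw \<alpha> (space M) (space M)" and m: "\<alpha> \<in> M \<rightarrow>\<^sub>M M" and inv: "inv_into (space M) \<alpha> \<in> M \<rightarrow>\<^sub>M M"
    and d: "distr M M \<alpha> = M"
    using assms by (auto simp: borel_automorphism_def measure_preserving_map_def)
  have sub: "A \<subseteq> space M" by (rule sets.sets_into_space[OF A])
  have inj: "inj_on \<alpha> (space M)" and surj: "\<alpha> ` space M = space M" using bij by (auto simp: bij_betw_def)
  have "\<alpha> ` A = inv_into (space M) \<alpha> -` A \<inter> space M"
    using inv_into_f_f[OF inj] f_inv_into_f[of _ \<alpha> "space M"] sub surj by (auto 0 3 intro: rev_image_eqI)
  then have im: "\<alpha> ` A \<in> sets M" using measurable_sets[OF inv A] by simp
  let ?D = "(\<alpha> ` A - A) \<union> (A - \<alpha> ` A)"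
  have "measure M ?D = measure (distr M M \<alpha>) ?D" by (simp add: d)
  also have "\<dots> = measure M (\<alpha> -` ?D \<inter> space M)"
    by (rule measure_distr[OF m]) (use im A in auto)
  also have "\<alpha> -` ?D \<inter> space M = {x \<in> space M. (x \<in> A) \<noteq> (\<alpha> x \<in> A)}"
    using inj_on_image_mem_iff[OF inj _ sub] measurable_space[OF m] by blast
  finally show ?thesis .
qed

text \<open>The variance is at most twice the mean of the positive part of \<open>f x - f y\<close>
  over independent \<open>x\<close> and \<open>y\<close>. Slicing that positive part by levels gives
  the probability that \<open>t\<close> lies between the two values.\<close>

lemma (in prob_space) level_variance_bound:
  assumes f [measurable]: "f \<in> borel_measurable M" and b: "\<And>x. x \<in> space M \<Longrightarrow> \<bar>f x\<bar> \<le> 1"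
  shows "ennreal (\<integral>x. (f x - (\<integral>x. f x \<partial>M))\<^sup>2 \<partial>M)
    \<le> 2 * (\<integral>\<^sup>+t. ennreal (prob {x\<in>space M. f x > t} * (1 - prob {x\<in>space M. f x > t})) \<partial>lborel)"
proof -
  interpret P: pair_prob_space M M ..
  interpret PL: pair_sigma_finite "M \<Otimes>\<^sub>M M" lborel ..
  have fb: "bdd_meas M f" by (rule bdd_measI[OF f b])
  let ?P = "M \<Otimes>\<^sub>M M"
  define D where "D p = f (fst p) - f (snd p)" for p
  have Db: "bdd_meas ?P D" unfolding D_def by (intro bdd_meas_diff P.bdd_meas_fst P.bdd_meas_snd fb)
  have D [measurable]: "D \<in> borel_measurable ?P" using Db by auto
  have m: "bdd_meas ?P (\<lambda>p. max 0 (D p))"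
  proof (rule bdd_measI[of _ _ 2])
    fix p assume "p \<in> space ?P"
    then have "\<bar>f (fst p)\<bar> \<le> 1" "\<bar>f (snd p)\<bar> \<le> 1" using b by (auto simp: space_pair_measure)
    then show "\<bar>max 0 (D p)\<bar> \<le> 2" by (auto simp: D_def)
  qed simp
  \<comment> \<open>\<open>D\<close> has mean zero, so the 1 may be added; it places the second
    factor between 0 and 2.\<close>
  have "(\<integral>x. (f x - (\<integral>x. f x \<partial>M))\<^sup>2 \<partial>M) = (\<integral>p. D p * (f (fst p) + 1) \<partial>?P)"
  proof -
    have "(\<integral>x. (f x - (\<integral>x. f x \<partial>M))\<^sup>2 \<partial>M) = (\<integral>x. (f x)\<^sup>2 \<partial>M) - (\<integral>x. f x \<partial>M)\<^sup>2"
      using sqn_diff_scaled[OF fb bdd_meas_const[of M 1], of "\<integral>x. f x \<partial>M"]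
      by (simp add: sqn_def prob_space power2_eq_square)
    moreover have "(\<integral>p. D p * (f (fst p) + 1) \<partial>?P)
      = (\<integral>p. (f (fst p) * (f (fst p) + 1)) * 1 \<partial>?P) - (\<integral>p. (f (fst p) + 1) * f (snd p) \<partial>?P)"
    proof (subst Bochner_Integration.integral_diff[symmetric])
      have 1: "bdd_meas ?P (\<lambda>p. f (fst p))" "bdd_meas ?P (\<lambda>p. f (snd p))"
        by (intro P.bdd_meas_fst P.bdd_meas_snd fb)+
      show "integrable ?P (\<lambda>p. f (fst p) * (f (fst p) + 1) * 1)" "integrable ?P (\<lambda>p. (f (fst p) + 1) * f (snd p))"
        by (intro P.integrable_bdd_meas bdd_meas_mult bdd_meas_add 1 bdd_meas_const)+
    qed (simp add: D_def algebra_simps)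
    moreover have "(\<integral>p. (f (fst p) * (f (fst p) + 1)) * 1 \<partial>?P) = (\<integral>x. (f x)\<^sup>2 \<partial>M) + (\<integral>x. f x \<partial>M)"
    proof -
      have "(\<integral>p. (f (fst p) * (f (fst p) + 1)) * 1 \<partial>?P) = (\<integral>x. f x * (f x + 1) \<partial>M)"
        using P.integral_tensor[OF bdd_meas_mult[OF fb bdd_meas_add[OF fb bdd_meas_const]], of "\<lambda>_. 1" 1] by (simp add: prob_space)
      also have "\<dots> = (\<integral>x. (f x)\<^sup>2 + f x \<partial>M)" by (simp add: power2_eq_square distrib_left)
      also have "\<dots> = (\<integral>x. (f x)\<^sup>2 \<partial>M) + (\<integral>x. f x \<partial>M)"
        by (intro Bochner_Integration.integral_add integrable_bdd_meas bdd_meas_power2 fb)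
      finally show ?thesis .
    qed
    moreover have "(\<integral>p. (f (fst p) + 1) * f (snd p) \<partial>?P) = ((\<integral>x. f x \<partial>M) + 1) * (\<integral>x. f x \<partial>M)"
      using P.integral_tensor[OF bdd_meas_add[OF fb bdd_meas_const] fb, of 1] integrable_bdd_meas[OF fb] by (simp add: prob_space)
    ultimately show ?thesis by (simp add: power2_eq_square algebra_simps)
  qed
  also have "\<dots> \<le> (\<integral>p. 2 * max 0 (D p) \<partial>?P)"
  proof (rule integral_mono)
    show "integrable ?P (\<lambda>p. D p * (f (fst p) + 1))"
      by (intro P.integrable_bdd_meas bdd_meas_mult Db bdd_meas_add bdd_meas_const P.bdd_meas_fst fb)
    show "integrable ?P (\<lambda>p. 2 * max 0 (D p))"
      by (intro P.integrable_bdd_meas bdd_meas_mult m bdd_meas_const)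
    fix p assume "p \<in> space ?P"
    then have "\<bar>f (fst p)\<bar> \<le> 1" using b by (auto simp: space_pair_measure)
    then have "0 \<le> f (fst p) + 1" "f (fst p) + 1 \<le> 2" by auto
    then have "D p * (f (fst p) + 1) \<le> max 0 (D p) * (f (fst p) + 1)" "max 0 (D p) * (f (fst p) + 1) \<le> max 0 (D p) * 2"
      by (intro mult_right_mono mult_left_mono; simp)+
    then show "D p * (f (fst p) + 1) \<le> 2 * max 0 (D p)" by linarith
  qed
  finally have le: "(\<integral>x. (f x - (\<integral>x. f x \<partial>M))\<^sup>2 \<partial>M) \<le> 2 * (\<integral>p. max 0 (D p) \<partial>?P)" by simp
  define h where "h p t = (indicator {f (snd p)..<f (fst p)} t :: ennreal)" for p t
  have "ennreal (\<integral>p. max 0 (D p) \<partial>?P) = (\<integral>\<^sup>+p. ennreal (max 0 (D p)) \<partial>?P)"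
    by (rule nn_integral_eq_integral[symmetric]) (auto intro: P.integrable_bdd_meas m)
  also have "\<dots> = (\<integral>\<^sup>+p. (\<integral>\<^sup>+t. h p t \<partial>lborel) \<partial>?P)"
    by (intro nn_integral_cong) (auto simp: h_def D_def max_def)
  also have "\<dots> = (\<integral>\<^sup>+t. (\<integral>\<^sup>+p. h p t \<partial>?P) \<partial>lborel)"
  proof (rule PL.Fubini'[symmetric])
    have "(\<lambda>q. h (fst q) (snd q)) = (\<lambda>q. indicator {q. f (snd (fst q)) \<le> snd q \<and> snd q < f (fst (fst q))} q)"
      by (auto simp: h_def indicator_def)
    also have "\<dots> \<in> borel_measurable (?P \<Otimes>\<^sub>M lborel)" by measurable
    finally show "case_prod h \<in> borel_measurable (?P \<Otimes>\<^sub>M lborel)" by (simp add: case_prod_unfold)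
  qed
  also have "\<dots> = (\<integral>\<^sup>+t. ennreal (prob {x\<in>space M. f x > t} * (1 - prob {x\<in>space M. f x > t})) \<partial>lborel)"
  proof (rule nn_integral_cong)
    fix t
    let ?A = "{x\<in>space M. f x > t}"
    have "(\<integral>\<^sup>+p. h p t \<partial>?P) = (\<integral>\<^sup>+p. indicator (?A \<times> (space M - ?A)) p \<partial>?P)"
      by (rule nn_integral_cong) (auto simp: h_def indicator_def space_pair_measure)
    also have "\<dots> = emeasure ?P (?A \<times> (space M - ?A))" by (rule nn_integral_indicator) measurable
    also have "\<dots> = emeasure M ?A * emeasure M (space M - ?A)"
      by (rule emeasure_pair_measure_Times) auto
    also have "\<dots> = ennreal (prob ?A * (1 - prob ?A))"
      by (simp add: emeasure_eq_measure prob_compl ennreal_mult)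
    finally show "(\<integral>\<^sup>+p. h p t \<partial>?P) = ennreal (prob ?A * (1 - prob ?A))" .
  qed
  finally have "ennreal (\<integral>p. max 0 (D p) \<partial>?P)
    = (\<integral>\<^sup>+t. ennreal (prob {x\<in>space M. f x > t} * (1 - prob {x\<in>space M. f x > t})) \<partial>lborel)" .
  moreover have "ennreal (2 * (\<integral>p. max 0 (D p) \<partial>?P)) = 2 * ennreal (\<integral>p. max 0 (D p) \<partial>?P)"
    by (subst ennreal_mult) auto
  ultimately show ?thesis using ennreal_leI[OF le] by simp
qed

text \<open>For almost every level the level sets are asymptotically invariant, so their variances
  tend to 0 by strong ergodicity, and the variance of \<open>f r\<close> is bounded by their
  integral over levels. The countable family \<open>h\<close> serves all of the uncountable full
  group.\<close>

lemma (in prob_space) strongly_ergodic_asymptotically_invariant: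
  fixes f :: "nat \<Rightarrow> 'a \<Rightarrow> real" and h :: "nat \<Rightarrow> 'a \<Rightarrow> 'a"
  assumes se: "strongly_ergodic M R"
    and h [measurable]: "\<And>i. h i \<in> M \<rightarrow>\<^sub>M M"
    and cover: "\<And>x y. x \<in> space M \<Longrightarrow> (y, x) \<in> R \<Longrightarrow> \<exists>i. y = h i x"
    and f [measurable]: "\<And>r. f r \<in> borel_measurable M"
    and b: "\<And>r x. x \<in> space M \<Longrightarrow> \<bar>f r x\<bar> \<le> 1"
    and summ: "AE x in M. \<forall>i. summable (\<lambda>r. \<bar>f r (h i x) - f r x\<bar>)"
  shows "(\<lambda>r. \<integral>x. (f r x - (\<integral>x. f r x \<partial>M))\<^sup>2 \<partial>M) \<longlonglongrightarrow> 0"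
proof -
  interpret QL: pair_sigma_finite M lborel ..
  define A where "A r t = {x \<in> space M. f r x > t}" for r t
  have A [measurable]: "A r t \<in> sets M" for r t unfolding A_def by measurable
  define \<phi> where "\<phi> r t = prob (A r t) * (1 - prob (A r t))" for r t
  have \<phi>01: "0 \<le> \<phi> r t" "\<phi> r t \<le> 1" for r t
  proof -
    show "0 \<le> \<phi> r t" by (simp add: \<phi>_def)
    have "prob (A r t) * (1 - prob (A r t)) \<le> 1 * 1" by (intro mult_mono) auto
    then show "\<phi> r t \<le> 1" by (simp add: \<phi>_def)
  qed
  have \<phi>0: "\<phi> r t = 0" if "t \<notin> {-1..1}" for r t
  proof (cases "t > 1")
    case True
    then have "A r t = {}" using b[of _ r] abs_le_D1[of "f r _" 1] unfolding A_def by fastforce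
    then show ?thesis by (simp add: \<phi>_def)
  next
    case False
    then have "t < -1" using that by auto
    then have "A r t = space M" using b[of _ r] abs_le_D2[of "f r _" 1] unfolding A_def by fastforce
    then show ?thesis by (simp add: \<phi>_def prob_space)
  qed
  have "AE x in M. AE t in lborel. \<forall>i. \<forall>\<^sub>F r in sequentially. (f r (h i x) > t) = (f r x > t)"
    using summ
  proof eventually_elim
    case (elim x)
    then show ?case by (subst AE_all_countable) (auto intro: AE_eventually_same_level)
  qed
  moreover have "{p\<in>space (M \<Otimes>\<^sub>M lborel). \<forall>i. \<forall>\<^sub>F r in sequentially. (f r (h i (fst p)) > snd p) = (f r (fst p) > snd p)}
      \<in> sets (M \<Otimes>\<^sub>M lborel)"
    unfolding eventually_sequentially by measurable
  \<comment> \<open>Exchanging the null sets turns levels that depend on the point into levels good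
    for almost all points.\<close>
  ultimately have "AE t in lborel. AE x in M. \<forall>i. \<forall>\<^sub>F r in sequentially. (f r (h i x) > t) = (f r x > t)"
    by (subst QL.AE_commute[symmetric]) auto
  then have lim: "AE t in lborel. (\<lambda>r. \<phi> r t) \<longlonglongrightarrow> 0"
  proof eventually_elim
    case (elim t)
    have "(\<lambda>r. prob ((\<alpha> ` A r t - A r t) \<union> (A r t - \<alpha> ` A r t))) \<longlonglongrightarrow> 0" if \<alpha>: "\<alpha> \<in> full_group M R" for \<alpha>
    proof -
      have \<alpha>1: "borel_automorphism M \<alpha>" "measure_preserving_map M M \<alpha>" "AE x in M. (\<alpha> x, x) \<in> R"
        using \<alpha> by (auto simp: full_group_def)
      have [measurable]: "\<alpha> \<in> M \<rightarrow>\<^sub>M M" using \<alpha>1(2) by (simp add: measure_preserving_map_def)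
      let ?B = "\<lambda>r. {x \<in> space M. (x \<in> A r t) \<noteq> (\<alpha> x \<in> A r t)}"
      \<comment> \<open>At almost every point \<open>\<alpha>\<close> agrees with one of the
        \<open>h i\<close>, the index depending on the point; pointwise convergence is all that is
        required here.\<close>
      have ev: "AE x in M. \<forall>\<^sub>F r in sequentially. x \<notin> ?B r"
        using \<alpha>1(3) elim AE_space
      proof eventually_elim
        case (elim x)
        then obtain i where i: "\<alpha> x = h i x" using cover by blast
        have sp: "\<alpha> x \<in> space M" using elim measurable_space[of \<alpha> M M x] by simp
        have "\<forall>\<^sub>F r in sequentially. (f r (h i x) > t) = (f r x > t)" using elim by simp
        then show ?case by eventually_elim (use i sp in \<open>auto simp: A_def\<close>)
      qed
      have "(\<lambda>r. \<integral>x. indicator (?B r) x \<partial>M :: real) \<longlonglongrightarrow> (\<integral>x. 0 \<partial>M)"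
      proof (rule integral_dominated_convergence[where w = "\<lambda>_. 1"])
        show "AE x in M. (\<lambda>r. indicator (?B r) x :: real) \<longlonglongrightarrow> 0"
          using ev
        proof eventually_elim
          case (elim x)
          then have "\<forall>\<^sub>F r in sequentially. (indicator (?B r) x :: real) = 0"
            by eventually_elim (simp add: indicator_def)
          then show ?case by (rule tendsto_eventually)
        qed
      qed (auto simp: indicator_def)
      then have "(\<lambda>r. prob (?B r)) \<longlonglongrightarrow> 0" by simp
      then show ?thesis by (simp add: measure_image_symdiff[OF \<alpha>1(1,2) A])
    qed
    then show ?case using se unfolding strongly_ergodic_def \<phi>_def by (auto intro: A)
  qed
  have \<phi>m [measurable]: "\<phi> r \<in> borel_measurable lborel" for r
  proof -
    have "(\<lambda>t. measure M {x \<in> space M. f r x > t}) \<in> borel_measurable lborel"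
    proof -
      have "(\<lambda>t. \<integral>x. (if f r x > t then 1 else 0 :: real) \<partial>M) \<in> borel_measurable (lborel :: real measure)"
        by measurable
      also have "(\<lambda>t. \<integral>x. (if f r x > t then 1 else 0 :: real) \<partial>M) = (\<lambda>t. measure M {x \<in> space M. f r x > t})"
      proof
        fix t
        have "(\<integral>x. (if f r x > t then 1 else 0 :: real) \<partial>M) = (\<integral>x. indicator {x \<in> space M. f r x > t} x \<partial>M)"
          by (rule Bochner_Integration.integral_cong) (auto simp: indicator_def)
        then show "(\<integral>x. (if f r x > t then 1 else 0 :: real) \<partial>M) = measure M {x \<in> space M. f r x > t}"
          by simp
      qed
      finally show ?thesis .
    qed
    then show ?thesis unfolding \<phi>_def A_def by measurable
  qed
  have \<phi>int: "integrable lborel (\<phi> r)" for r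
    by (rule Bochner_Integration.integrable_bound[of _ "indicator {-1..1::real} :: real \<Rightarrow> real"])
      (use \<phi>0 \<phi>01 in \<open>auto simp: indicator_def integrable_indicator_iff\<close>)
  have int0: "(\<lambda>r. \<integral>t. \<phi> r t \<partial>lborel) \<longlonglongrightarrow> (\<integral>t. 0 \<partial>(lborel :: real measure))"
  proof (rule integral_dominated_convergence[where s = \<phi> and w = "indicator {-1..1::real} :: real \<Rightarrow> real"])
    show "integrable lborel (indicator {-1..1::real} :: real \<Rightarrow> real)" by (simp add: integrable_indicator_iff)
    show "AE t in lborel. norm (\<phi> r t) \<le> indicator {-1..1} t" for r
      using \<phi>0 \<phi>01 by (auto simp: indicator_def)
  qed (use lim in auto)
  show ?thesis
  proof (rule Lim_null_comparison)
    show "(\<lambda>r. 2 * (\<integral>t. \<phi> r t \<partial>lborel)) \<longlonglongrightarrow> 0" using tendsto_mult[OF tendsto_const int0, of 2] by simp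
    show "\<forall>\<^sub>F r in sequentially. norm (\<integral>x. (f r x - (\<integral>x. f r x \<partial>M))\<^sup>2 \<partial>M) \<le> 2 * (\<integral>t. \<phi> r t \<partial>lborel)"
    proof (rule always_eventually, rule allI)
      fix r
      have "ennreal (\<integral>x. (f r x - (\<integral>x. f r x \<partial>M))\<^sup>2 \<partial>M) \<le> 2 * (\<integral>\<^sup>+t. ennreal (\<phi> r t) \<partial>lborel)"
        using level_variance_bound[OF f b] by (simp add: \<phi>_def A_def)
      also have "\<dots> = ennreal (2 * (\<integral>t. \<phi> r t \<partial>lborel))"
        using nn_integral_eq_integral[OF \<phi>int, of r] \<phi>01 by (simp add: ennreal_mult)
      finally show "norm (\<integral>x. (f r x - (\<integral>x. f r x \<partial>M))\<^sup>2 \<partial>M) \<le> 2 * (\<integral>t. \<phi> r t \<partial>lborel)"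
        by (subst (asm) ennreal_le_iff) (auto intro!: integral_nonneg_AE \<phi>01)
    qed
  qed
qed

section \<open>Disintegration over ergodic components\<close>

section \<open>Conditional expectation along an ergodic decomposition\<close>

lemma (in prob_space) AE_summable_of_integral:
  fixes u :: "nat \<Rightarrow> 'a \<Rightarrow> real"
  assumes u: "\<And>r. integrable M (u r)" and s: "summable (\<lambda>r. \<integral>x. \<bar>u r x\<bar> \<partial>M)"
  shows "AE x in M. summable (\<lambda>r. \<bar>u r x\<bar>)"
proof -
  have [measurable]: "u r \<in> borel_measurable M" for r using u by auto
  have "(\<integral>\<^sup>+x. (\<Sum>r. ennreal \<bar>u r x\<bar>) \<partial>M) = (\<Sum>r. \<integral>\<^sup>+x. ennreal \<bar>u r x\<bar> \<partial>M)"
    by (rule nn_integral_suminf) measurable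
  also have "\<dots> = (\<Sum>r. ennreal (\<integral>x. \<bar>u r x\<bar> \<partial>M))"
    by (intro suminf_cong nn_integral_eq_integral) (auto intro: integrable_abs u)
  also have "\<dots> < \<infinity>" using s by (simp add: suminf_ennreal2 integral_nonneg_AE)
  finally have "AE x in M. (\<Sum>r. ennreal \<bar>u r x\<bar>) \<noteq> \<infinity>"
    by (intro nn_integral_noteq_infinite) auto
  then show ?thesis by eventually_elim (rule summable_suminf_not_top, auto)
qed

locale decomposed = prob_space M for M :: "'a measure" +
  fixes R :: "('a \<times> 'a) set" and \<kappa> :: "'a \<Rightarrow> 'a measure"
  assumes decomp: "ergodic_decomposition M R \<kappa>"
begin

lemma \<kappa>_measurable: "\<kappa> \<in> M \<rightarrow>\<^sub>M prob_algebra M"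
  and \<kappa>_invariant: "(x, y) \<in> R \<Longrightarrow> \<kappa> x = \<kappa> y"
  and emeasure_\<kappa>: "A \<in> sets M \<Longrightarrow> emeasure M A = (\<integral>\<^sup>+x. emeasure (\<kappa> x) A \<partial>M)"
  and AE_\<kappa>_self: "AE x in M. AE y in \<kappa> x. \<kappa> y = \<kappa> x"
  using decomp by (auto simp: ergodic_decomposition_def)

lemma \<kappa>_subprob: "\<kappa> \<in> M \<rightarrow>\<^sub>M subprob_algebra M"
  by (rule measurable_prob_algebraD[OF \<kappa>_measurable])

lemma sets_\<kappa>: "x \<in> space M \<Longrightarrow> sets (\<kappa> x) = sets M"
  and prob_space_\<kappa>: "x \<in> space M \<Longrightarrow> prob_space (\<kappa> x)"
  using measurable_space[OF \<kappa>_measurable] by (auto simp: space_prob_algebra)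

lemma space_\<kappa>: "x \<in> space M \<Longrightarrow> space (\<kappa> x) = space M"
  by (rule sets_eq_imp_space_eq[OF sets_\<kappa>])

lemma bind_\<kappa>: "M \<bind> \<kappa> = M"
proof (rule measure_eqI)
  show "sets (M \<bind> \<kappa>) = sets M" by (rule sets_bind[OF sets_\<kappa> not_empty])
  then show "emeasure (M \<bind> \<kappa>) A = emeasure M A" if "A \<in> sets (M \<bind> \<kappa>)" for A
    using that emeasure_bind[OF not_empty \<kappa>_subprob] emeasure_\<kappa> by simp
qed

lemma nn_integral_\<kappa>: "f \<in> borel_measurable M \<Longrightarrow> (\<integral>\<^sup>+x. f x \<partial>M) = (\<integral>\<^sup>+x. \<integral>\<^sup>+y. f y \<partial>\<kappa> x \<partial>M)"
  using nn_integral_bind[OF _ \<kappa>_subprob, of f] bind_\<kappa> by simp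

lemma AE_\<kappa>: assumes "AE x in M. P x" shows "AE x in M. AE y in \<kappa> x. P y"
proof -
  obtain N where N: "{x \<in> space M. \<not> P x} \<subseteq> N" "emeasure M N = 0" "N \<in> sets M"
    using assms by (rule AE_E)
  have [measurable]: "(\<lambda>x. emeasure (\<kappa> x) N) \<in> borel_measurable M"
    using measurable_compose[OF \<kappa>_subprob measurable_emeasure_subprob_algebra[OF N(3)]] .
  have "(\<integral>\<^sup>+x. emeasure (\<kappa> x) N \<partial>M) = 0" using emeasure_\<kappa>[OF N(3)] N(2) by simp
  then have "AE x in M. emeasure (\<kappa> x) N = 0" by (subst (asm) nn_integral_0_iff_AE) auto
  then show ?thesis using AE_space
  proof eventually_elim
    case (elim x)
    show ?case by (rule AE_I[of _ _ N]) (use elim N in \<open>auto simp: space_\<kappa> sets_\<kappa>\<close>)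
  qed
qed

text \<open>A pointwise version of the conditional expectation onto invariant functions. As
  \<open>\<kappa>\<close> is constant on classes, it is invariant on every pair of \<open>R\<close>,
  not only almost everywhere.\<close>

definition cond_mean :: "('a \<Rightarrow> real) \<Rightarrow> 'a \<Rightarrow> real" where
  "cond_mean f x = (\<integral>y. f y \<partial>\<kappa> x)"

lemma cond_mean_invariant: "(x, y) \<in> R \<Longrightarrow> cond_mean f x = cond_mean f y"
  by (simp add: cond_mean_def \<kappa>_invariant)

lemma cond_mean_measurable: "f \<in> borel_measurable M \<Longrightarrow> cond_mean f \<in> borel_measurable M"
  unfolding cond_mean_def by (rule measurable_compose[OF \<kappa>_subprob integral_measurable_subprob_algebra])

lemma abs_cond_mean_le:
  assumes f: "f \<in> borel_measurable M" and b: "\<And>x. x \<in> space M \<Longrightarrow> \<bar>f x\<bar> \<le> B" and x: "x \<in> space M"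
  shows "\<bar>cond_mean f x\<bar> \<le> B"
proof -
  interpret K: prob_space "\<kappa> x" by (rule prob_space_\<kappa>[OF x])
  have fm: "bdd_meas (\<kappa> x) f"
    by (rule bdd_measI[of _ _ B]) (use f b x in \<open>auto simp: space_\<kappa> cong: measurable_cong_sets[OF sets_\<kappa>[OF x] refl]\<close>)
  have "\<bar>cond_mean f x\<bar> \<le> (\<integral>y. \<bar>f y\<bar> \<partial>\<kappa> x)" unfolding cond_mean_def by (rule integral_abs_bound)
  also have "\<dots> \<le> (\<integral>y. B \<partial>\<kappa> x)"
    by (intro integral_mono K.integrable_bdd_meas bdd_meas_abs fm bdd_meas_const) (use b x in \<open>auto simp: space_\<kappa>\<close>)
  finally show ?thesis by (simp add: K.prob_space)
qed

text \<open>The squared distance is the integral of the variances on the components, each of which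
  tends to 0 by strong ergodicity. Summability, unlike convergence in measure, passes to almost
  every component.\<close>

lemma sqn_cond_mean_tendsto:
  fixes f :: "nat \<Rightarrow> 'a \<Rightarrow> real" and h :: "nat \<Rightarrow> 'a \<Rightarrow> 'a"
  assumes se: "AE x in M. strongly_ergodic (\<kappa> x) R"
    and h: "\<And>i. h i \<in> M \<rightarrow>\<^sub>M M"
    and cover: "\<And>x y. x \<in> space M \<Longrightarrow> (y, x) \<in> R \<Longrightarrow> \<exists>i. y = h i x"
    and f [measurable]: "\<And>r. f r \<in> borel_measurable M"
    and b: "\<And>r x. x \<in> space M \<Longrightarrow> \<bar>f r x\<bar> \<le> 1"
    and summ: "AE x in M. \<forall>i. summable (\<lambda>r. \<bar>f r (h i x) - f r x\<bar>)"
  shows "(\<lambda>r. sqn M (\<lambda>x. f r x - cond_mean (f r) x)) \<longlonglongrightarrow> 0"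
proof -
  have cm [measurable]: "cond_mean (f r) \<in> borel_measurable M" for r by (rule cond_mean_measurable[OF f])
  define d where "d r y = (f r y - cond_mean (f r) y)\<^sup>2" for r y
  have dm [measurable]: "d r \<in> borel_measurable M" for r unfolding d_def by measurable
  have d_bd: "\<bar>d r y\<bar> \<le> 4" if "y \<in> space M" for r y
  proof -
    have "\<bar>f r y - cond_mean (f r) y\<bar> \<le> 2"
      using b[OF that, of r] abs_cond_mean_le[OF f b that, of r] by linarith
    then have "(f r y - cond_mean (f r) y)\<^sup>2 \<le> 2\<^sup>2" by (metis abs_numeral abs_le_square_iff)
    then show ?thesis by (simp add: d_def)
  qed
  have db: "bdd_meas M (d r)" for r by (rule bdd_measI[OF dm d_bd])
  define v where "v r x = (\<integral>y. d r y \<partial>\<kappa> x)" for r x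
  have vm [measurable]: "v r \<in> borel_measurable M" for r
    unfolding v_def by (rule measurable_compose[OF \<kappa>_subprob integral_measurable_subprob_algebra[OF dm]])
  have v_bd: "\<bar>v r x\<bar> \<le> 4" if "x \<in> space M" for r x
    using abs_cond_mean_le[OF dm d_bd that] unfolding v_def cond_mean_def by blast
  have vb: "bdd_meas M (v r)" for r by (rule bdd_measI[OF vm v_bd])
  have "sqn M (\<lambda>x. f r x - cond_mean (f r) x) = (\<integral>x. v r x \<partial>M)" for r
  proof -
    have nn: "0 \<le> d r y" "0 \<le> v r x" for x y by (auto simp: d_def v_def)
    have "ennreal (\<integral>x. d r x \<partial>M) = (\<integral>\<^sup>+x. ennreal (d r x) \<partial>M)"
      by (rule nn_integral_eq_integral[symmetric]) (auto simp: nn integrable_bdd_meas db)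
    also have "\<dots> = (\<integral>\<^sup>+x. \<integral>\<^sup>+y. ennreal (d r y) \<partial>\<kappa> x \<partial>M)" by (rule nn_integral_\<kappa>) measurable
    also have "\<dots> = (\<integral>\<^sup>+x. ennreal (v r x) \<partial>M)"
    proof (rule nn_integral_cong)
      fix x assume x: "x \<in> space M"
      interpret K: prob_space "\<kappa> x" by (rule prob_space_\<kappa>[OF x])
      have "bdd_meas (\<kappa> x) (d r)"
        by (rule bdd_measI[of _ _ 4]) (use dm d_bd x in \<open>auto simp: space_\<kappa> cong: measurable_cong_sets[OF sets_\<kappa>[OF x] refl]\<close>)
      then show "(\<integral>\<^sup>+y. ennreal (d r y) \<partial>\<kappa> x) = ennreal (v r x)"
        unfolding v_def by (intro nn_integral_eq_integral K.integrable_bdd_meas) (auto simp: nn)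
    qed
    also have "\<dots> = ennreal (\<integral>x. v r x \<partial>M)"
      by (rule nn_integral_eq_integral) (auto simp: nn integrable_bdd_meas vb)
    finally show ?thesis
      by (subst (asm) ennreal_inj) (auto simp: sqn_def d_def[symmetric] nn intro!: integral_nonneg_AE)
  qed
  moreover have "(\<lambda>r. \<integral>x. v r x \<partial>M) \<longlonglongrightarrow> (\<integral>x. 0 \<partial>M)"
  proof (rule integral_dominated_convergence[where s = v and w = "\<lambda>_. 4"])
    show "AE x in M. (\<lambda>r. v r x) \<longlonglongrightarrow> 0"
      using se AE_\<kappa>[OF summ] AE_\<kappa>_self AE_space
    proof eventually_elim
      case (elim x)
      interpret K: prob_space "\<kappa> x" by (rule prob_space_\<kappa>[OF elim(4)])
      note [simp] = space_\<kappa>[OF elim(4)] and [cong] = measurable_cong_sets[OF sets_\<kappa>[OF elim(4)] refl]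
      have hm: "h i \<in> \<kappa> x \<rightarrow>\<^sub>M \<kappa> x" for i
        using h[of i] by (simp cong: measurable_cong_sets[OF sets_\<kappa>[OF elim(4)] sets_\<kappa>[OF elim(4)]])
      have fm: "f r \<in> borel_measurable (\<kappa> x)" for r using f[of r] by simp
      have "(\<lambda>r. \<integral>y. (f r y - (\<integral>y. f r y \<partial>\<kappa> x))\<^sup>2 \<partial>\<kappa> x) \<longlonglongrightarrow> 0"
        by (rule K.strongly_ergodic_asymptotically_invariant[OF elim(1) hm _ fm _ elim(2)]) (auto intro: cover b)
      \<comment> \<open>Almost every \<open>y\<close> for \<open>\<kappa> x\<close> has
        \<open>\<kappa> y = \<kappa> x\<close>, so \<open>cond_mean\<close> is constant on the
        component.\<close>
      moreover have "v r x = (\<integral>y. (f r y - (\<integral>y. f r y \<partial>\<kappa> x))\<^sup>2 \<partial>\<kappa> x)" for r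
        unfolding v_def
      proof (rule integral_cong_AE)
        show "AE y in \<kappa> x. d r y = (f r y - (\<integral>y. f r y \<partial>\<kappa> x))\<^sup>2"
          using elim(3) by eventually_elim (simp add: d_def cond_mean_def)
        show "d r \<in> borel_measurable (\<kappa> x)" using dm[of r] by simp
        show "(\<lambda>y. (f r y - (\<integral>y. f r y \<partial>\<kappa> x))\<^sup>2) \<in> borel_measurable (\<kappa> x)" using fm[of r] by measurable
      qed
      ultimately show ?case by simp
    qed
  qed (use v_bd in auto)
  ultimately show ?thesis by simp
qed

lemma sqn_cond_mean_small:
  fixes f :: "nat \<Rightarrow> 'a \<Rightarrow> real" and h :: "nat \<Rightarrow> 'a \<Rightarrow> 'a"
  assumes se: "AE x in M. strongly_ergodic (\<kappa> x) R"
    and h: "\<And>i. h i \<in> M \<rightarrow>\<^sub>M M"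
    and cover: "\<And>x y. x \<in> space M \<Longrightarrow> (y, x) \<in> R \<Longrightarrow> \<exists>i. y = h i x"
    and f: "\<And>n. f n \<in> borel_measurable M"
    and b: "\<And>n x. x \<in> space M \<Longrightarrow> \<bar>f n x\<bar> \<le> 1"
    and asymp: "\<And>i. (\<lambda>n. sqn M (\<lambda>x. f n (h i x) - f n x)) \<longlonglongrightarrow> 0"
    and e: "0 < e"
  shows "\<exists>n. sqn M (\<lambda>x. f n x - cond_mean (f n) x) < e"
proof -
  have diff: "bdd_meas M (\<lambda>x. f n (h i x) - f n x)" for n i
    by (intro bdd_meas_diff bdd_meas_comp[OF _ h] bdd_measI[OF f b])
  \<comment> \<open>Selects indices so sparse that L2 convergence becomes almost sure summability;
    any fixed \<open>i\<close> is covered from \<open>r = i\<close> on.\<close>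
  have "\<exists>n. \<forall>i\<le>r. (\<integral>x. \<bar>f n (h i x) - f n x\<bar> \<partial>M) < (1/2)^r" for r :: nat
  proof -
    have "\<forall>\<^sub>F n in sequentially. \<forall>i\<in>{..r}. (\<integral>x. \<bar>f n (h i x) - f n x\<bar> \<partial>M) < (1/2)^r"
    proof (intro eventually_ball_finite ballI)
      fix i
      have "(\<lambda>n. sqrt (sqn M (\<lambda>x. f n (h i x) - f n x))) \<longlonglongrightarrow> sqrt 0" by (intro tendsto_real_sqrt asymp)
      then have "\<forall>\<^sub>F n in sequentially. sqrt (sqn M (\<lambda>x. f n (h i x) - f n x)) < (1/2)^r"
        by (rule order_tendstoD) simp
      then show "\<forall>\<^sub>F n in sequentially. (\<integral>x. \<bar>f n (h i x) - f n x\<bar> \<partial>M) < (1/2)^r"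
        by eventually_elim (use integral_abs_le_sqrt_sqn[OF diff] in \<open>rule le_less_trans\<close>)
    qed simp
    then show ?thesis by (auto simp: eventually_sequentially)
  qed
  then obtain s where s: "\<And>r i. i \<le> r \<Longrightarrow> (\<integral>x. \<bar>f (s r) (h i x) - f (s r) x\<bar> \<partial>M) < (1/2)^r" by metis
  have "AE x in M. summable (\<lambda>r. \<bar>f (s r) (h i x) - f (s r) x\<bar>)" for i
  proof (rule AE_summable_of_integral)
    show "summable (\<lambda>r. \<integral>x. \<bar>f (s r) (h i x) - f (s r) x\<bar> \<partial>M)"
    proof (rule summable_comparison_test_ev)
      show "\<forall>\<^sub>F r in sequentially. norm (\<integral>x. \<bar>f (s r) (h i x) - f (s r) x\<bar> \<partial>M) \<le> (1/2)^r"
        unfolding eventually_sequentially using s[of i] by (intro exI[of _ i]) (auto intro: less_imp_le)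
    qed (rule summable_geometric, simp)
  qed (intro integrable_bdd_meas diff)
  then have "AE x in M. \<forall>i. summable (\<lambda>r. \<bar>f (s r) (h i x) - f (s r) x\<bar>)" by (simp add: AE_all_countable)
  from sqn_cond_mean_tendsto[OF se h cover f b this]
  have "\<forall>\<^sub>F r in sequentially. sqn M (\<lambda>x. f (s r) x - cond_mean (f (s r)) x) < e"
    by (rule order_tendstoD) (use e in auto)
  then show ?thesis by (auto simp: eventually_sequentially)
qed

end

section \<open>Weak convergence to zero, seen by the mean over one coordinate\<close>

section \<open>Vanishing of coordinate means\<close>

context diagonal_pmp
begin

definition coord_null :: "nat \<Rightarrow> (nat \<Rightarrow> (nat \<Rightarrow> 'a) \<Rightarrow> real) \<Rightarrow> bool" where
  "coord_null n u \<longleftrightarrow> (\<forall>k. bdd_meas M (u k)) \<and> (\<lambda>k. sqn M (coord_mean n (u k))) \<longlonglongrightarrow> 0"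

lemma coord_mean_cong:
  assumes "\<And>x. x \<in> space M \<Longrightarrow> f x = h x" "x \<in> space M" shows "coord_mean n f x = coord_mean n h x"
  unfolding coord_mean_def
  by (rule Bochner_Integration.integral_cong) (use assms in \<open>auto simp: space_M\<close>)

lemma coord_null_cong:
  assumes "\<And>k x. x \<in> space M \<Longrightarrow> u k x = v k x" "coord_null n u" shows "coord_null n v"
proof -
  have "sqn M (coord_mean n (u k)) = sqn M (coord_mean n (v k))" for k
    by (intro sqn_cong coord_mean_cong assms)
  moreover have "bdd_meas M (u k) \<longleftrightarrow> bdd_meas M (v k)" for k by (rule bdd_meas_cong) (rule assms)
  ultimately show ?thesis using assms(2) by (simp add: coord_null_def)
qed

lemma coord_null_add:
  assumes u: "coord_null n u" and v: "coord_null n v" shows "coord_null n (\<lambda>k x. u k x + v k x)"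
proof -
  have b: "bdd_meas M (u k)" "bdd_meas M (v k)" for k using u v by (auto simp: coord_null_def)
  have le: "sqn M (coord_mean n (\<lambda>x. u k x + v k x)) \<le> 2 * sqn M (coord_mean n (u k)) + 2 * sqn M (coord_mean n (v k))" for k
  proof -
    have "sqn M (coord_mean n (\<lambda>x. u k x + v k x)) = sqn M (\<lambda>x. coord_mean n (u k) x + coord_mean n (v k) x)"
      by (rule sqn_cong) (simp add: coord_mean_add b)
    also have "\<dots> \<le> 2 * sqn M (coord_mean n (u k)) + 2 * sqn M (coord_mean n (v k))"
      by (intro PM.sqn_add_le bdd_meas_coord_mean b)
    finally show ?thesis .
  qed
  have "(\<lambda>k. 2 * sqn M (coord_mean n (u k)) + 2 * sqn M (coord_mean n (v k))) \<longlonglongrightarrow> 2 * 0 + 2 * 0"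
    using u v unfolding coord_null_def by (intro tendsto_add tendsto_mult tendsto_const) auto
  then have lim: "(\<lambda>k. 2 * sqn M (coord_mean n (u k)) + 2 * sqn M (coord_mean n (v k))) \<longlonglongrightarrow> 0"
    by simp
  have "(\<lambda>k. sqn M (coord_mean n (\<lambda>x. u k x + v k x))) \<longlonglongrightarrow> 0"
    by (rule Lim_null_comparison[OF always_eventually lim]) (simp add: le)
  then show ?thesis using b by (auto simp: coord_null_def)
qed

lemma coord_null_zero: "coord_null n (\<lambda>k x. 0)"
  by (simp add: coord_null_def coord_mean_def sqn_def)

lemma coord_null_sum:
  assumes "finite I" "\<And>i. i \<in> I \<Longrightarrow> coord_null n (\<lambda>k x. u i k x)"
  shows "coord_null n (\<lambda>k x. \<Sum>i\<in>I. u i k x)"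
  using assms
proof (induction I rule: finite_induct)
  case empty
  show ?case by (simp only: sum.empty coord_null_zero)
next
  case (insert i I)
  have "coord_null n (\<lambda>k x. u i k x + (\<Sum>i\<in>I. u i k x))"
    by (rule coord_null_add[OF insert.prems insert.IH]) (use insert.prems in blast)+
  then show ?case by (simp only: sum.insert[OF insert.hyps])
qed

lemma coord_null_act:
  assumes u: "coord_null n u" and g: "g \<in> carrier G" shows "coord_null n (\<lambda>k x. u k (T g x))"
proof -
  have b: "bdd_meas M (u k)" for k using u by (auto simp: coord_null_def)
  have "sqn M (coord_mean n (\<lambda>x. u k (T g x))) = sqn M (coord_mean n (u k))" for k
  proof -
    have "sqn M (coord_mean n (\<lambda>x. u k (T g x))) = sqn M (\<lambda>x. coord_mean n (u k) (T g x))"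
      by (rule sqn_cong) (simp add: coord_mean_act b g)
    also have "\<dots> = sqn M (coord_mean n (u k))"
      by (rule MT.sqn_act[OF g]) (use bdd_meas_coord_mean[OF b] in auto)
    finally show ?thesis .
  qed
  then show ?thesis using u bdd_meas_comp[OF b T_measurable[OF g]] by (simp add: coord_null_def)
qed

text \<open>With the other coordinates fixed, \<open>\<phi>\<close> is a bounded test function in
  coordinate \<open>n\<close>, so the mean tends to 0 pointwise; dominated convergence does the
  rest.\<close>

lemma coord_null_weakly_null:
  fixes f :: "nat \<Rightarrow> 'a \<Rightarrow> real"
  assumes f: "\<And>k. f k \<in> borel_measurable (X n)" "\<And>k x. x \<in> space (X n) \<Longrightarrow> \<bar>f k x\<bar> \<le> 1"
    and weak: "\<And>h. bdd_meas (X n) h \<Longrightarrow> (\<lambda>k. \<integral>x. f k x * h x \<partial>X n) \<longlonglongrightarrow> 0"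
    and \<phi>: "bdd_meas M \<phi>"
  shows "coord_null n (\<lambda>k x. \<phi> x * f k (x n))"
proof -
  have fb: "bdd_meas (X n) (f k)" for k by (rule bdd_measI[OF f])
  have b: "bdd_meas M (\<lambda>x. \<phi> x * f k (x n))" for k
    by (intro bdd_meas_mult \<phi> bdd_meas_comp[OF fb]) simp
  obtain B where B: "B \<ge> 0" "\<And>x. x \<in> space M \<Longrightarrow> \<bar>\<phi> x\<bar> \<le> B" using bdd_measE[OF \<phi>] by metis
  have cm: "coord_mean n (\<lambda>x. \<phi> x * f k (x n)) x = (\<integral>y. f k y * \<phi> (x(n := y)) \<partial>X n)" for k x
    by (simp add: coord_mean_def mult.commute)
  have sl: "bdd_meas (X n) (\<lambda>y. \<phi> (x(n := y)))" if "x \<in> space M" for x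
    using RP.bdd_meas_slice[OF bdd_meas_resample[OF \<phi>, of n] that] by (simp add: resample_def)
  have bound: "\<bar>coord_mean n (\<lambda>x. \<phi> x * f k (x n)) x\<bar> \<le> B" if x: "x \<in> space M" for k x
  proof -
    have "\<bar>coord_mean n (\<lambda>x. \<phi> x * f k (x n)) x\<bar> \<le> (\<integral>y. \<bar>f k y * \<phi> (x(n := y))\<bar> \<partial>X n)"
      unfolding cm by (rule integral_abs_bound)
    also have "\<dots> \<le> (\<integral>y. B \<partial>X n)"
    proof (intro integral_mono X.integrable_bdd_meas bdd_meas_abs bdd_meas_mult fb sl x bdd_meas_const)
      fix y assume y: "y \<in> space (X n)"
      have "\<bar>f k y\<bar> * \<bar>\<phi> (x(n := y))\<bar> \<le> 1 * B"
        by (intro mult_mono f(2) y B) (use x y in \<open>auto simp: space_M\<close>)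
      then show "\<bar>f k y * \<phi> (x(n := y))\<bar> \<le> B" by (simp add: abs_mult)
    qed
    finally show ?thesis by (simp add: X.prob_space)
  qed
  have "(\<lambda>k. \<integral>x. (coord_mean n (\<lambda>x. \<phi> x * f k (x n)) x)\<^sup>2 \<partial>M) \<longlonglongrightarrow> (\<integral>x. 0 \<partial>M)"
  proof (rule integral_dominated_convergence[where w = "\<lambda>_. B\<^sup>2"])
    show "AE x in M. (\<lambda>k. (coord_mean n (\<lambda>x. \<phi> x * f k (x n)) x)\<^sup>2) \<longlonglongrightarrow> 0"
    proof (rule AE_I2)
      fix x assume x: "x \<in> space M"
      have "(\<lambda>k. (coord_mean n (\<lambda>x. \<phi> x * f k (x n)) x)\<^sup>2) \<longlonglongrightarrow> 0\<^sup>2"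
        unfolding cm by (intro tendsto_power weak sl x)
      then show "(\<lambda>k. (coord_mean n (\<lambda>x. \<phi> x * f k (x n)) x)\<^sup>2) \<longlonglongrightarrow> 0" by simp
    qed
    show "AE x in M. norm ((coord_mean n (\<lambda>x. \<phi> x * f k (x n)) x)\<^sup>2) \<le> B\<^sup>2" for k
    proof (rule AE_I2)
      fix x assume "x \<in> space M"
      from bound[OF this, of k] B(1) show "norm ((coord_mean n (\<lambda>x. \<phi> x * f k (x n)) x)\<^sup>2) \<le> B\<^sup>2"
        by (simp add: abs_le_square_iff[symmetric])
    qed
  qed (use bdd_meas_coord_mean[OF b] in auto)
  then show ?thesis using b by (simp add: coord_null_def sqn_def)
qed

text \<open>The hypothesis allows all bounded multipliers so that the shift by \<open>g\<close> can be moved to \<open>\<phi>\<close>.\<close>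

lemma coord_null_avg:
  assumes K: "K \<subseteq> carrier G" and D: "\<And>g. g \<in> K \<Longrightarrow> D g \<in> sets M"
    and av: "averaging M K (\<lambda>g x. if x \<in> D g then T g x else x)"
    and u: "\<And>\<phi>. bdd_meas M \<phi> \<Longrightarrow> coord_null n (\<lambda>k x. \<phi> x * u k x)" and \<phi>: "bdd_meas M \<phi>"
  shows "coord_null n (\<lambda>k x. \<phi> x * averaging.avg K (\<lambda>g x. if x \<in> D g then T g x else x) (u k) x)"
proof -
  interpret averaging M K "\<lambda>g x. if x \<in> D g then T g x else x" by (rule av)
  let ?\<tau> = "\<lambda>g x. if x \<in> D g then T g x else x"
  have "coord_null n (\<lambda>k x. \<Sum>g\<in>K. (\<phi> x / card K) * u k (?\<tau> g x))"
  proof (rule coord_null_sum[OF finite_K])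
    fix g assume gK: "g \<in> K"
    then have g: "g \<in> carrier G" "inv g \<in> carrier G" using K by auto
    \<comment> \<open>The multiplier is precomposed with \<open>T (inv g)\<close>, so that after the
      shift by \<open>g\<close> it is again \<open>\<psi>\<close>, evaluated at
      \<open>x\<close>.\<close>
    define \<psi> where "\<psi> x = indicator (D g) x * (\<phi> x / card K)" for x
    have \<psi>: "bdd_meas M \<psi>" unfolding \<psi>_def
      by (intro bdd_meas_mult bdd_meas_indicator D gK bdd_meas_divide \<phi>)
    have "coord_null n (\<lambda>k x. \<psi> (T (inv g) (T g x)) * u k (T g x))"
      by (rule coord_null_act[OF u g(1)]) (rule bdd_meas_comp[OF \<psi> T_measurable[OF g(2)]])
    moreover have "coord_null n (\<lambda>k x. (indicator (space M - D g) x * (\<phi> x / card K)) * u k x)"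
      by (intro u bdd_meas_mult bdd_meas_indicator bdd_meas_divide \<phi> sets.compl_sets D gK)
    ultimately have "coord_null n (\<lambda>k x. \<psi> (T (inv g) (T g x)) * u k (T g x)
        + (indicator (space M - D g) x * (\<phi> x / card K)) * u k x)"
      by (rule coord_null_add)
    then show "coord_null n (\<lambda>k x. (\<phi> x / card K) * u k (?\<tau> g x))"
      by (rule coord_null_cong[rotated]) (auto simp: \<psi>_def MT.act_inv_left[OF g(1)])
  qed
  then show ?thesis by (rule coord_null_cong[rotated]) (simp add: avg_def sum_distrib_left sum_divide_distrib)
qed

lemma coord_null_avg_pow:
  assumes K: "K \<subseteq> carrier G" and D: "\<And>g. g \<in> K \<Longrightarrow> D g \<in> sets M"
    and av: "averaging M K (\<lambda>g x. if x \<in> D g then T g x else x)"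
    and u: "\<And>\<phi>. bdd_meas M \<phi> \<Longrightarrow> coord_null n (\<lambda>k x. \<phi> x * u k x)" and \<phi>: "bdd_meas M \<phi>"
  shows "coord_null n (\<lambda>k x. \<phi> x * (averaging.avg K (\<lambda>g x. if x \<in> D g then T g x else x) ^^ l) (u k) x)"
  using \<phi>
proof (induction l arbitrary: \<phi>)
  case (Suc l)
  from coord_null_avg[OF K D av Suc.IH Suc.prems] show ?case by simp
qed (use u in auto)

end

section \<open>Localised averages and equality in Cauchy-Schwarz\<close>

section \<open>Averages over the finite extensions\<close>

lemma sq_diff_sqrt_le:
  fixes a b c :: real
  assumes "0 \<le> a" "0 \<le> b" "\<bar>c\<bar> \<le> 1"
  shows "(c * sqrt a - c * sqrt b)\<^sup>2 \<le> \<bar>a - b\<bar>"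
proof -
  have "\<bar>sqrt a - sqrt b\<bar> \<le> \<bar>sqrt a + sqrt b\<bar>" using assms real_sqrt_ge_zero[of a] real_sqrt_ge_zero[of b] by linarith
  then have "\<bar>sqrt a - sqrt b\<bar> * \<bar>sqrt a - sqrt b\<bar> \<le> \<bar>sqrt a - sqrt b\<bar> * \<bar>sqrt a + sqrt b\<bar>"
    by (intro mult_left_mono) auto
  also have "\<dots> = \<bar>a - b\<bar>" using assms by (simp only: abs_mult[symmetric]) (simp add: algebra_simps)
  finally have "(sqrt a - sqrt b)\<^sup>2 \<le> \<bar>a - b\<bar>" by (simp add: power2_eq_square abs_mult[symmetric])
  moreover have "c\<^sup>2 * (sqrt a - sqrt b)\<^sup>2 \<le> 1 * (sqrt a - sqrt b)\<^sup>2"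
    using assms by (intro mult_right_mono) (auto simp: abs_square_le_1)
  ultimately show ?thesis by (simp add: right_diff_distrib[symmetric] power_mult_distrib)
qed

context averaging
begin

text \<open>The probability that the random walk from \<open>x\<close> is in \<open>B\<close> after
  \<open>l\<close> steps.\<close>

definition loc_prob :: "nat \<Rightarrow> 'a set \<Rightarrow> 'a \<Rightarrow> real" where
  "loc_prob l B = (avg ^^ l) (indicator B)"

text \<open>The normalisation makes the squares over a partition sum up to at most the average of \<open>u\<^sup>2\<close>.
  Division by zero makes \<open>loc_vec\<close> vanish where \<open>loc_prob\<close> does.\<close>

definition loc_vec :: "nat \<Rightarrow> 'a set \<Rightarrow> ('a \<Rightarrow> real) \<Rightarrow> 'a \<Rightarrow> real" where
  "loc_vec l B u x = (avg ^^ l) (\<lambda>x. indicator B x * u x) x / sqrt (loc_prob l B x)"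

context
  fixes B :: "'a set" assumes B: "B \<in> sets M"
begin

lemma loc_prob_bdd: "bdd_meas M (loc_prob l B)"
  unfolding loc_prob_def by (intro bdd_meas_avg_pow bdd_meas_indicator B)

lemma loc_prob_nonneg: "x \<in> space M \<Longrightarrow> 0 \<le> loc_prob l B x"
  unfolding loc_prob_def by (rule avg_pow_nonneg) auto

text \<open>A single word ending in \<open>B\<close> already has weight
  \<open>1 / card K ^ l\<close>. This makes the normalising factor of \<open>loc_vec\<close> a
  bounded function for fixed \<open>l\<close>.\<close>

lemma loc_prob_ge: assumes "loc_prob l B x \<noteq> 0" shows "1 / card K ^ l \<le> loc_prob l B x"
proof -
  let ?W = "{w. set w \<subseteq> K \<and> length w = l}"
  have fin: "finite ?W" by (rule finite_lists_length_eq[OF finite_K])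
  have "(\<Sum>w\<in>?W. indicator B (foldr \<tau> w x) :: real) \<noteq> 0"
    using assms unfolding loc_prob_def avg_pow_words by auto
  then obtain w where w: "w \<in> ?W" "(indicator B (foldr \<tau> w x) :: real) \<noteq> 0" by (rule sum.not_neutral_contains_not_neutral)
  have "1 = (indicator B (foldr \<tau> w x) :: real)" using w by (auto simp: indicator_def split: if_splits)
  also have "\<dots> \<le> (\<Sum>w\<in>?W. indicator B (foldr \<tau> w x))" by (rule member_le_sum[OF w(1)]) (auto simp: fin)
  finally show ?thesis unfolding loc_prob_def avg_pow_words by (simp add: divide_right_mono)
qed

lemma loc_vec_sq_le:
  assumes u: "bdd_meas M u" and x: "x \<in> space M"
  shows "(loc_vec l B u x)\<^sup>2 \<le> (avg ^^ l) (\<lambda>x. indicator B x * (u x)\<^sup>2) x"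
proof (cases "loc_prob l B x = 0")
  case True
  then show ?thesis using avg_pow_nonneg[OF _ x, of "\<lambda>x. indicator B x * (u x)\<^sup>2" l] by (simp add: loc_vec_def)
next
  case False
  then have p: "loc_prob l B x > 0" using loc_prob_nonneg[OF x, of l] by simp
  have "((avg ^^ l) (\<lambda>x. indicator B x * u x) x)\<^sup>2 \<le> (avg ^^ l) (\<lambda>x. indicator B x * (u x)\<^sup>2) x * loc_prob l B x"
    unfolding loc_prob_def by (rule avg_pow_mult_sq_le) (use B x in auto)
  then show ?thesis using p by (simp add: loc_vec_def power_divide field_simps)
qed

lemma loc_vec_eq_mult:
  "loc_vec l B u x = (1 / sqrt (loc_prob l B x)) * (avg ^^ l) (\<lambda>x. indicator B x * u x) x"
  by (simp add: loc_vec_def)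

lemma bdd_meas_inverse_sqrt_loc_prob: "bdd_meas M (\<lambda>x. 1 / sqrt (loc_prob l B x))"
proof (rule bdd_measI)
  show "(\<lambda>x. 1 / sqrt (loc_prob l B x)) \<in> borel_measurable M"
    using loc_prob_bdd[of l] by auto
  fix x assume x: "x \<in> space M"
  have k: "(0::real) < 1 / card K ^ l" using card_K_pos by simp
  show "\<bar>1 / sqrt (loc_prob l B x)\<bar> \<le> 1 / sqrt (1 / card K ^ l)"
  proof (cases "loc_prob l B x = 0")
    case False
    then have "sqrt (1 / card K ^ l) \<le> sqrt (loc_prob l B x)" using loc_prob_ge by simp
    then have "1 / sqrt (loc_prob l B x) \<le> 1 / sqrt (1 / card K ^ l)"
      using k less_le_trans[OF k loc_prob_ge[OF False]] by (intro divide_left_mono mult_pos_pos) simp_all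
    then show ?thesis using loc_prob_nonneg[OF x] by simp
  qed simp
qed

lemma bdd_meas_loc_vec: "bdd_meas M u \<Longrightarrow> bdd_meas M (loc_vec l B u)"
  unfolding loc_vec_eq_mult[abs_def]
  by (intro bdd_meas_mult bdd_meas_inverse_sqrt_loc_prob bdd_meas_avg_pow bdd_meas_indicator B)

lemma loc_vec_diff: "loc_vec l B (\<lambda>x. u x - v x) x = loc_vec l B u x - loc_vec l B v x"
  unfolding loc_vec_def by (simp add: right_diff_distrib avg_pow_diff diff_divide_distrib)

text \<open>Where \<open>u\<close> is constant on the part of \<open>B\<close> that the walk can
  reach, the weighted Cauchy-Schwarz inequality is an equality: no energy is lost, and
  \<open>loc_vec\<close> depends on \<open>u\<close> only through the constant
  \<open>c\<close>.\<close>

lemma loc_vec_const_on: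
  assumes C: "\<And>i y. i \<in> K \<Longrightarrow> y \<in> C \<Longrightarrow> \<tau> i y \<in> C" and c: "\<And>y. y \<in> C \<Longrightarrow> y \<in> B \<Longrightarrow> u y = c"
    and x: "x \<in> C" "x \<in> space M"
  shows "loc_vec l B u x = c * sqrt (loc_prob l B x)"
    and "(avg ^^ l) (\<lambda>x. indicator B x * (u x)\<^sup>2) x = (loc_vec l B u x)\<^sup>2"
proof -
  have "(avg ^^ l) (\<lambda>x. indicator B x * u x) x = (avg ^^ l) (\<lambda>x. c * indicator B x) x"
    by (rule avg_pow_cong_on[OF C _ x(1)]) (auto simp: c indicator_def)
  also have "\<dots> = c * loc_prob l B x" by (simp add: avg_pow_cmult loc_prob_def)
  finally show *: "loc_vec l B u x = c * sqrt (loc_prob l B x)"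
    using loc_prob_nonneg[OF x(2), of l] by (simp add: loc_vec_def real_div_sqrt flip: times_divide_eq_right)
  have "(avg ^^ l) (\<lambda>x. indicator B x * (u x)\<^sup>2) x = (avg ^^ l) (\<lambda>x. c\<^sup>2 * indicator B x) x"
    by (rule avg_pow_cong_on[OF C _ x(1)]) (auto simp: c indicator_def)
  also have "\<dots> = c\<^sup>2 * loc_prob l B x" by (simp add: avg_pow_cmult loc_prob_def)
  finally show "(avg ^^ l) (\<lambda>x. indicator B x * (u x)\<^sup>2) x = (loc_vec l B u x)\<^sup>2"
    using loc_prob_nonneg[OF x(2), of l] by (simp add: * power_mult_distrib)
qed

end

lemma sum_loc_vec_sq_le:
  assumes B: "\<And>j. j \<in> J \<Longrightarrow> B j \<in> sets M" and part: "\<And>x. x \<in> space M \<Longrightarrow> (\<Sum>j\<in>J. indicator (B j) x :: real) = 1"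
    and u: "bdd_meas M u" and x: "x \<in> space M"
  shows "(\<Sum>j\<in>J. (avg ^^ l) (\<lambda>x. indicator (B j) x * (u x)\<^sup>2) x) = (avg ^^ l) (\<lambda>x. (u x)\<^sup>2) x"
    and "(\<Sum>j\<in>J. (loc_vec l (B j) u x)\<^sup>2) \<le> (avg ^^ l) (\<lambda>x. (u x)\<^sup>2) x"
proof -
  have "(\<Sum>j\<in>J. (avg ^^ l) (\<lambda>x. indicator (B j) x * (u x)\<^sup>2) x) = (avg ^^ l) (\<lambda>x. \<Sum>j\<in>J. indicator (B j) x * (u x)\<^sup>2) x"
    by (simp add: avg_pow_sum)
  also have "\<dots> = (avg ^^ l) (\<lambda>x. (u x)\<^sup>2) x"
    by (rule avg_pow_cong[OF _ x]) (simp add: part flip: sum_distrib_right)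
  finally show *: "(\<Sum>j\<in>J. (avg ^^ l) (\<lambda>x. indicator (B j) x * (u x)\<^sup>2) x) = (avg ^^ l) (\<lambda>x. (u x)\<^sup>2) x" .
  show "(\<Sum>j\<in>J. (loc_vec l (B j) u x)\<^sup>2) \<le> (avg ^^ l) (\<lambda>x. (u x)\<^sup>2) x"
    unfolding *[symmetric] by (intro sum_mono loc_vec_sq_le B u x)
qed

end

section \<open>Energy of the localised averages against the gap\<close>

section \<open>The main inequality\<close>

locale extension_averaging = diagonal_pmp G X a
  for G :: "('g, 'r) monoid_scheme" (structure) and X :: "nat \<Rightarrow> 'a measure" and a +
  fixes n :: nat and K :: "'g set" and C :: real and D :: "'g \<Rightarrow> (nat \<Rightarrow> 'a) set"
  assumes finite_K: "finite K" and K_carrier: "K \<subseteq> carrier G" and one_K: "\<one> \<in> K"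
    and inv_K: "\<And>g. g \<in> K \<Longrightarrow> inv g \<in> K"
    and D_sets: "\<And>g. g \<in> K \<Longrightarrow> D g \<in> sets M"
    and D_inv: "\<And>g x. g \<in> K \<Longrightarrow> x \<in> space M \<Longrightarrow> T g x \<in> D (inv g) \<longleftrightarrow> x \<in> D g"
    and C_nonneg: "0 \<le> C"
    and gap: "\<And>f. bdd_meas M f \<Longrightarrow>
      sqn M f \<le> C * (\<Sum>g\<in>K. sqn M (\<lambda>x. f (T g x) - f x)) + 2 * sqn M (coord_mean n f)"
begin

abbreviation \<tau> :: "'g \<Rightarrow> (nat \<Rightarrow> 'a) \<Rightarrow> (nat \<Rightarrow> 'a)" where
  "\<tau> \<equiv> (\<lambda>g x. if x \<in> D g then T g x else x)"

sublocale Av: averaging M K \<tau>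
  by (rule MT.averaging_partial[OF finite_K K_carrier one_K inv_K D_sets D_inv])

definition closed_under_\<tau> :: "(nat \<Rightarrow> 'a) set \<Rightarrow> bool" where
  "closed_under_\<tau> A \<longleftrightarrow> (\<forall>g\<in>K. \<forall>y\<in>A. \<tau> g y \<in> A)"

text \<open>The closed set \<open>A\<close> plays the role of the class of \<open>x\<close>, and \<open>u\<close> is constant on \<open>A \<inter> B\<close>.\<close>

definition constant_on_classes :: "(nat \<Rightarrow> 'a) set \<Rightarrow> (nat \<Rightarrow> 'a) set \<Rightarrow> ((nat \<Rightarrow> 'a) \<Rightarrow> real) \<Rightarrow> bool" where
  "constant_on_classes U B u \<longleftrightarrow> (\<forall>x\<in>U. \<exists>A c. x \<in> A \<and> closed_under_\<tau> A \<and>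
     \<bar>c\<bar> \<le> 1 \<and> (\<forall>y\<in>A. y \<in> B \<longrightarrow> u y = c))"

text \<open>The gap is applied to each \<open>loc_vec l (B j) u\<close> and summed over
  \<open>j\<close>. The energy of \<open>u\<close> survives on \<open>U\<close>; the motion is that
  of \<open>loc_prob\<close>, up to an error outside \<open>U \<inter> D g\<close>; replacing
  \<open>u\<close> by \<open>f\<close> costs the squared distance of the two.\<close>

lemma main_inequality:
  fixes B :: "'j \<Rightarrow> (nat \<Rightarrow> 'a) set"
  assumes J: "finite J" and B: "\<And>j. j \<in> J \<Longrightarrow> B j \<in> sets M"
    and part: "\<And>x. x \<in> space M \<Longrightarrow> (\<Sum>j\<in>J. indicator (B j) x :: real) = 1"
    and U: "U \<in> sets M" and const: "\<And>j. j \<in> J \<Longrightarrow> constant_on_classes U (B j) u"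
    and u: "u \<in> borel_measurable M" "\<And>x. x \<in> space M \<Longrightarrow> \<bar>u x\<bar> \<le> 1"
    and f: "bdd_meas M f"
  shows "sqn M u \<le> PM.prob (space M - U)
    + C * (\<Sum>g\<in>K. (\<Sum>j\<in>J. sqrt (sqn M (\<lambda>x. Av.loc_prob l (B j) (\<tau> g x) - Av.loc_prob l (B j) x)))
        + 4 * PM.prob (space M - (U \<inter> D g)))
    + 4 * sqn M (\<lambda>x. u x - f x) + 4 * (\<Sum>j\<in>J. sqn M (coord_mean n (Av.loc_vec l (B j) f)))"
proof -
  define w where "w j = Av.loc_vec l (B j) u" for j
  define v where "v j = Av.loc_vec l (B j) f" for j
  define q where "q j = Av.loc_prob l (B j)" for j
  have ub: "bdd_meas M u" by (rule bdd_measI[OF u])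
  have wb: "bdd_meas M (w j)" and vb: "bdd_meas M (v j)" and qb: "bdd_meas M (q j)" if "j \<in> J" for j
    unfolding w_def v_def q_def by (intro Av.bdd_meas_loc_vec Av.loc_prob_bdd B that ub f)+
  have u1: "(u x)\<^sup>2 \<le> 1" if "x \<in> space M" for x using u(2)[OF that] by (simp add: abs_square_le_1)
  have Qu: "bdd_meas M ((Av.avg ^^ l) (\<lambda>x. (u x)\<^sup>2))" by (intro Av.bdd_meas_avg_pow bdd_meas_power2 ub)
  have Qu1: "(Av.avg ^^ l) (\<lambda>x. (u x)\<^sup>2) x \<le> 1" if "x \<in> space M" for x
    using Av.avg_pow_mono[OF u1 that, where l = l] by (simp add: Av.avg_pow_const)
  have w_le: "(\<Sum>j\<in>J. (w j x)\<^sup>2) \<le> 1" if "x \<in> space M" for x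
    using Av.sum_loc_vec_sq_le(2)[OF B part ub that, where l = l] Qu1[OF that] by (simp add: w_def)
  have w_const: "\<exists>c. \<bar>c\<bar> \<le> 1 \<and> w j x = c * sqrt (q j x) \<and> (\<forall>g\<in>K. w j (\<tau> g x) = c * sqrt (q j (\<tau> g x)))
      \<and> (Av.avg ^^ l) (\<lambda>x. indicator (B j) x * (u x)\<^sup>2) x = (w j x)\<^sup>2" if j: "j \<in> J" and x: "x \<in> U" for j x
  proof -
    have xM: "x \<in> space M" using sets.sets_into_space[OF U] x by auto
    obtain A c where A: "x \<in> A" "closed_under_\<tau> A" "\<bar>c\<bar> \<le> 1" "\<And>y. y \<in> A \<Longrightarrow> y \<in> B j \<Longrightarrow> u y = c"
      using const[OF j] x unfolding constant_on_classes_def by meson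
    have cl: "\<tau> g y \<in> A" if "g \<in> K" "y \<in> A" for g y
      by (rule bspec[OF bspec[OF A(2)[unfolded closed_under_\<tau>_def] that(1)] that(2)])
    have "w j y = c * sqrt (q j y)" if "y \<in> A" "y \<in> space M" for y
      unfolding w_def q_def by (rule Av.loc_vec_const_on(1)[OF B[OF j] cl A(4) that])
    moreover have "(Av.avg ^^ l) (\<lambda>x. indicator (B j) x * (u x)\<^sup>2) x = (w j x)\<^sup>2"
      unfolding w_def by (rule Av.loc_vec_const_on(2)[OF B[OF j] cl A(4) A(1) xM])
    moreover have "\<tau> g x \<in> A" "\<tau> g x \<in> space M" if "g \<in> K" for g
      by (rule cl[OF that A(1)], rule Av.\<tau>_space[OF that xM])
    ultimately show ?thesis using A(1,3) xM by (intro exI[of _ c] conjI ballI) blast+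
  qed
  \<comment> \<open>On \<open>U\<close> the squares of the \<open>w j\<close> sum exactly to the
    average of the square of \<open>u\<close>; elsewhere that average is at most 1.\<close>
  have lower: "sqn M u - PM.prob (space M - U) \<le> (\<Sum>j\<in>J. sqn M (w j))"
  proof -
    have "sqn M u - PM.prob (space M - U) = (\<integral>x. (Av.avg ^^ l) (\<lambda>x. (u x)\<^sup>2) x - indicator (space M - U) x \<partial>M)"
    proof (subst Bochner_Integration.integral_diff)
      show "integrable M ((Av.avg ^^ l) (\<lambda>x. (u x)\<^sup>2))" by (rule PM.integrable_bdd_meas[OF Qu])
      show "integrable M (indicat_real (space M - U))" using U by (intro PM.integrable_bdd_meas bdd_meas_indicator) auto
      show "sqn M u - PM.prob (space M - U) = integral\<^sup>L M ((Av.avg ^^ l) (\<lambda>x. (u x)\<^sup>2)) - integral\<^sup>L M (indicat_real (space M - U))"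
        using Av.integral_avg_pow[OF bdd_meas_power2[OF ub], where l = l] U by (simp add: sqn_def)
    qed
    also have "\<dots> \<le> (\<integral>x. (\<Sum>j\<in>J. (w j x)\<^sup>2) \<partial>M)"
    proof (rule integral_mono)
      show "integrable M (\<lambda>x. (Av.avg ^^ l) (\<lambda>x. (u x)\<^sup>2) x - indicator (space M - U) x)"
        using U by (intro PM.integrable_bdd_meas bdd_meas_diff Qu bdd_meas_indicator) auto
      show "integrable M (\<lambda>x. \<Sum>j\<in>J. (w j x)\<^sup>2)" by (intro PM.integrable_bdd_meas bdd_meas_sum bdd_meas_power2 wb)
      fix x assume x: "x \<in> space M"
      show "(Av.avg ^^ l) (\<lambda>x. (u x)\<^sup>2) x - indicator (space M - U) x \<le> (\<Sum>j\<in>J. (w j x)\<^sup>2)"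
      proof (cases "x \<in> U")
        case True
        have "(Av.avg ^^ l) (\<lambda>x. (u x)\<^sup>2) x = (\<Sum>j\<in>J. (Av.avg ^^ l) (\<lambda>x. indicator (B j) x * (u x)\<^sup>2) x)"
          by (rule Av.sum_loc_vec_sq_le(1)[OF B part ub x, symmetric])
        also have "\<dots> = (\<Sum>j\<in>J. (w j x)\<^sup>2)" by (intro sum.cong refl) (use w_const True in blast)
        finally show ?thesis by (simp add: indicator_def)
      next
        case False
        then show ?thesis using Qu1[OF x] x sum_nonneg[of J "\<lambda>j. (w j x)\<^sup>2"] by simp
      qed
    qed
    also have "\<dots> = (\<Sum>j\<in>J. sqn M (w j))"
      unfolding sqn_def by (intro Bochner_Integration.integral_sum PM.integrable_bdd_meas bdd_meas_power2 wb)
    finally show ?thesis .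
  qed
  \<comment> \<open>On \<open>U \<inter> D g\<close> the move stays in the closed set, so the same
    \<open>c\<close> serves both points and only the square roots differ. Elsewhere 4 bounds the
    sum, as the squares of the \<open>w j\<close> sum to at most 1 at each of the two
    points.\<close>
  have defect: "(\<Sum>j\<in>J. sqn M (\<lambda>x. w j (T g x) - w j x))
    \<le> (\<Sum>j\<in>J. sqrt (sqn M (\<lambda>x. q j (\<tau> g x) - q j x))) + 4 * PM.prob (space M - (U \<inter> D g))" if g: "g \<in> K" for g
  proof -
    have gG: "g \<in> carrier G" using g K_carrier by auto
    have E: "space M - (U \<inter> D g) \<in> sets M" using U D_sets[OF g] by auto
    have wT: "bdd_meas M (\<lambda>x. w j (T g x))" if "j \<in> J" for j
      by (rule bdd_meas_comp[OF wb[OF that] T_measurable[OF gG]])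
    have qd: "bdd_meas M (\<lambda>x. q j (\<tau> g x) - q j x)" if "j \<in> J" for j
      by (intro bdd_meas_diff Av.bdd_meas_\<tau>[OF g] qb that)
    have "(\<Sum>j\<in>J. sqn M (\<lambda>x. w j (T g x) - w j x)) = (\<integral>x. (\<Sum>j\<in>J. (w j (T g x) - w j x)\<^sup>2) \<partial>M)"
      unfolding sqn_def
      by (rule Bochner_Integration.integral_sum[symmetric]) (intro PM.integrable_bdd_meas bdd_meas_power2 bdd_meas_diff wT wb)
    also have "\<dots> \<le> (\<integral>x. (\<Sum>j\<in>J. \<bar>q j (\<tau> g x) - q j x\<bar>) + 4 * indicator (space M - (U \<inter> D g)) x \<partial>M)"
    proof (rule integral_mono)
      show "integrable M (\<lambda>x. \<Sum>j\<in>J. (w j (T g x) - w j x)\<^sup>2)"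
        by (intro PM.integrable_bdd_meas bdd_meas_sum bdd_meas_power2 bdd_meas_diff wT wb)
      show "integrable M (\<lambda>x. (\<Sum>j\<in>J. \<bar>q j (\<tau> g x) - q j x\<bar>) + 4 * indicator (space M - (U \<inter> D g)) x)"
        by (intro PM.integrable_bdd_meas bdd_meas_add bdd_meas_sum bdd_meas_abs qd bdd_meas_mult bdd_meas_const bdd_meas_indicator E)
      fix x assume x: "x \<in> space M"
      show "(\<Sum>j\<in>J. (w j (T g x) - w j x)\<^sup>2) \<le> (\<Sum>j\<in>J. \<bar>q j (\<tau> g x) - q j x\<bar>) + 4 * indicator (space M - (U \<inter> D g)) x"
      proof (cases "x \<in> U \<inter> D g")
        case True
        have "(w j (T g x) - w j x)\<^sup>2 \<le> \<bar>q j (\<tau> g x) - q j x\<bar>" if j: "j \<in> J" for j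
        proof -
          obtain c where c: "\<bar>c\<bar> \<le> 1" "w j x = c * sqrt (q j x)" "\<forall>g\<in>K. w j (\<tau> g x) = c * sqrt (q j (\<tau> g x))"
            using w_const[OF j, of x] True by blast
          have "w j (T g x) = c * sqrt (q j (T g x))" using c(3) g True by auto
          then show ?thesis
            using c True sq_diff_sqrt_le[of "q j (T g x)" "q j x" c] Av.loc_prob_nonneg[OF B[OF j]] x T_space[OF gG x]
            by (simp add: q_def)
        qed
        then show ?thesis using True by (simp add: sum_mono)
      next
        case False
        have "(\<Sum>j\<in>J. (w j (T g x) - w j x)\<^sup>2) \<le> (\<Sum>j\<in>J. 2 * (w j (T g x))\<^sup>2 + 2 * (w j x)\<^sup>2)"
        proof (rule sum_mono)
          fix j show "(w j (T g x) - w j x)\<^sup>2 \<le> 2 * (w j (T g x))\<^sup>2 + 2 * (w j x)\<^sup>2"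
            using zero_le_power2[of "w j (T g x) + w j x"] by (simp add: power2_sum power2_diff)
        qed
        also have "\<dots> \<le> 4" using w_le[OF x] w_le[OF T_space[OF gG x]] by (simp add: sum.distrib flip: sum_distrib_left)
        finally show ?thesis using False x by (simp add: sum_nonneg add_increasing)
      qed
    qed
    also have "\<dots> = (\<Sum>j\<in>J. \<integral>x. \<bar>q j (\<tau> g x) - q j x\<bar> \<partial>M) + 4 * PM.prob (space M - (U \<inter> D g))"
    proof (subst Bochner_Integration.integral_add)
      show "integrable M (\<lambda>x. \<Sum>j\<in>J. \<bar>q j (\<tau> g x) - q j x\<bar>)" by (intro PM.integrable_bdd_meas bdd_meas_sum bdd_meas_abs qd)
      show "integrable M (\<lambda>x. 4 * indicat_real (space M - (U \<inter> D g)) x)"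
        by (intro PM.integrable_bdd_meas bdd_meas_mult bdd_meas_const bdd_meas_indicator E)
      have "(\<integral>x. (\<Sum>j\<in>J. \<bar>q j (\<tau> g x) - q j x\<bar>) \<partial>M) = (\<Sum>j\<in>J. \<integral>x. \<bar>q j (\<tau> g x) - q j x\<bar> \<partial>M)"
        by (intro Bochner_Integration.integral_sum PM.integrable_bdd_meas bdd_meas_abs qd)
      then show "(\<integral>x. (\<Sum>j\<in>J. \<bar>q j (\<tau> g x) - q j x\<bar>) \<partial>M) + (\<integral>x. 4 * indicat_real (space M - (U \<inter> D g)) x \<partial>M)
        = (\<Sum>j\<in>J. \<integral>x. \<bar>q j (\<tau> g x) - q j x\<bar> \<partial>M) + 4 * PM.prob (space M - (U \<inter> D g))"
        using E by simp
    qed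
    also have "\<dots> \<le> (\<Sum>j\<in>J. sqrt (sqn M (\<lambda>x. q j (\<tau> g x) - q j x))) + 4 * PM.prob (space M - (U \<inter> D g))"
      by (intro add_right_mono sum_mono PM.integral_abs_le_sqrt_sqn qd)
    finally show ?thesis .
  qed
  have wv: "(\<Sum>j\<in>J. sqn M (\<lambda>x. w j x - v j x)) \<le> sqn M (\<lambda>x. u x - f x)"
  proof -
    have d: "bdd_meas M (\<lambda>x. u x - f x)" by (rule bdd_meas_diff[OF ub f])
    have eq: "w j x - v j x = Av.loc_vec l (B j) (\<lambda>x. u x - f x) x" if "j \<in> J" for j x
      unfolding w_def v_def by (rule Av.loc_vec_diff[OF B[OF that], symmetric])
    have db: "bdd_meas M (\<lambda>x. w j x - v j x)" if "j \<in> J" for j by (intro bdd_meas_diff wb vb that)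
    have "(\<Sum>j\<in>J. sqn M (\<lambda>x. w j x - v j x)) = (\<integral>x. (\<Sum>j\<in>J. (w j x - v j x)\<^sup>2) \<partial>M)"
      unfolding sqn_def
      by (rule Bochner_Integration.integral_sum[symmetric]) (intro PM.integrable_bdd_meas bdd_meas_power2 db)
    also have "\<dots> \<le> (\<integral>x. (Av.avg ^^ l) (\<lambda>x. (u x - f x)\<^sup>2) x \<partial>M)"
    proof (rule integral_mono)
      show "integrable M (\<lambda>x. \<Sum>j\<in>J. (w j x - v j x)\<^sup>2)"
        by (intro PM.integrable_bdd_meas bdd_meas_sum bdd_meas_power2 db)
      show "integrable M ((Av.avg ^^ l) (\<lambda>x. (u x - f x)\<^sup>2))"
        by (intro PM.integrable_bdd_meas Av.bdd_meas_avg_pow bdd_meas_power2 d)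
      fix x assume x: "x \<in> space M"
      show "(\<Sum>j\<in>J. (w j x - v j x)\<^sup>2) \<le> (Av.avg ^^ l) (\<lambda>x. (u x - f x)\<^sup>2) x"
        using Av.sum_loc_vec_sq_le(2)[OF B part d x, where l = l] by (simp add: eq)
    qed
    also have "\<dots> = sqn M (\<lambda>x. u x - f x)"
      unfolding sqn_def by (rule Av.integral_avg_pow[OF bdd_meas_power2[OF d]])
    finally show ?thesis .
  qed
  \<comment> \<open>Passing to \<open>v j\<close> makes the coordinate mean accessible to weak
    convergence, which says nothing about \<open>u\<close>.\<close>
  have cm: "sqn M (coord_mean n (w j)) \<le> 2 * sqn M (\<lambda>x. w j x - v j x) + 2 * sqn M (coord_mean n (v j))" if j: "j \<in> J" for j
  proof -
    have d: "bdd_meas M (\<lambda>x. w j x - v j x)" by (intro bdd_meas_diff wb vb j)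
    have "sqn M (coord_mean n (w j)) = sqn M (\<lambda>x. coord_mean n (\<lambda>x. w j x - v j x) x + coord_mean n (v j) x)"
      by (rule sqn_cong) (simp add: coord_mean_add[OF d vb[OF j], symmetric])
    also have "\<dots> \<le> 2 * sqn M (coord_mean n (\<lambda>x. w j x - v j x)) + 2 * sqn M (coord_mean n (v j))"
      by (intro PM.sqn_add_le bdd_meas_coord_mean d vb j)
    finally show ?thesis using sqn_coord_mean_le[OF d, of n] by simp
  qed
  have "(\<Sum>j\<in>J. sqn M (w j)) \<le> (\<Sum>j\<in>J. C * (\<Sum>g\<in>K. sqn M (\<lambda>x. w j (T g x) - w j x))
      + 2 * (2 * sqn M (\<lambda>x. w j x - v j x) + 2 * sqn M (coord_mean n (v j))))"
    using gap[OF wb] cm by (intro sum_mono) fastforce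
  also have "\<dots> = C * (\<Sum>g\<in>K. \<Sum>j\<in>J. sqn M (\<lambda>x. w j (T g x) - w j x))
      + 4 * (\<Sum>j\<in>J. sqn M (\<lambda>x. w j x - v j x)) + 4 * (\<Sum>j\<in>J. sqn M (coord_mean n (v j)))"
    by (subst sum.swap) (simp add: sum.distrib sum_distrib_left)
  also have "\<dots> \<le> C * (\<Sum>g\<in>K. (\<Sum>j\<in>J. sqrt (sqn M (\<lambda>x. q j (\<tau> g x) - q j x))) + 4 * PM.prob (space M - (U \<inter> D g)))
      + 4 * sqn M (\<lambda>x. u x - f x) + 4 * (\<Sum>j\<in>J. sqn M (coord_mean n (v j)))"
    using wv by (intro add_mono mult_left_mono sum_mono defect C_nonneg) auto
  finally show ?thesis using lower unfolding q_def v_def by linarith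
qed

text \<open>First \<open>k\<close> tends to infinity with \<open>l\<close> fixed, killing the
  coordinate means, then \<open>l\<close>, killing the motion of \<open>loc_prob\<close>. The
  remaining terms involve neither.\<close>

lemma limit_inequality:
  fixes B :: "'j \<Rightarrow> (nat \<Rightarrow> 'a) set" and f :: "nat \<Rightarrow> 'a \<Rightarrow> real"
  assumes J: "finite J" and B: "\<And>j. j \<in> J \<Longrightarrow> B j \<in> sets M"
    and part: "\<And>x. x \<in> space M \<Longrightarrow> (\<Sum>j\<in>J. indicator (B j) x :: real) = 1"
    and U: "U \<in> sets M" and const: "\<And>j k. j \<in> J \<Longrightarrow> constant_on_classes U (B j) (u k)"
    and u: "\<And>k. u k \<in> borel_measurable M" "\<And>k x. x \<in> space M \<Longrightarrow> \<bar>u k x\<bar> \<le> 1"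
    and f: "\<And>k. f k \<in> borel_measurable (X n)" "\<And>k x. x \<in> space (X n) \<Longrightarrow> \<bar>f k x\<bar> \<le> 1"
    and weak: "\<And>h. bdd_meas (X n) h \<Longrightarrow> (\<lambda>k. \<integral>x. f k x * h x \<partial>X n) \<longlonglongrightarrow> 0"
    and close: "\<And>k. sqn M (\<lambda>x. f k (x n) - u k x) \<le> \<epsilon>" and c: "\<And>k. c \<le> sqn (X n) (f k)"
  shows "c / 2 - 5 * \<epsilon> \<le> PM.prob (space M - U) + C * (\<Sum>g\<in>K. 4 * PM.prob (space M - (U \<inter> D g)))"
proof -
  define Z where "Z l = PM.prob (space M - U)
    + C * (\<Sum>g\<in>K. (\<Sum>j\<in>J. sqrt (sqn M (\<lambda>x. Av.loc_prob l (B j) (\<tau> g x) - Av.loc_prob l (B j) x)))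
        + 4 * PM.prob (space M - (U \<inter> D g)))" for l
  have proj: "(\<lambda>x. x n) \<in> M \<rightarrow>\<^sub>M X n" by (rule measurable_component_singleton) simp
  have fb: "bdd_meas M (\<lambda>x. f k (x n))" for k
    by (rule bdd_meas_comp[OF bdd_measI[OF f] proj])
  have fc: "c \<le> sqn M (\<lambda>x. f k (x n))" for k
    using c[of k] sqn_distr[OF proj PX.PiM_component f(1), of k] by simp
  \<comment> \<open>One \<open>\<epsilon>\<close> is lost in bounding the energy of
    \<open>u k\<close> from below by \<open>c / 2 - \<epsilon>\<close>, four more in the main
    inequality.\<close>
  have le: "c / 2 - 5 * \<epsilon> \<le> Z l" for l
  proof -
    have step: "c / 2 - 5 * \<epsilon> \<le> Z l + 4 * (\<Sum>j\<in>J. sqn M (coord_mean n (Av.loc_vec l (B j) (\<lambda>x. f k (x n)))))" for k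
    proof -
      have ub: "bdd_meas M (u k)" by (rule bdd_measI[OF u])
      have "sqn M (\<lambda>x. f k (x n)) \<le> 2 * sqn M (\<lambda>x. f k (x n) - u k x) + 2 * sqn M (u k)"
        using PM.sqn_add_le[OF bdd_meas_diff[OF fb ub] ub, of k] by simp
      then have "c / 2 - \<epsilon> \<le> sqn M (u k)" using fc[of k] close[of k] by linarith
      moreover have "sqn M (\<lambda>x. u k x - f k (x n)) \<le> \<epsilon>"
        using close[of k] sqn_uminus[of M "\<lambda>x. u k x - f k (x n)"] by simp
      ultimately show ?thesis
        using main_inequality[OF J B part U const u fb, of k l k] unfolding Z_def by linarith
    qed
    \<comment> \<open>For fixed \<open>l\<close> the normalisation is a bounded multiplier
      independent of \<open>k\<close>.\<close>
    have "(\<lambda>k. sqn M (coord_mean n (Av.loc_vec l (B j) (\<lambda>x. f k (x n))))) \<longlonglongrightarrow> 0" if j: "j \<in> J" for j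
    proof -
      have "coord_null n (\<lambda>k x. (1 / sqrt (Av.loc_prob l (B j) x)) * (Av.avg ^^ l) (\<lambda>x. indicator (B j) x * f k (x n)) x)"
      proof (rule coord_null_avg_pow[OF K_carrier D_sets Av.averaging_axioms])
        show "bdd_meas M (\<lambda>x. 1 / sqrt (Av.loc_prob l (B j) x))" by (rule Av.bdd_meas_inverse_sqrt_loc_prob[OF B[OF j]])
        fix \<phi> :: "(nat \<Rightarrow> 'a) \<Rightarrow> real" assume "bdd_meas M \<phi>"
        then have "bdd_meas M (\<lambda>x. \<phi> x * indicator (B j) x)" using B[OF j] by auto
        from coord_null_weakly_null[OF f weak this]
        show "coord_null n (\<lambda>k x. \<phi> x * (indicator (B j) x * f k (x n)))" by (simp add: mult.assoc)
      qed
      then show ?thesis by (simp add: coord_null_def Av.loc_vec_def[abs_def])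
    qed
    then have "(\<lambda>k. Z l + 4 * (\<Sum>j\<in>J. sqn M (coord_mean n (Av.loc_vec l (B j) (\<lambda>x. f k (x n)))))) \<longlonglongrightarrow> Z l + 4 * (\<Sum>j\<in>J. 0)"
      by (intro tendsto_add tendsto_mult tendsto_const tendsto_sum)
    then have "(\<lambda>k. Z l + 4 * (\<Sum>j\<in>J. sqn M (coord_mean n (Av.loc_vec l (B j) (\<lambda>x. f k (x n)))))) \<longlonglongrightarrow> Z l"
      by simp
    then show ?thesis by (rule LIMSEQ_le_const) (use step in auto)
  qed
  have "Z \<longlonglongrightarrow> PM.prob (space M - U) + C * (\<Sum>g\<in>K. (\<Sum>j\<in>J. sqrt 0) + 4 * PM.prob (space M - (U \<inter> D g)))"
    unfolding Z_def Av.loc_prob_def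
    by (intro tendsto_add tendsto_mult tendsto_const tendsto_sum tendsto_real_sqrt Av.avg_pow_defect_tendsto
        bdd_meas_indicator B)
  then have "Z \<longlonglongrightarrow> PM.prob (space M - U) + C * (\<Sum>g\<in>K. 4 * PM.prob (space M - (U \<inter> D g)))" by simp
  then show ?thesis by (rule LIMSEQ_le_const) (use le in auto)
qed

end

section \<open>Finite subrelations of the quotient and labels that separate their classes\<close>

section \<open>Hyperfinite quotients\<close>

text \<open>A countable base of the topology separates points; its members serve as labels for
  points of the quotient.\<close>

lemma standard_borel_separating:
  fixes N :: "'y measure"
  assumes "standard_borel N"
  shows "\<exists>V :: nat \<Rightarrow> 'y set. (\<forall>i. V i \<in> sets N) \<and>
    (\<forall>y\<in>space N. \<forall>y'\<in>space N. (\<forall>i. y \<in> V i \<longleftrightarrow> y' \<in> V i) \<longrightarrow> y = y')"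
proof -
  obtain T where T: "completely_metrizable_space T" "second_countable T" "topspace T = space N"
    "sets N = sigma_sets (space N) {U. openin T U}" using assms by (auto simp: standard_borel_def)
  obtain \<B> where \<B>: "countable \<B>" "\<And>V. V \<in> \<B> \<Longrightarrow> openin T V"
    "\<And>U x. openin T U \<Longrightarrow> x \<in> U \<Longrightarrow> \<exists>V\<in>\<B>. x \<in> V \<and> V \<subseteq> U"
    using T(2) unfolding second_countable_def by metis
  \<comment> \<open>The empty set guarantees something to enumerate even if the base is empty; it
    separates nothing.\<close>
  define V where "V = from_nat_into (insert {} \<B>)"
  have V_in: "V i \<in> insert {} \<B>" for i unfolding V_def by (rule from_nat_into) simp
  have t1: "t1_space T" using T(1) by (simp add: completely_metrizable_imp_metrizable_space metrizable_imp_t1_space)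
  show ?thesis
  proof (intro exI[of _ V] conjI allI ballI impI)
    show "V i \<in> sets N" for i
      using V_in[of i] \<B>(2) by (auto simp: T(4) sigma_sets.Empty)
    fix y y' assume y: "y \<in> space N" "y' \<in> space N" and same: "\<forall>i. y \<in> V i \<longleftrightarrow> y' \<in> V i"
    show "y = y'"
    proof (rule ccontr)
      assume "y \<noteq> y'"
      then obtain U where U: "openin T U" "y \<in> U" "y' \<notin> U" using t1 y T(3) unfolding t1_space_def by metis
      then obtain W where W: "W \<in> \<B>" "y \<in> W" "W \<subseteq> U" using \<B>(3) by meson
      then obtain i where "V i = W" using from_nat_into_surj[of "insert {} \<B>" W] \<B>(1) by (auto simp: V_def)
      then show False using spec[OF same, of i] W U by auto
    qed
  qed
qed

lemma (in prob_space) prob_compl_incseq_tendsto: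
  assumes A: "\<And>m::nat. A m \<in> sets M" and inc: "incseq A" and ae: "AE x in M. \<exists>m. x \<in> A m"
  shows "(\<lambda>m. prob (space M - A m)) \<longlonglongrightarrow> 0"
proof -
  have "(\<lambda>m. prob (A m)) \<longlonglongrightarrow> prob (\<Union>m. A m)"
    by (rule finite_Lim_measure_incseq) (use A inc in auto)
  moreover have "prob (\<Union>m. A m) = 1"
    using ae A by (subst prob_eq_1) auto
  ultimately have "(\<lambda>m. 1 - prob (A m)) \<longlonglongrightarrow> 1 - 1" by (intro tendsto_diff tendsto_const) simp
  then show ?thesis using A by (simp add: prob_compl)
qed

context diagonal_pmp
begin

lemma orbit_relation_act:
  assumes g: "g \<in> carrier G" and x: "x \<in> space M" shows "(x, T g x) \<in> orbit_relation G M T"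
proof -
  have "orbit G T x = orbit G T (T g x)"
  proof (intro subset_antisym subsetI)
    fix y assume "y \<in> orbit G T x"
    then obtain h where h: "h \<in> carrier G" "y = T h x" by (auto simp: orbit_def)
    then have "y = T (h \<otimes> inv g) (T g x)"
      using g x by (simp add: MT.act_mult T_space MT.act_inv_left)
    then show "y \<in> orbit G T (T g x)" using h g by (auto simp: orbit_def)
  next
    fix y assume "y \<in> orbit G T (T g x)"
    then obtain h where h: "h \<in> carrier G" "y = T h (T g x)" by (auto simp: orbit_def)
    then have "y = T (h \<otimes> g) x" using g x by (simp add: MT.act_mult)
    then show "y \<in> orbit G T x" using h g by (auto simp: orbit_def)
  qed
  then show ?thesis using x T_space[OF g x] by (simp add: orbit_relation_def)
qed

lemma orbit_relation_acts:
  assumes "g \<in> carrier G" "h \<in> carrier G" "x \<in> space M"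
  shows "(T g x, T h x) \<in> orbit_relation G M T"
  using orbit_relation_act[OF assms(1,3)] orbit_relation_act[OF assms(2,3)] by (auto simp: orbit_relation_def)

end

text \<open>The relation on \<open>N\<close> is present only through its finite subrelations
  \<open>E m\<close> and the assumption \<open>exhaust\<close>; \<open>e\<close> enumerates the
  group, \<open>V\<close> the labels.\<close>

locale hyperfinite_quotient = diagonal_pmp G X a
  for G :: "('g, 'r) monoid_scheme" (structure) and X :: "nat \<Rightarrow> 'a measure" and a +
  fixes N :: "'y measure" and \<pi> :: "(nat \<Rightarrow> 'a) \<Rightarrow> 'y" and E :: "nat \<Rightarrow> ('y \<times> 'y) set"
    and V :: "nat \<Rightarrow> 'y set" and e :: "nat \<Rightarrow> 'g"
  assumes \<pi>_measurable [measurable]: "\<pi> \<in> M \<rightarrow>\<^sub>M N"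
    and E_equiv: "equiv (space N) (E m)" and E_sets: "E m \<in> sets (N \<Otimes>\<^sub>M N)"
    and E_finite: "y \<in> space N \<Longrightarrow> finite (E m `` {y})" and E_mono: "E m \<subseteq> E (Suc m)"
    and V_sets [measurable]: "V i \<in> sets N"
    and V_sep: "y \<in> space N \<Longrightarrow> y' \<in> space N \<Longrightarrow> (\<And>i. y \<in> V i \<longleftrightarrow> y' \<in> V i) \<Longrightarrow> y = y'"
    and e_carrier: "e i \<in> carrier G" and e_surj: "g \<in> carrier G \<Longrightarrow> \<exists>i. e i = g"
    and exhaust: "AE x in M. \<forall>g\<in>carrier G. \<exists>m. (\<pi> (T g x), \<pi> x) \<in> E m"
begin

text \<open>Where \<open>g\<close> stays inside the extension of the kernel relation by
  \<open>E m\<close>.\<close>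

definition D :: "nat \<Rightarrow> 'g \<Rightarrow> (nat \<Rightarrow> 'a) set" where
  "D m g = {x \<in> space M. (\<pi> (T g x), \<pi> x) \<in> E m}"

text \<open>The set where the first \<open>p\<close> labels separate the classes of \<open>\<pi>\<close> within one extended class. It
  is defined through the countable group rather than through the classes of \<open>E m\<close>, which makes its
  measurability evident.\<close>

definition U :: "nat \<Rightarrow> nat \<Rightarrow> (nat \<Rightarrow> 'a) set" where
  "U m p = {x \<in> space M. \<forall>i j. x \<in> D m (e i) \<longrightarrow> x \<in> D m (e j) \<longrightarrow>
     (\<forall>r<p. \<pi> (T (e i) x) \<in> V r \<longleftrightarrow> \<pi> (T (e j) x) \<in> V r) \<longrightarrow>
     (\<forall>r. \<pi> (T (e i) x) \<in> V r \<longleftrightarrow> \<pi> (T (e j) x) \<in> V r)}"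

definition B :: "nat \<Rightarrow> nat set \<Rightarrow> (nat \<Rightarrow> 'a) set" where
  "B p j = {x \<in> space M. {i\<in>{..<p}. \<pi> x \<in> V i} = j}"

lemma \<pi>_space: "x \<in> space M \<Longrightarrow> \<pi> x \<in> space N"
  using measurable_space[OF \<pi>_measurable] .

lemma E_sym: "(x, y) \<in> E m \<Longrightarrow> (y, x) \<in> E m"
  using E_equiv[of m] by (auto simp: equiv_def dest: symD)

lemma E_trans: "(x, y) \<in> E m \<Longrightarrow> (y, z) \<in> E m \<Longrightarrow> (x, z) \<in> E m"
  using E_equiv[of m] by (auto simp: equiv_def dest: transD)

lemma E_refl: "y \<in> space N \<Longrightarrow> (y, y) \<in> E m"
  using E_equiv[of m] by (auto simp: equiv_def dest: refl_onD)

lemma D_sets: assumes g: "g \<in> carrier G" shows "D m g \<in> sets M"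
proof -
  note [measurable] = T_measurable[OF g]
  have "(\<lambda>x. (\<pi> (T g x), \<pi> x)) \<in> M \<rightarrow>\<^sub>M N \<Otimes>\<^sub>M N" by measurable
  from measurable_sets[OF this E_sets[of m]] show ?thesis
    by (simp add: D_def vimage_def Int_def conj_commute)
qed

lemma D_inv: "g \<in> carrier G \<Longrightarrow> x \<in> space M \<Longrightarrow> T g x \<in> D m (inv g) \<longleftrightarrow> x \<in> D m g"
  using E_sym by (auto simp: D_def MT.act_inv_left T_space)

lemma D_tendsto:
  assumes g: "g \<in> carrier G" shows "(\<lambda>m. PM.prob (space M - D m g)) \<longlonglongrightarrow> 0"
proof (rule PM.prob_compl_incseq_tendsto)
  show "D m g \<in> sets M" for m by (rule D_sets[OF g])
  show "incseq (\<lambda>m. D m g)" unfolding incseq_Suc_iff D_def using E_mono by auto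
  show "AE x in M. \<exists>m. x \<in> D m g" using exhaust AE_space
    by eventually_elim (use g in \<open>auto simp: D_def\<close>)
qed

lemma U_sets: "U m p \<in> sets M"
proof -
  note [measurable] = T_measurable[OF e_carrier] D_sets[OF e_carrier]
  show ?thesis unfolding U_def by measurable
qed

text \<open>This is where finiteness of the classes of \<open>E m\<close> enters: finitely many
  points of the quotient are separated by finitely many labels.\<close>

lemma U_tendsto: "(\<lambda>p. PM.prob (space M - U m p)) \<longlonglongrightarrow> 0"
proof (rule PM.prob_compl_incseq_tendsto[OF U_sets])
  show "incseq (U m)"
    unfolding incseq_Suc_iff U_def by (auto simp: less_Suc_eq)
  show "AE x in M. \<exists>p. x \<in> U m p"
  proof (rule AE_I2)
    fix x assume x: "x \<in> space M"
    define F where "F = E m `` {\<pi> x}"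
    have F: "finite F" unfolding F_def by (rule E_finite[OF \<pi>_space[OF x]])
    define s where "s y y' = (SOME s. (y \<in> V s) \<noteq> (y' \<in> V s))" for y y'
    have s: "(y \<in> V (s y y')) \<noteq> (y' \<in> V (s y y'))" if "(y \<in> V i) \<noteq> (y' \<in> V i)" for y y' i
      unfolding s_def by (rule someI[of _ i]) (rule that)
    have fin: "finite ((\<lambda>(y, y'). s y y') ` (F \<times> F))" using F by auto
    then obtain p where p: "\<forall>r\<in>(\<lambda>(y, y'). s y y') ` (F \<times> F). r < p"
      unfolding finite_nat_set_iff_bounded by blast
    have "x \<in> U m p"
      unfolding U_def
    proof (intro CollectI conjI x allI impI)
      fix i j r
      assume i: "x \<in> D m (e i)" and j: "x \<in> D m (e j)"
        and same: "\<forall>r<p. \<pi> (T (e i) x) \<in> V r \<longleftrightarrow> \<pi> (T (e j) x) \<in> V r"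
      have "\<pi> (T (e i) x) \<in> F" "\<pi> (T (e j) x) \<in> F" using i j E_sym by (auto simp: F_def D_def)
      then have "s (\<pi> (T (e i) x)) (\<pi> (T (e j) x)) < p" using p by auto
      then show "\<pi> (T (e i) x) \<in> V r \<longleftrightarrow> \<pi> (T (e j) x) \<in> V r" using s same by blast
    qed
    then show "\<exists>p. x \<in> U m p" ..
  qed
qed

lemma B_sets: assumes "j \<in> Pow {..<p}" shows "B p j \<in> sets M"
proof -
  have "B p j = {x \<in> space M. \<forall>i<p. \<pi> x \<in> V i \<longleftrightarrow> i \<in> j}" using assms by (auto simp: B_def)
  also have "\<dots> \<in> sets M" by measurable
  finally show ?thesis .
qed

lemma B_partition: "x \<in> space M \<Longrightarrow> (\<Sum>j\<in>Pow {..<p}. indicator (B p j) x :: real) = 1"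
proof -
  assume "x \<in> space M"
  then have "(\<Sum>j\<in>Pow {..<p}. indicator (B p j) x :: real) = (\<Sum>j\<in>Pow {..<p}. if {i\<in>{..<p}. \<pi> x \<in> V i} = j then 1 else 0)"
    by (intro sum.cong) (auto simp: B_def indicator_def)
  then show ?thesis by (simp add: sum.delta', auto)
qed

text \<open>The error terms vanish as first \<open>p\<close>, then \<open>m\<close> tends to
  infinity. The order is forced: how many labels are required depends on the size of the classes of
  \<open>E m\<close>.\<close>

proposition quotient_inequality:
  fixes n :: nat and f :: "nat \<Rightarrow> 'a \<Rightarrow> real"
  assumes K: "finite K" "K \<subseteq> carrier G" "\<one> \<in> K" "\<And>g. g \<in> K \<Longrightarrow> inv g \<in> K" and C: "0 \<le> C"
    and gap: "\<And>f. bdd_meas M f \<Longrightarrow>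
      sqn M f \<le> C * (\<Sum>g\<in>K. sqn M (\<lambda>x. f (T g x) - f x)) + 2 * sqn M (coord_mean n f)"
    and u: "\<And>k. u k \<in> borel_measurable M" "\<And>k x. x \<in> space M \<Longrightarrow> \<bar>u k x\<bar> \<le> 1"
    and u_inv: "\<And>k x y. (x, y) \<in> orbit_relation G M T \<Longrightarrow> \<pi> x = \<pi> y \<Longrightarrow> u k x = u k y"
    and f: "\<And>k. f k \<in> borel_measurable (X n)" "\<And>k x. x \<in> space (X n) \<Longrightarrow> \<bar>f k x\<bar> \<le> 1"
    and weak: "\<And>h. bdd_meas (X n) h \<Longrightarrow> (\<lambda>k. \<integral>x. f k x * h x \<partial>X n) \<longlonglongrightarrow> 0"
    and close: "\<And>k. sqn M (\<lambda>x. f k (x n) - u k x) \<le> \<epsilon>" and c: "\<And>k. c \<le> sqn (X n) (f k)"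
  shows "c \<le> 10 * \<epsilon>"
proof -
  have KG: "g \<in> carrier G" if "g \<in> K" for g using that K by auto
  \<comment> \<open>The complement of \<open>U m p\<close> is counted once by itself and once more,
    with weight \<open>4 * C\<close>, for each element of \<open>K\<close>.\<close>
  have bound: "c / 2 - 5 * \<epsilon> \<le> (1 + 4 * C * card K) * PM.prob (space M - U m p) + 4 * C * (\<Sum>g\<in>K. PM.prob (space M - D m g))" for m p
  proof -
    interpret EA: extension_averaging G X a n K C "D m"
      by unfold_locales (use K C gap D_sets KG D_inv in auto)
    have const: "EA.constant_on_classes (U m p) (B p j) (u k)" for j k
      unfolding EA.constant_on_classes_def
    proof
      fix x assume xU: "x \<in> U m p"
      then have x: "x \<in> space M" by (simp add: U_def)
      \<comment> \<open>The extended class of \<open>x\<close>: the part of its orbit lying over the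
        \<open>E m\<close>-class of \<open>\<pi> x\<close>.\<close>
      define A where "A = {y. \<exists>g\<in>carrier G. y = T g x \<and> (\<pi> y, \<pi> x) \<in> E m}"
      have AM: "y \<in> space M" if "y \<in> A" for y using that T_space x by (auto simp: A_def)
      have xA: "x \<in> A" using MT.act_one[OF x] E_refl[OF \<pi>_space[OF x]] by (auto simp: A_def intro!: bexI[of _ \<one>])
      have closed: "EA.closed_under_\<tau> A"
        unfolding EA.closed_under_\<tau>_def
      proof (intro ballI)
        fix h y assume h: "h \<in> K" and y: "y \<in> A"
        then obtain g where g: "g \<in> carrier G" "y = T g x" "(\<pi> y, \<pi> x) \<in> E m" by (auto simp: A_def)
        have "T h y \<in> A" if "y \<in> D m h"
        proof -
          have "T h y = T (h \<otimes> g) x" using g KG[OF h] x by (simp add: MT.act_mult)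
          moreover have "(\<pi> (T h y), \<pi> x) \<in> E m" using that g(3) E_trans by (auto simp: D_def)
          ultimately show ?thesis using g(1) KG[OF h] by (auto simp: A_def)
        qed
        then show "EA.\<tau> h y \<in> A" using y by simp
      qed
      \<comment> \<open>Equal first \<open>p\<close> labels force equal images under
        \<open>\<pi>\<close> because \<open>x\<close> lies in \<open>U m p\<close>; then
        \<open>y\<close> and \<open>y'\<close> are related by the kernel relation.\<close>
      have eq: "u k y = u k y'" if y: "y \<in> A" "y \<in> B p j" and y': "y' \<in> A" "y' \<in> B p j" for y y'
      proof -
        obtain g where g: "g \<in> carrier G" "y = T g x" "(\<pi> y, \<pi> x) \<in> E m" using y by (auto simp: A_def)
        obtain h where h: "h \<in> carrier G" "y' = T h x" "(\<pi> y', \<pi> x) \<in> E m" using y' by (auto simp: A_def)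
        obtain i where i: "e i = g" using e_surj[OF g(1)] by auto
        obtain i' where i': "e i' = h" using e_surj[OF h(1)] by auto
        have D: "x \<in> D m (e i)" "x \<in> D m (e i')" using g h i i' x by (auto simp: D_def)
        have "\<pi> y \<in> V r \<longleftrightarrow> \<pi> y' \<in> V r" if "r < p" for r using y(2) y'(2) that by (auto simp: B_def)
        then have "\<pi> y \<in> V r \<longleftrightarrow> \<pi> y' \<in> V r" for r
          using xU D g(2) h(2) i i' unfolding U_def by blast
        then have "\<pi> y = \<pi> y'" using V_sep[OF \<pi>_space[OF AM[OF y(1)]] \<pi>_space[OF AM[OF y'(1)]]] by simp
        then show ?thesis using u_inv orbit_relation_acts[OF g(1) h(1) x] g(2) h(2) by blast
      qed
      show "\<exists>A c. x \<in> A \<and> EA.closed_under_\<tau> A \<and> \<bar>c\<bar> \<le> 1 \<and> (\<forall>y\<in>A. y \<in> B p j \<longrightarrow> u k y = c)"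
      proof (cases "\<exists>y\<in>A. y \<in> B p j")
        case True
        then obtain y where y: "y \<in> A" "y \<in> B p j" by auto
        have "\<bar>u k y\<bar> \<le> 1" by (rule u(2)[OF AM[OF y(1)]])
        then show ?thesis using xA closed eq y by (intro exI[of _ A] exI[of _ "u k y"] conjI) blast+
      next
        case False
        then show ?thesis using xA closed by (intro exI[of _ A] exI[of _ "0::real"] conjI) auto
      qed
    qed
    have "c / 2 - 5 * \<epsilon> \<le> PM.prob (space M - U m p) + C * (\<Sum>g\<in>K. 4 * PM.prob (space M - (U m p \<inter> D m g)))"
      by (rule EA.limit_inequality[OF _ B_sets B_partition U_sets const u f weak close c]) auto
    also have "\<dots> \<le> PM.prob (space M - U m p) + C * (\<Sum>g\<in>K. 4 * (PM.prob (space M - U m p) + PM.prob (space M - D m g)))"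
    proof (intro add_left_mono mult_left_mono sum_mono C)
      fix g assume g: "g \<in> K"
      have "space M - (U m p \<inter> D m g) = (space M - U m p) \<union> (space M - D m g)" by auto
      then show "PM.prob (space M - (U m p \<inter> D m g)) \<le> PM.prob (space M - U m p) + PM.prob (space M - D m g)"
        using measure_Un_le[of "space M - U m p" M "space M - D m g"] U_sets D_sets[OF KG[OF g]] by auto
    qed simp
    also have "\<dots> = (1 + 4 * C * card K) * PM.prob (space M - U m p) + 4 * C * (\<Sum>g\<in>K. PM.prob (space M - D m g))"
      by (simp add: sum.distrib algebra_simps sum_distrib_left)
    finally show ?thesis .
  qed
  have bound2: "c / 2 - 5 * \<epsilon> \<le> 4 * C * (\<Sum>g\<in>K. PM.prob (space M - D m g))" for m
  proof -
    have "(\<lambda>p. (1 + 4 * C * card K) * PM.prob (space M - U m p) + 4 * C * (\<Sum>g\<in>K. PM.prob (space M - D m g)))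
      \<longlonglongrightarrow> (1 + 4 * C * card K) * 0 + 4 * C * (\<Sum>g\<in>K. PM.prob (space M - D m g))"
      by (intro tendsto_add tendsto_mult tendsto_const U_tendsto)
    then show ?thesis using bound[of m] by (intro LIMSEQ_le_const[of _ "4 * C * (\<Sum>g\<in>K. PM.prob (space M - D m g))"]) auto
  qed
  have "(\<lambda>m. 4 * C * (\<Sum>g\<in>K. PM.prob (space M - D m g))) \<longlonglongrightarrow> 4 * C * (\<Sum>g\<in>K. 0)"
    by (intro tendsto_mult tendsto_const tendsto_sum D_tendsto KG)
  then have "c / 2 - 5 * \<epsilon> \<le> 4 * C * (\<Sum>g\<in>K. 0)" by (rule LIMSEQ_le_const) (use bound2 in auto)
  then show ?thesis by simp
qed

end

section \<open>From complex functions to clamped real parts, and the contradiction\<close>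

section \<open>Reduction to real functions and conclusion\<close>

text \<open>One of the real and imaginary parts carries half of the squared norm. Clamping to the
  interval from -1 to 1 turns the almost sure bound into one at every point and does not increase
  distances, so weak convergence and almost invariance carry over to the same
  \<open>f\<close>.\<close>

lemma (in prob_space) clamped_real_part:
  fixes F :: "'a \<Rightarrow> complex"
  assumes F [measurable]: "F \<in> borel_measurable M" and bd: "AE x in M. cmod (F x) \<le> 1"
    and c: "0 \<le> c" "c \<le> L2_norm M F"
  shows "\<exists>f. f \<in> borel_measurable M \<and> (\<forall>x. \<bar>f x\<bar> \<le> 1) \<and> c\<^sup>2 / 2 \<le> sqn M f \<and>
    (\<forall>x y. \<bar>f x - f y\<bar> \<le> cmod (F x - F y)) \<and>
    (\<forall>h. bdd_meas M h \<longrightarrow> \<bar>\<integral>x. f x * h x \<partial>M\<bar> \<le> cmod (L2_inner M F (\<lambda>x. complex_of_real (h x))))"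
proof -
  define clamp :: "real \<Rightarrow> real" where "clamp t = max (-1) (min 1 t)" for t
  have clamp: "\<bar>clamp s\<bar> \<le> 1" "\<bar>clamp s - clamp t\<bar> \<le> \<bar>s - t\<bar>" "\<bar>s\<bar> \<le> 1 \<Longrightarrow> clamp s = s" for s t
    by (auto simp: clamp_def max_def min_def)
  define p q where "p x = clamp (Re (F x))" and "q x = clamp (Im (F x))" for x
  have [measurable]: "p \<in> borel_measurable M" "q \<in> borel_measurable M"
    unfolding p_def q_def clamp_def by measurable
  have pb: "bdd_meas M p" and qb: "bdd_meas M q"
    by (rule bdd_measI[of _ _ 1]; simp add: p_def q_def clamp)+
  have pF: "AE x in M. p x = Re (F x)" and qF: "AE x in M. q x = Im (F x)"
    using bd by (eventually_elim; simp add: p_def q_def clamp(3) order_trans[OF abs_Re_le_cmod] order_trans[OF abs_Im_le_cmod])+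
  have "(L2_norm M F)\<^sup>2 = (\<integral>x. (cmod (F x))\<^sup>2 \<partial>M)" by (simp add: L2_norm_def)
  also have "\<dots> = (\<integral>x. (p x)\<^sup>2 + (q x)\<^sup>2 \<partial>M)"
    by (rule integral_cong_AE) (use pF qF in \<open>auto simp: cmod_power2 elim: AE_mp\<close>)
  also have "\<dots> = sqn M p + sqn M q" unfolding sqn_def
    by (intro Bochner_Integration.integral_add integrable_bdd_meas bdd_meas_power2 pb qb)
  finally have "c\<^sup>2 \<le> sqn M p + sqn M q" using c power_mono[OF c(2,1), of 2] by simp
  then have or: "c\<^sup>2 / 2 \<le> sqn M p \<or> c\<^sup>2 / 2 \<le> sqn M q" by linarith
  have int: "integrable M (\<lambda>x. F x * complex_of_real (h x))" if h: "bdd_meas M h" for h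
  proof -
    obtain B where B: "0 \<le> B" "\<And>x. x \<in> space M \<Longrightarrow> \<bar>h x\<bar> \<le> B" using bdd_measE[OF h] by metis
    have [measurable]: "h \<in> borel_measurable M" using h by auto
    show ?thesis
    proof (rule integrable_const_bound[of _ B])
      show "AE x in M. cmod (F x * complex_of_real (h x)) \<le> B"
        using bd AE_space
      proof eventually_elim
        case (elim x)
        then have "cmod (F x) * \<bar>h x\<bar> \<le> 1 * B" using B by (intro mult_mono) auto
        then show ?case by (simp add: norm_mult)
      qed
    qed measurable
  qed
  have inner: "L2_inner M F (\<lambda>x. complex_of_real (h x)) = (\<integral>x. F x * complex_of_real (h x) \<partial>M)" for h
    by (simp add: L2_inner_def)
  have ph: "\<bar>\<integral>x. p x * h x \<partial>M\<bar> \<le> cmod (L2_inner M F (\<lambda>x. complex_of_real (h x)))" if h: "bdd_meas M h" for h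
  proof -
    note [measurable] = bdd_meas_measurable[OF h]
    have "(\<integral>x. p x * h x \<partial>M) = (\<integral>x. Re (F x * complex_of_real (h x)) \<partial>M)"
      by (rule integral_cong_AE) (use pF in \<open>auto elim: AE_mp\<close>)
    also have "\<dots> = Re (\<integral>x. F x * complex_of_real (h x) \<partial>M)" by (rule integral_Re[OF int[OF h]])
    finally show ?thesis using abs_Re_le_cmod by (simp add: inner)
  qed
  have qh: "\<bar>\<integral>x. q x * h x \<partial>M\<bar> \<le> cmod (L2_inner M F (\<lambda>x. complex_of_real (h x)))" if h: "bdd_meas M h" for h
  proof -
    note [measurable] = bdd_meas_measurable[OF h]
    have "(\<integral>x. q x * h x \<partial>M) = (\<integral>x. Im (F x * complex_of_real (h x)) \<partial>M)"
      by (rule integral_cong_AE) (use qF in \<open>auto elim: AE_mp\<close>)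
    also have "\<dots> = Im (\<integral>x. F x * complex_of_real (h x) \<partial>M)" by (rule integral_Im[OF int[OF h]])
    finally show ?thesis using abs_Im_le_cmod by (simp add: inner)
  qed
  have pd: "\<bar>p x - p y\<bar> \<le> cmod (F x - F y)" and qd: "\<bar>q x - q y\<bar> \<le> cmod (F x - F y)" for x y
    using clamp(2)[of "Re (F x)" "Re (F y)"] clamp(2)[of "Im (F x)" "Im (F y)"]
      abs_Re_le_cmod[of "F x - F y"] abs_Im_le_cmod[of "F x - F y"] by (auto simp: p_def q_def)
  show ?thesis
    using or
  proof
    assume "c\<^sup>2 / 2 \<le> sqn M p"
    then show ?thesis using ph pd clamp(1) by (intro exI[of _ p]) (auto simp: p_def[symmetric], auto simp: p_def clamp)
  next
    assume "c\<^sup>2 / 2 \<le> sqn M q"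
    then show ?thesis using qh qd clamp(1) by (intro exI[of _ q]) (auto simp: q_def[symmetric], auto simp: q_def clamp)
  qed
qed

text \<open>Without integrability the integral is 0 by convention, so the bound holds
  trivially.\<close>

lemma (in prob_space) L2_norm_le:
  assumes "AE x in M. cmod (F x) \<le> B" "0 \<le> B" shows "L2_norm M F \<le> B"
proof (cases "integrable M (\<lambda>x. (cmod (F x))\<^sup>2)")
  case True
  have "(\<integral>x. (cmod (F x))\<^sup>2 \<partial>M) \<le> (\<integral>x. B\<^sup>2 \<partial>M)"
    by (rule integral_mono_AE[OF True]) (use assms in \<open>auto elim!: eventually_mono intro: power_mono\<close>)
  then show ?thesis using assms(2) by (simp add: L2_norm_def prob_space real_le_lsqrt)
next
  case False
  then show ?thesis using assms(2) by (simp add: L2_norm_def not_integrable_integral_eq)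
qed

text \<open>The bound by 2 ensures that the suprema over \<open>k\<close> in the almost invariance
  hypothesis are taken over bounded families, so that each member lies below its supremum.\<close>

lemma (in mp_action) sqn_defect_le_L2_norm:
  fixes F :: "'a \<Rightarrow> complex"
  assumes F [measurable]: "F \<in> borel_measurable M" and bd: "AE x in M. cmod (F x) \<le> 1"
    and f: "f \<in> borel_measurable M" "\<And>x. \<bar>f x\<bar> \<le> 1"
    and le: "\<And>x y. \<bar>f x - f y\<bar> \<le> cmod (F x - F y)" and g: "g \<in> carrier G"
  shows "sqn M (\<lambda>x. f (b g x) - f x) \<le> (L2_norm M (\<lambda>x. F (b g x) - F x))\<^sup>2"
    and "L2_norm M (\<lambda>x. F (b g x) - F x) \<le> 2"
proof -
  note [measurable] = act_measurable[OF g] f(1)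
  have bd2: "AE x in M. cmod (F (b g x) - F x) \<le> 2"
    using bd AE_act[OF bd g]
  proof eventually_elim
    case (elim x)
    then show ?case using norm_triangle_ineq4[of "F (b g x)" "F x"] by linarith
  qed
  have fb: "bdd_meas M f" by (rule bdd_measI[OF f])
  have "sqn M (\<lambda>x. f (b g x) - f x) \<le> (\<integral>x. (cmod (F (b g x) - F x))\<^sup>2 \<partial>M)"
    unfolding sqn_def
  proof (rule integral_mono)
    show "integrable M (\<lambda>x. (f (b g x) - f x)\<^sup>2)"
      by (intro integrable_bdd_meas bdd_meas_power2 bdd_meas_diff fb bdd_meas_comp[OF fb act_measurable[OF g]])
    show "integrable M (\<lambda>x. (cmod (F (b g x) - F x))\<^sup>2)"
    proof (rule integrable_const_bound[of _ "2\<^sup>2"])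
      show "AE x in M. norm ((cmod (F (b g x) - F x))\<^sup>2) \<le> 2\<^sup>2"
        using bd2
      proof eventually_elim
        case (elim x)
        then show ?case using power_mono[OF elim norm_ge_zero, of 2] by simp
      qed
    qed measurable
    show "(f (b g x) - f x)\<^sup>2 \<le> (cmod (F (b g x) - F x))\<^sup>2" for x
      using le[of "b g x" x] by (metis abs_ge_zero power2_abs power_mono)
  qed
  then show "sqn M (\<lambda>x. f (b g x) - f x) \<le> (L2_norm M (\<lambda>x. F (b g x) - F x))\<^sup>2" by (simp add: L2_norm_def)
  show "L2_norm M (\<lambda>x. F (b g x) - F x) \<le> 2" by (rule L2_norm_le[OF bd2]) simp
qed

theorem theorem6:
  fixes G :: "('g, 'r) monoid_scheme"
    and X :: "nat \<Rightarrow> 'a measure"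
    and a :: "nat \<Rightarrow> 'g \<Rightarrow> 'a \<Rightarrow> 'a"
    and F :: "nat \<Rightarrow> nat \<Rightarrow> 'a \<Rightarrow> complex"
  assumes "group G" and "countable (carrier G)"
    and "\<And>n. pmp_action G (X n) (a n)"
    and "\<And>n. free_action G (X n) (a n)"
    and "\<And>n. ergodic_action G (X n) (a n)"
    and "\<And>n. spectral_gap G (X n \<Otimes>\<^sub>M X n) (diagonal_square_action (X n) (a n))"
    and "\<And>n k. F n k \<in> Linf (X n)"
    and "(SUP (n, k). Linf_norm (X n) (F n k)) \<le> 1"
    and "(INF (n, k). L2_norm (X n) (F n k)) > 0"
    and "\<And>n. L2_weakly_tendsto (X n) (F n) (\<lambda>_. 0)"
    and "\<And>g. g \<in> carrier G \<Longrightarrow>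
           (\<lambda>n. SUP k. L2_norm (X n) (\<lambda>x. F n k (a n g x) - F n k x)) \<longlonglongrightarrow> 0"
  shows "\<not> jones_schmidt TYPE('y) (\<Pi>\<^sub>M n\<in>UNIV. X n)
             (orbit_relation G (\<Pi>\<^sub>M n\<in>UNIV. X n) (diagonal_action X a))"
proof
  let ?M = "\<Pi>\<^sub>M n\<in>UNIV. X n" and ?T = "diagonal_action X a"
  let ?S = "orbit_relation G ?M ?T"
  assume "jones_schmidt TYPE('y) ?M ?S"
  then obtain N :: "'y measure" and R \<pi> where N: "countable_pmp_eqrel N R" "hyperfinite_eqrel N R"
    and \<pi>: "measure_preserving_map ?M N \<pi>" and \<pi>S: "AE x in ?M. \<pi> ` (?S `` {x}) = R `` {\<pi> x}"
    and comp: "strongly_ergodic_on_components ?M {(x, y) \<in> ?S. \<pi> x = \<pi> y}"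
    unfolding jones_schmidt_def by blast
  interpret group G by fact
  interpret diagonal_pmp G X a
    by (intro diagonal_pmp.intro diagonal_pmp_axioms.intro pmp_action_mp_action[OF assms(3)]) (rule assms(1))
  define S0 where "S0 = {(x, y) \<in> ?S. \<pi> x = \<pi> y}"
  obtain \<kappa> where \<kappa>: "ergodic_decomposition ?M S0 \<kappa>" "AE x in ?M. strongly_ergodic (\<kappa> x) S0"
    using comp unfolding strongly_ergodic_on_components_def S0_def by blast
  interpret Dc: decomposed ?M S0 \<kappa> by unfold_locales (rule \<kappa>(1))
  obtain E where E': "\<forall>m. equiv (space N) (E m) \<and> E m \<in> sets (N \<Otimes>\<^sub>M N) \<and> E m \<subseteq> R \<and>
      E m \<subseteq> E (Suc m) \<and> (\<forall>x\<in>space N. finite (E m `` {x}))"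
    and ER: "AE y in N. R `` {y} = (\<Union>m. E m `` {y})"
    using N(2) unfolding hyperfinite_eqrel_def by (elim exE conjE)
  have E: "equiv (space N) (E m)" "E m \<in> sets (N \<Otimes>\<^sub>M N)" "E m \<subseteq> E (Suc m)"
    "y \<in> space N \<Longrightarrow> finite (E m `` {y})" for m y
    using E'[rule_format, of m] by blast+
  have "standard_borel N" using N(1) by (simp add: countable_pmp_eqrel_def standard_prob_space_def)
  from standard_borel_separating[OF this] obtain V :: "nat \<Rightarrow> 'y set" where V: "\<forall>i. V i \<in> sets N"
    "\<forall>y\<in>space N. \<forall>y'\<in>space N. (\<forall>i. y \<in> V i \<longleftrightarrow> y' \<in> V i) \<longrightarrow> y = y'" by (elim exE conjE)
  define e where "e = from_nat_into (carrier G)"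
  have e: "e i \<in> carrier G" for i unfolding e_def by (rule from_nat_into) auto
  have e_surj: "\<exists>i. e i = g" if "g \<in> carrier G" for g
    using from_nat_into_surj[OF assms(2) that] by (simp add: e_def)
  have \<pi>m: "\<pi> \<in> ?M \<rightarrow>\<^sub>M N" and \<pi>d: "distr ?M N \<pi> = N" using \<pi> by (auto simp: measure_preserving_map_def)
  have act_S: "(x, ?T g x) \<in> ?S" if g: "g \<in> carrier G" and x: "x \<in> space ?M" for g x
    by (rule orbit_relation_act[OF g x])
  have exhaust: "AE x in ?M. \<forall>g\<in>carrier G. \<exists>m. (\<pi> (?T g x), \<pi> x) \<in> E m"
  proof -
    have "AE y in distr ?M N \<pi>. R `` {y} = (\<Union>m. E m `` {y})" using ER by (simp only: \<pi>d)
    then have "AE x in ?M. R `` {\<pi> x} = (\<Union>m. E m `` {\<pi> x})" by (rule AE_distrD[OF \<pi>m])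
    then show ?thesis using \<pi>S AE_space
    proof eventually_elim
      case (elim x)
      show ?case
      proof
        fix g assume g: "g \<in> carrier G"
        have "\<pi> (?T g x) \<in> \<pi> ` (?S `` {x})" using act_S[OF g elim(3)] by auto
        then obtain m where "(\<pi> x, \<pi> (?T g x)) \<in> E m" using elim(1,2) by auto
        then show "\<exists>m. (\<pi> (?T g x), \<pi> x) \<in> E m" using E(1)[of m] by (auto simp: equiv_def dest: symD)
      qed
    qed
  qed
  interpret HQ: hyperfinite_quotient G X a N \<pi> E V e
    by unfold_locales (use \<pi>m E V e e_surj exhaust in auto)
  have Fm: "F n k \<in> borel_measurable (X n)" for n k using assms(7) by (simp add: Linf_def)
  have F1: "AE x in X n. cmod (F n k x) \<le> 1" for n k
  proof -
    have le: "Linf_norm (X n) (F n k) \<le> 1"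
      using assms(8) by (rule order_trans[rotated]) (rule SUP_upper2[where i = "(n, k)"], auto)
    have "AE x in X n. ereal (cmod (F n k x)) \<le> Linf_norm (X n) (F n k)"
      unfolding Linf_norm_def by (rule esssup_AE)
    then show ?thesis
    proof eventually_elim
      case (elim x)
      show ?case using order_trans[OF elim le] by (simp add: one_ereal_def)
    qed
  qed
  define c where "c = (INF (n, k). L2_norm (X n) (F n k))"
  have c0: "c > 0" using assms(9) by (simp add: c_def)
  have c_le: "c \<le> L2_norm (X n) (F n k)" for n k
    unfolding c_def by (rule cINF_lower2[where x = "(n, k)"]) (auto intro!: bdd_belowI2[of _ 0] simp: L2_norm_def)
  define good where "good n k f \<longleftrightarrow> f \<in> borel_measurable (X n) \<and> (\<forall>x. \<bar>f x\<bar> \<le> 1) \<and> c\<^sup>2 / 2 \<le> sqn (X n) f \<and>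
    (\<forall>x y. \<bar>f x - f y\<bar> \<le> cmod (F n k x - F n k y)) \<and>
    (\<forall>h. bdd_meas (X n) h \<longrightarrow> \<bar>\<integral>x. f x * h x \<partial>X n\<bar> \<le> cmod (L2_inner (X n) (F n k) (\<lambda>x. complex_of_real (h x))))"
    for n k f
  have "\<exists>f. good n k f" for n k
    unfolding good_def by (rule X.clamped_real_part[OF Fm F1 less_imp_le[OF c0] c_le])
  then have "\<forall>n. \<exists>f. \<forall>k. good n k (f k)" by (intro allI choice)
  from choice[OF this] obtain f where f_good: "\<forall>n k. good n k (f n k)" by (rule exE)
  have f: "f n k \<in> borel_measurable (X n)" "\<bar>f n k x\<bar> \<le> 1"
    "c\<^sup>2 / 2 \<le> sqn (X n) (f n k)" "\<bar>f n k x - f n k y\<bar> \<le> cmod (F n k x - F n k y)"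
    "bdd_meas (X n) h \<Longrightarrow> \<bar>\<integral>x. f n k x * h x \<partial>X n\<bar> \<le> cmod (L2_inner (X n) (F n k) (\<lambda>x. complex_of_real (h x)))"
    for n k x y h
    using f_good[rule_format, of n k, unfolded good_def]
    by (elim conjE; simp)+
  have weak: "(\<lambda>k. \<integral>x. f n k x * h x \<partial>X n) \<longlonglongrightarrow> 0" if h: "bdd_meas (X n) h" for n h
  proof (rule Lim_null_comparison)
    show "\<forall>\<^sub>F k in sequentially. norm (\<integral>x. f n k x * h x \<partial>X n) \<le> cmod (L2_inner (X n) (F n k) (\<lambda>x. complex_of_real (h x)))"
      using f(5)[OF h] by simp
    have "(\<lambda>x. complex_of_real (h x)) \<in> L2 (X n)"
      using h X.integrable_bdd_meas[OF bdd_meas_power2[OF h]] by (auto simp: L2_def)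
    then have "(\<lambda>k. L2_inner (X n) (F n k) (\<lambda>x. complex_of_real (h x))) \<longlonglongrightarrow> L2_inner (X n) (\<lambda>_. 0) (\<lambda>x. complex_of_real (h x))"
      using assms(10)[of n] by (simp add: L2_weakly_tendsto_def)
    then show "(\<lambda>k. cmod (L2_inner (X n) (F n k) (\<lambda>x. complex_of_real (h x)))) \<longlonglongrightarrow> 0"
      by (intro tendsto_norm_zero) (simp add: L2_inner_def)
  qed
  \<comment> \<open>Chosen so that \<open>10 * \<epsilon>\<close> is half of
    \<open>c\<^sup>2 / 2\<close>, the lower bound for the energies of the
    \<open>f n k\<close>.\<close>
  define \<epsilon> where "\<epsilon> = c\<^sup>2 / 40"
  have \<epsilon>: "\<epsilon> > 0" using c0 by (simp add: \<epsilon>_def)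
  have proj: "(\<lambda>x. x n) \<in> ?M \<rightarrow>\<^sub>M X n" for n by (rule measurable_component_singleton) simp
  have fp: "(\<lambda>x. f n k (x n)) \<in> borel_measurable ?M" for n k by (rule measurable_compose[OF proj f(1)])
  have "\<exists>n. \<forall>k. sqn ?M (\<lambda>x. f n k (x n) - Dc.cond_mean (\<lambda>x. f n k (x n)) x) \<le> \<epsilon>"
  proof (rule ccontr)
    assume "\<not> ?thesis"
    then have "\<forall>n. \<exists>k. \<not> sqn ?M (\<lambda>x. f n k (x n) - Dc.cond_mean (\<lambda>x. f n k (x n)) x) \<le> \<epsilon>" by blast
    \<comment> \<open>One bad \<open>k\<close> for each \<open>n\<close>. The sequence is still
      asymptotically invariant, since the hypothesis is uniform in \<open>k\<close>, and this
      contradicts strong ergodicity on the components.\<close>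
    from choice[OF this] obtain s where s: "\<And>n. \<epsilon> < sqn ?M (\<lambda>x. f n (s n) (x n) - Dc.cond_mean (\<lambda>x. f n (s n) (x n)) x)"
      unfolding not_le by blast
    have "\<exists>n. sqn ?M (\<lambda>x. f n (s n) (x n) - Dc.cond_mean (\<lambda>x. f n (s n) (x n)) x) < \<epsilon>"
    proof (rule Dc.sqn_cond_mean_small[OF \<kappa>(2), where h = "\<lambda>i. ?T (e i)"])
      show "?T (e i) \<in> ?M \<rightarrow>\<^sub>M ?M" for i by (rule T_measurable[OF e])
      show "\<exists>i. y = ?T (e i) x" if x: "x \<in> space ?M" and yx: "(y, x) \<in> S0" for x y
      proof -
        have y: "y \<in> space ?M" and "orbit G ?T y = orbit G ?T x" using yx by (auto simp: S0_def orbit_relation_def)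
        moreover have "y \<in> orbit G ?T y" using MT.act_one[OF y] by (auto simp: orbit_def intro!: exI[of _ "\<one>\<^bsub>G\<^esub>"])
        ultimately obtain g where "g \<in> carrier G" "y = ?T g x" by (auto simp: orbit_def)
        then show ?thesis using e_surj by blast
      qed
      show "(\<lambda>x. f n (s n) (x n)) \<in> borel_measurable ?M" for n by (rule fp)
      show "\<bar>f n (s n) (x n)\<bar> \<le> 1" for n and x :: "nat \<Rightarrow> 'a" by (rule f(2))
      show "(\<lambda>n. sqn ?M (\<lambda>x. f n (s n) (?T (e i) x n) - f n (s n) (x n))) \<longlonglongrightarrow> 0" for i
      proof (rule Lim_null_comparison[OF always_eventually])
        let ?L = "\<lambda>n k. L2_norm (X n) (\<lambda>x. F n k (a n (e i) x) - F n k x)"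
        show "(\<lambda>n. (SUP k. ?L n k)\<^sup>2) \<longlonglongrightarrow> 0" using tendsto_power[OF assms(11)[OF e[of i]], of 2] by simp
        show "\<forall>n. norm (sqn ?M (\<lambda>x. f n (s n) (?T (e i) x n) - f n (s n) (x n))) \<le> (SUP k. ?L n k)\<^sup>2"
        proof
          fix n
          have "sqn ?M (\<lambda>x. f n (s n) (?T (e i) x n) - f n (s n) (x n)) = sqn ?M (\<lambda>x. f n (s n) (a n (e i) (x n)) - f n (s n) (x n))"
            by (rule sqn_cong) (simp add: T_eq)
          also have "\<dots> = sqn (X n) (\<lambda>y. f n (s n) (a n (e i) y) - f n (s n) y)"
          proof (rule sqn_distr[OF proj])
            show "distr ?M (X n) (\<lambda>x. x n) = X n" by (rule PX.PiM_component) simp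
            show "(\<lambda>y. f n (s n) (a n (e i) y) - f n (s n) y) \<in> borel_measurable (X n)"
              by (intro borel_measurable_diff f(1) measurable_compose[OF X.act_measurable[OF e] f(1)])
          qed
          also have "\<dots> \<le> (?L n (s n))\<^sup>2" by (rule X.sqn_defect_le_L2_norm(1)[OF Fm F1 f(1,2,4) e])
          also have "\<dots> \<le> (SUP k. ?L n k)\<^sup>2"
          proof (rule power_mono)
            show "?L n (s n) \<le> (SUP k. ?L n k)"
            proof (rule cSUP_upper)
              show "bdd_above (range (?L n))"
                by (rule bdd_aboveI2[of _ _ 2]) (rule X.sqn_defect_le_L2_norm(2)[OF Fm F1 f(1,2,4) e])
            qed simp
          qed (simp add: L2_norm_def)
          finally show "norm (sqn ?M (\<lambda>x. f n (s n) (?T (e i) x n) - f n (s n) (x n))) \<le> (SUP k. ?L n k)\<^sup>2" by simp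
        qed
      qed
    qed (rule \<epsilon>)
    then show False using s by (meson less_asym)
  qed
  then obtain n where n: "\<And>k. sqn ?M (\<lambda>x. f n k (x n) - Dc.cond_mean (\<lambda>x. f n k (x n)) x) \<le> \<epsilon>" by blast
  obtain K C where K: "finite K" "K \<subseteq> carrier G" "\<one>\<^bsub>G\<^esub> \<in> K" "\<And>g. g \<in> K \<Longrightarrow> inv\<^bsub>G\<^esub> g \<in> K" "0 \<le> C"
    "\<And>f. bdd_meas ?M f \<Longrightarrow> sqn ?M f \<le> C * (\<Sum>g\<in>K. sqn ?M (\<lambda>x. f (?T g x) - f x)) + 2 * sqn ?M (coord_mean n f)"
    by (rule sqn_le_defect_coord_mean[OF assms(2,6)]) (rule that; assumption)
  have "c\<^sup>2 / 2 \<le> 10 * \<epsilon>"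
  proof (rule HQ.quotient_inequality[OF K, where f = "f n" and u = "\<lambda>k. Dc.cond_mean (\<lambda>x. f n k (x n))"])
    show "Dc.cond_mean (\<lambda>x. f n k (x n)) \<in> borel_measurable ?M" for k by (rule Dc.cond_mean_measurable[OF fp])
    show "\<bar>Dc.cond_mean (\<lambda>x. f n k (x n)) x\<bar> \<le> 1" if "x \<in> space ?M" for k x
      by (rule Dc.abs_cond_mean_le[OF fp _ that]) (rule f(2))
    show "Dc.cond_mean (\<lambda>x. f n k (x n)) x = Dc.cond_mean (\<lambda>x. f n k (x n)) y" if "(x, y) \<in> ?S" "\<pi> x = \<pi> y" for k x y
      by (rule Dc.cond_mean_invariant) (simp add: S0_def that)
  qed (use f weak n in auto)
  then show False using c0 by (simp add: \<epsilon>_def)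
qed

end
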